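(* Let $M$ be a smooth Hausdorff manifold over the good topological ring $\mathbb{K}$. Then, for all $n\in\mathbb{N}$, $\mathbf{t}\in\mathbb{K}^n$ and $A\subset\{1,\dots,n\}$, the manifold $M^{A;\mathsf n}_{\mathbf t}$ is smooth over the ring $\mathbb{K}^{A;\mathsf n}_{\mathbf t}$; and if $f:M\to N$ is a smooth map over $\mathbb{K}$ between smooth Hausdorff manifolds over $\mathbb{K}$, then $f^{A;\mathsf n}_{\mathbf t}:M^{A;\mathsf n}_{\mathbf t}\to N^{A;\mathsf n}_{\mathbf t}$ is smooth over the ring $\mathbb{K}^{A;\mathsf n}_{\mathbf t}$.
   Context: A good topological ring is a commutative unital Hausdorff topological ring whose unit group is dense; topological modules are Hausdorff. Smoothness. Let $R$ be a topological ring, $E,F$ topological $R$-modules, $U\subset E$ open, $U^{[1]}:=\{(x,v,t)\in E\times E\times R\mid x\in U,\ x+tv\in U\}$. A map $f:U\to F$ is of class $C^1$ over $R$ if there is a continuous map $f^{[1]}:U^{[1]}\to F$ with $f^{[1]}(x,v,t)=t^{-1}(f(x+tv)-f(x))$ for all $t\in R^\times$; of class $C^n$ over $R$ if it is $C^1$ and $f^{[1]}$ is of class $C^{n-1}$; smooth over $R$ if it is $C^n$ for all $n$. A smooth manifold over $R$ is a topological space with a maximal atlas of charts onto open subsets of a topological $R$-module such that transition maps are smooth over $R$ (chart domains need not be connected); smooth maps of manifolds are defined via charts. The manifolds $M^{A;\mathsf n}_{\mathbf t}$. For $U$ open in a topological $\mathbb{K}$-module $V$ and $t\in\mathbb{K}$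 let $U_t:=\{(x,v)\in V\times V\mid x\in U,\ x+tv\in U\}$ (open in $V_t=V\times V$), and for $f:U\to W$ smooth over $\mathbb{K}$ let $f_t(x,v):=(f(x),f^{[1]}(x,v,t))$. For a smooth Hausdorff manifold $M$ with charts $\varphi_i:M_i\to V_i\subset V$ and transition maps $\varphi_{ij}=\varphi_i\circ\varphi_j^{-1}$, $M_t$ is obtained by gluing the sets $(V_i)_t$ along $(\varphi_{ij})_t$; it is again a smooth Hausdorff manifold over $\mathbb{K}$, modelled on $V\times V$, and a smooth map $f:M\to N$ induces $f_t:M_t\to N_t$, given in charts by the formula above. For $A=\{a_1<\dots<a_k\}\subset\mathsf n=\{1,\dots,n\}$ and $\mathbf t=(t_1,\dots,t_n)$, $M^{A;\mathsf n}_{\mathbf t}:=((M_{t_{a_1}})_{t_{a_2}}\ldots)_{t_{a_k}}$ and $f^{A;\mathsf n}_{\mathbf t}:=((f_{t_{a_1}})_{t_{a_2}}\ldots)_{t_{a_k}}$. (These are the vertex sets and vertex maps of the $n$-fold groupoid $M^{\mathsf n}_{\mathbf t}$ and of the morphism $f^{\mathsf n}_{\mathbf t}$.) The rings $\mathbb{K}^{A;\mathsf n}_{\mathbf t}$. For $B\subset\mathsf n$ put $t_B:=\prod_{i\in B}t_i$, $t_\emptyset:=1$. $\mathbb{K}^{A;\mathsf n}_{\mathbf t}$ is the free $\mathbb{K}$-module with basis $(e_B)_{B\subset A}$, with the product topology and the commutative unital ring structure given by $e_B\cdot e_C=t_{B\cap C}\,e_{B\cup C}$ (unit $e_\emptyset$).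 Meaning of the statement: the local model $V^{A;\mathsf n}_{\mathbf t}$ of $M^{A;\mathsf n}_{\mathbf t}$ is identified with $\bigoplus_{B\subset A}V e_B=V\otimes_{\mathbb{K}}\mathbb{K}^{A;\mathsf n}_{\mathbf t}$ (in one step, $(x,v)\in V_{t_k}$ is $x+v\,e_{\{k\}}$), with product topology and $\mathbb{K}^{A;\mathsf n}_{\mathbf t}$-module structure $(\lambda e_B)\cdot(v e_C)=t_{B\cap C}\,\lambda v\,e_{B\cup C}$; with the charts induced from those of $M$, $M^{A;\mathsf n}_{\mathbf t}$ is a smooth manifold over $\mathbb{K}^{A;\mathsf n}_{\mathbf t}$ modelled on this module.
   Formalization: The map f^A is shown smooth wherever its chart formula applies, and to be a map on all of M^A only if, at each point of M^A, one chart of N contains the f-images of all its vertices; without this f^A need not be defined everywhere (e.g. N two points, M two lines, t=1). *)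

theory Defs
  imports "HOL-Analysis.Analysis" "HOL-Algebra.Module"
begin

section \<open>Topological rings and modules\<close>

text \<open>Rings and modules are HOL-Algebra structures with explicit carriers, since the rings
  \<open>K\<^sup>A\<close> below depend on a finite set \<open>A\<close>. As usual in HOL-Algebra, the fields \<open>mult\<close> and \<open>one\<close>
  of a module record carry no meaning.\<close>

record 'r top_ring = "'r ring" +
  rtop :: "'r topology"

record ('r, 'e) top_module = "('r, 'e) module" +
  mtop :: "'e topology"

definition topological_ring :: "'r top_ring \<Rightarrow> bool" where
  "topological_ring R \<longleftrightarrow>
     cring R \<and> topspace (rtop R) = carrier R \<and>
     continuous_map (prod_topology (rtop R) (rtop R)) (rtop R) (\<lambda>(x, y). x \<oplus>\<^bsub>R\<^esub> y) \<and>
     continuous_map (rtop R) (rtop R) (\<lambda>x. \<ominus>\<^bsub>R\<^esub> x) \<and>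
     continuous_map (prod_topology (rtop R) (rtop R)) (rtop R) (\<lambda>(x, y). x \<otimes>\<^bsub>R\<^esub> y)"

definition good_topological_ring :: "'r top_ring \<Rightarrow> bool" where
  "good_topological_ring R \<longleftrightarrow>
     topological_ring R \<and> Hausdorff_space (rtop R) \<and> rtop R closure_of Units R = carrier R"

definition topological_module :: "'r top_ring \<Rightarrow> ('r, 'e) top_module \<Rightarrow> bool" where
  "topological_module R E \<longleftrightarrow>
     topological_ring R \<and> Module.module R E \<and>
     topspace (mtop E) = carrier E \<and> Hausdorff_space (mtop E) \<and>
     continuous_map (prod_topology (mtop E) (mtop E)) (mtop E) (\<lambda>(x, y). x \<oplus>\<^bsub>E\<^esub> y) \<and>
     continuous_map (prod_topology (rtop R) (mtop E)) (mtop E) (\<lambda>(r, x). r \<odot>\<^bsub>E\<^esub> x)"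

definition regular_module :: "'r top_ring \<Rightarrow> ('r, 'r) top_module" where
  "regular_module R =
     \<lparr>carrier = carrier R, mult = undefined, one = undefined, ring.zero = \<zero>\<^bsub>R\<^esub>, add = add R,
      smult = mult R, mtop = rtop R\<rparr>"

definition prod_module ::
  "('r, 'e) top_module \<Rightarrow> ('r, 'f) top_module \<Rightarrow> ('r, 'e \<times> 'f) top_module" where
  "prod_module E F =
     \<lparr>carrier = carrier E \<times> carrier F, mult = undefined, one = undefined,
      ring.zero = (\<zero>\<^bsub>E\<^esub>, \<zero>\<^bsub>F\<^esub>),
      add = (\<lambda>(x, y) (x', y'). (x \<oplus>\<^bsub>E\<^esub> x', y \<oplus>\<^bsub>F\<^esub> y')),
      smult = (\<lambda>r (x, y). (r \<odot>\<^bsub>E\<^esub> x, r \<odot>\<^bsub>F\<^esub> y)),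
      mtop = prod_topology (mtop E) (mtop F)\<rparr>"


section \<open>Transport of structure along injections\<close>

text \<open>Iterating \<open>E \<mapsto> E \<times> E \<times> R\<close>, or \<open>M \<mapsto> M\<^sub>t\<close>, changes the HOL type at every step. To iterate a
  variable number of times, each step is followed by a renaming of elements along an injection
  back into one fixed type. Partial functions are used throughout so that a map carries its
  domain.\<close>

definition relabel_top :: "('a \<Rightarrow> 'b) \<Rightarrow> 'a topology \<Rightarrow> 'b topology" where
  "relabel_top h T = pullback_topology (h ` topspace T) (inv_into (topspace T) h) T"

definition relabel_module ::
  "('e \<Rightarrow> 'f) \<Rightarrow> ('r, 'e) top_module \<Rightarrow> ('r, 'f) top_module" where
  "relabel_module h E = (let g = inv_into (carrier E) h in
     \<lparr>carrier = h ` carrier E, mult = undefined, one = undefined, ring.zero = h \<zero>\<^bsub>E\<^esub>,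
      add = (\<lambda>x y. h (g x \<oplus>\<^bsub>E\<^esub> g y)),
      smult = (\<lambda>r x. h (r \<odot>\<^bsub>E\<^esub> g x)),
      mtop = relabel_top h (mtop E)\<rparr>)"

definition relabel_dom :: "'a set \<Rightarrow> ('a \<Rightarrow> 'b) \<Rightarrow> ('a \<rightharpoonup> 'c) \<Rightarrow> ('b \<rightharpoonup> 'c)" where
  "relabel_dom S h f = (\<lambda>y. if y \<in> h ` S then f (inv_into S h y) else None)"


section \<open>Smooth maps on open subsets of topological modules\<close>

definition continuous_partial :: "'a topology \<Rightarrow> 'b topology \<Rightarrow> ('a \<rightharpoonup> 'b) \<Rightarrow> bool" where
  "continuous_partial S T f \<longleftrightarrow>
     openin S (dom f) \<and> continuous_map (subtopology S (dom f)) T (the \<circ> f)"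

text \<open>The set \<open>U\<^sup>[\<^sup>1\<^sup>]\<close>.\<close>

definition bracket1 ::
  "'r top_ring \<Rightarrow> ('r, 'e) top_module \<Rightarrow> 'e set \<Rightarrow> ('e \<times> 'e \<times> 'r) set" where
  "bracket1 R E U =
     {(x, v, s). x \<in> U \<and> v \<in> carrier E \<and> s \<in> carrier R \<and> x \<oplus>\<^bsub>E\<^esub> (s \<odot>\<^bsub>E\<^esub> v) \<in> U}"

abbreviation bracket_module ::
  "'r top_ring \<Rightarrow> ('r, 'e) top_module \<Rightarrow> ('r, 'e \<times> 'e \<times> 'r) top_module" where
  "bracket_module R E \<equiv> prod_module E (prod_module E (regular_module R))"

text \<open>\<open>h\<close> is an admissible \<open>f\<^sup>[\<^sup>1\<^sup>]\<close>.\<close>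

definition is_diff_quot ::
  "'r top_ring \<Rightarrow> ('r, 'e) top_module \<Rightarrow> ('r, 'f) top_module \<Rightarrow>
   ('e \<rightharpoonup> 'f) \<Rightarrow> ('e \<times> 'e \<times> 'r \<rightharpoonup> 'f) \<Rightarrow> bool" where
  "is_diff_quot R E F f h \<longleftrightarrow>
     dom h = bracket1 R E (dom f) \<and>
     continuous_partial (mtop (bracket_module R E)) (mtop F) h \<and>
     (\<forall>x v s. (x, v, s) \<in> bracket1 R E (dom f) \<and> s \<in> Units R \<longrightarrow>
        h (x, v, s) =
          Some (inv\<^bsub>R\<^esub> s \<odot>\<^bsub>F\<^esub> (the (f (x \<oplus>\<^bsub>E\<^esub> (s \<odot>\<^bsub>E\<^esub> v))) \<ominus>\<^bsub>F\<^esub> the (f x))))"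

text \<open>One type housing all iterates of \<open>E \<mapsto> E \<times> E \<times> R\<close>.\<close>

datatype ('e, 'r) tup = Leaf 'e | Node "('e, 'r) tup" "('e, 'r) tup" 'r

definition node :: "('e, 'r) tup \<times> ('e, 'r) tup \<times> 'r \<Rightarrow> ('e, 'r) tup" where
  "node = (\<lambda>(x, v, s). Node x v s)"

text \<open>Class \<open>C\<^sup>n\<close>, with \<open>C\<^sup>0\<close> meaning continuous. The continuity clause is redundant for \<open>n \<ge> 1\<close>,
  because \<open>f (x + v) = f x + f\<^sup>[\<^sup>1\<^sup>] (x, v, 1)\<close>. If the unit group of \<open>R\<close> is dense, \<open>f\<^sup>[\<^sup>1\<^sup>]\<close> is unique;
  over other rings (possibly \<open>K\<^sup>A\<close> below), \<open>C\<^sup>n\<close> asks for some continuous \<open>f\<^sup>[\<^sup>1\<^sup>]\<close> that is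
  \<open>C\<^sup>n\<^sup>-\<^sup>1\<close>.\<close>

primrec class_C ::
  "nat \<Rightarrow> 'r top_ring \<Rightarrow> ('r, ('e, 'r) tup) top_module \<Rightarrow> ('r, 'f) top_module \<Rightarrow>
   (('e, 'r) tup \<rightharpoonup> 'f) \<Rightarrow> bool" where
  "class_C 0 = (\<lambda>R E F f. continuous_partial (mtop E) (mtop F) f)"
| "class_C (Suc n) = (\<lambda>R E F f.
     continuous_partial (mtop E) (mtop F) f \<and>
     (\<exists>h. is_diff_quot R E F f h \<and>
          class_C n R (relabel_module node (bracket_module R E)) F
            (relabel_dom (carrier (bracket_module R E)) node h)))"

definition smooth ::
  "'r top_ring \<Rightarrow> ('r, 'e) top_module \<Rightarrow> ('r, 'f) top_module \<Rightarrow> ('e \<rightharpoonup> 'f) \<Rightarrow> bool" where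
  "smooth R E F f \<longleftrightarrow>
     (\<forall>n. class_C n R (relabel_module Leaf E) F (relabel_dom (carrier E) Leaf f))"


section \<open>Smooth manifolds\<close>

definition pinv :: "('a \<rightharpoonup> 'b) \<Rightarrow> ('b \<rightharpoonup> 'a)" where
  "pinv \<phi> = (\<lambda>y. if y \<in> ran \<phi> then Some (THE x. \<phi> x = Some y) else None)"

definition is_chart :: "('r, 'e) top_module \<Rightarrow> 'p topology \<Rightarrow> ('p \<rightharpoonup> 'e) \<Rightarrow> bool" where
  "is_chart E X \<phi> \<longleftrightarrow>
     openin X (dom \<phi>) \<and> openin (mtop E) (ran \<phi>) \<and>
     homeomorphic_map (subtopology X (dom \<phi>)) (subtopology (mtop E) (ran \<phi>)) (the \<circ> \<phi>)"

definition smooth_atlas ::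
  "'r top_ring \<Rightarrow> ('r, 'e) top_module \<Rightarrow> 'p topology \<Rightarrow> ('p \<rightharpoonup> 'e) set \<Rightarrow> bool" where
  "smooth_atlas R E X \<A> \<longleftrightarrow>
     topological_module R E \<and> (\<forall>\<phi>\<in>\<A>. is_chart E X \<phi>) \<and> (\<Union>\<phi>\<in>\<A>. dom \<phi>) = topspace X \<and>
     (\<forall>\<phi>\<in>\<A>. \<forall>\<psi>\<in>\<A>. smooth R E E (\<phi> \<circ>\<^sub>m pinv \<psi>))"

definition smooth_manifold ::
  "'r top_ring \<Rightarrow> ('r, 'e) top_module \<Rightarrow> 'p topology \<Rightarrow> ('p \<rightharpoonup> 'e) set \<Rightarrow> bool" where
  "smooth_manifold R E X \<A> \<longleftrightarrow>
     smooth_atlas R E X \<A> \<and> (\<forall>\<B>. smooth_atlas R E X \<B> \<and> \<A> \<subseteq> \<B> \<longrightarrow> \<B> = \<A>)"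

definition smooth_partial_map ::
  "'r top_ring \<Rightarrow> ('r, 'e) top_module \<Rightarrow> 'p topology \<Rightarrow> ('p \<rightharpoonup> 'e) set \<Rightarrow>
   ('r, 'f) top_module \<Rightarrow> 'q topology \<Rightarrow> ('q \<rightharpoonup> 'f) set \<Rightarrow> ('p \<rightharpoonup> 'q) \<Rightarrow> bool" where
  "smooth_partial_map R E X \<A> F Y \<B> f \<longleftrightarrow>
     continuous_partial X Y f \<and> (\<forall>\<phi>\<in>\<A>. \<forall>\<psi>\<in>\<B>. smooth R E F (\<psi> \<circ>\<^sub>m f \<circ>\<^sub>m pinv \<phi>))"

definition smooth_map ::
  "'r top_ring \<Rightarrow> ('r, 'e) top_module \<Rightarrow> 'p topology \<Rightarrow> ('p \<rightharpoonup> 'e) set \<Rightarrow>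
   ('r, 'f) top_module \<Rightarrow> 'q topology \<Rightarrow> ('q \<rightharpoonup> 'f) set \<Rightarrow> ('p \<rightharpoonup> 'q) \<Rightarrow> bool" where
  "smooth_map R E X \<A> F Y \<B> f \<longleftrightarrow>
     smooth_partial_map R E X \<A> F Y \<B> f \<and> dom f = topspace X"


section \<open>The manifold \<open>M\<^sub>t\<close> and the map \<open>f\<^sub>t\<close>\<close>

text \<open>The set \<open>U\<^sub>t\<close> and the map \<open>f\<^sub>t\<close> on it. The map \<open>f\<^sup>[\<^sup>1\<^sup>]\<close> is unique if \<open>R\<close> is good.\<close>

definition tset ::
  "('r, 'e) top_module \<Rightarrow> 'r \<Rightarrow> 'e set \<Rightarrow> ('e \<times> 'e) set" where
  "tset E t U = {(x, v). x \<in> U \<and> v \<in> carrier E \<and> x \<oplus>\<^bsub>E\<^esub> (t \<odot>\<^bsub>E\<^esub> v) \<in> U}"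

definition tmap ::
  "'r top_ring \<Rightarrow> ('r, 'e) top_module \<Rightarrow> ('r, 'f) top_module \<Rightarrow> 'r \<Rightarrow>
   ('e \<rightharpoonup> 'f) \<Rightarrow> ('e \<times> 'e \<rightharpoonup> 'f \<times> 'f)" where
  "tmap R E F t f = (\<lambda>(x, v).
     if (x, v) \<in> tset E t (dom f)
     then Some (the (f x), the ((THE h. is_diff_quot R E F f h) (x, v, t)))
     else None)"

text \<open>A space with an indexed family of charts; \<open>M\<^sub>t\<close> has charts indexed by the charts of \<open>M\<close>.\<close>

record ('i, 'p, 'e) charted =
  points :: "'p topology"
  index :: "'i set"
  chart :: "'i \<Rightarrow> 'p \<rightharpoonup> 'e"

definition tunion ::
  "('r, 'e) top_module \<Rightarrow> 'r \<Rightarrow> ('i, 'p, 'e) charted \<Rightarrow> ('i \<times> 'e \<times> 'e) set" where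
  "tunion E t M = (SIGMA i:index M. tset E t (ran (chart M i)))"

definition tglue ::
  "'r top_ring \<Rightarrow> ('r, 'e) top_module \<Rightarrow> 'r \<Rightarrow> ('i, 'p, 'e) charted \<Rightarrow>
   (('i \<times> 'e \<times> 'e) \<times> ('i \<times> 'e \<times> 'e)) set" where
  "tglue R E t M =
     {((j, a), (i, b)). (j, a) \<in> tunion E t M \<and> (i, b) \<in> tunion E t M \<and>
        tmap R E E t (chart M i \<circ>\<^sub>m pinv (chart M j)) a = Some b}"

text \<open>\<open>M\<^sub>t\<close>: points are equivalence classes, the topology is the quotient topology of the
  disjoint union, and the chart with index \<open>i\<close> sends the class of \<open>(i, a)\<close> to \<open>a\<close>.\<close>

definition tmanifold ::
  "'r top_ring \<Rightarrow> ('r, 'e) top_module \<Rightarrow> 'r \<Rightarrow> ('i, 'p, 'e) charted \<Rightarrow>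
   ('i, ('i \<times> 'e \<times> 'e) set, 'e \<times> 'e) charted" where
  "tmanifold R E t M = (let Q = tunion E t M // tglue R E t M in
     \<lparr>points = topology (\<lambda>W. W \<subseteq> Q \<and>
        (\<forall>i\<in>index M. openin (mtop (prod_module E E))
           {a \<in> tset E t (ran (chart M i)). tglue R E t M `` {(i, a)} \<in> W})),
      index = index M,
      chart = (\<lambda>i c. if c \<in> Q \<and> (\<exists>a. (i, a) \<in> c) then Some (THE a. (i, a) \<in> c) else None)\<rparr>)"

text \<open>\<open>f\<^sub>t\<close> is given by \<open>(\<psi>\<^sub>j \<circ> f \<circ> \<phi>\<^sub>i\<inverse>)\<^sub>t\<close> in the charts of \<open>M\<^sub>t\<close> and \<open>N\<^sub>t\<close> with indices \<open>i\<close> and \<open>j\<close>. It is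
  defined at those points of \<open>M\<^sub>t\<close> where this applies for some \<open>i\<close> and \<open>j\<close>.\<close>

definition tmanifold_map ::
  "'r top_ring \<Rightarrow> ('r, 'e) top_module \<Rightarrow> ('r, 'f) top_module \<Rightarrow> 'r \<Rightarrow>
   ('i, 'p, 'e) charted \<Rightarrow> ('j, 'q, 'f) charted \<Rightarrow> ('p \<rightharpoonup> 'q) \<Rightarrow>
   (('i \<times> 'e \<times> 'e) set \<rightharpoonup> ('j \<times> 'f \<times> 'f) set)" where
  "tmanifold_map R E F t M N f = (\<lambda>c.
     let P = (\<lambda>d. c \<in> topspace (points (tmanifold R E t M)) \<and>
       (\<exists>i\<in>index M. \<exists>j\<in>index N. \<exists>a b. (i, a) \<in> c \<and>
          tmap R E F t (chart N j \<circ>\<^sub>m f \<circ>\<^sub>m pinv (chart M i)) a = Some b \<and>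
          d = tglue R F t N `` {(j, b)}))
     in if \<exists>d. P d then Some (THE d. P d) else None)"


section \<open>The rings \<open>K\<^sup>A\<close> and the modules \<open>V\<^sup>A\<close>\<close>

text \<open>A family \<open>x\<close> indexed by the subsets of \<open>A\<close> stands for \<open>\<Sum>B\<subseteq>A. x B e\<^sub>B\<close>.\<close>

definition cube_ring :: "'r top_ring \<Rightarrow> (nat \<Rightarrow> 'r) \<Rightarrow> nat set \<Rightarrow> (nat set \<Rightarrow> 'r) top_ring" where
  "cube_ring K t A =
     \<lparr>carrier = (\<Pi>\<^sub>E B\<in>Pow A. carrier K),
      mult = (\<lambda>x y. \<lambda>D\<in>Pow A. finsum K
                (\<lambda>(B, C). finprod K t (B \<inter> C) \<otimes>\<^bsub>K\<^esub> (x B \<otimes>\<^bsub>K\<^esub> y C))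
                {(B, C). B \<subseteq> A \<and> C \<subseteq> A \<and> B \<union> C = D}),
      one = (\<lambda>B\<in>Pow A. if B = {} then \<one>\<^bsub>K\<^esub> else \<zero>\<^bsub>K\<^esub>),
      ring.zero = (\<lambda>B\<in>Pow A. \<zero>\<^bsub>K\<^esub>),
      add = (\<lambda>x y. \<lambda>B\<in>Pow A. x B \<oplus>\<^bsub>K\<^esub> y B),
      rtop = product_topology (\<lambda>_. rtop K) (Pow A)\<rparr>"

text \<open>\<open>V\<^sup>A\<close> as a module over \<open>K\<close>, and then as a module over \<open>K\<^sup>A\<close>.\<close>

definition cube_space :: "('r, 'e) top_module \<Rightarrow> nat set \<Rightarrow> ('r, nat set \<Rightarrow> 'e) top_module" where
  "cube_space V A =
     \<lparr>carrier = (\<Pi>\<^sub>E B\<in>Pow A. carrier V), mult = undefined, one = undefined,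
      ring.zero = (\<lambda>B\<in>Pow A. \<zero>\<^bsub>V\<^esub>),
      add = (\<lambda>x y. \<lambda>B\<in>Pow A. x B \<oplus>\<^bsub>V\<^esub> y B),
      smult = (\<lambda>r x. \<lambda>B\<in>Pow A. r \<odot>\<^bsub>V\<^esub> x B),
      mtop = product_topology (\<lambda>_. mtop V) (Pow A)\<rparr>"

definition cube_module ::
  "'r top_ring \<Rightarrow> (nat \<Rightarrow> 'r) \<Rightarrow> ('r, 'e) top_module \<Rightarrow> nat set \<Rightarrow>
   (nat set \<Rightarrow> 'r, nat set \<Rightarrow> 'e) top_module" where
  "cube_module K t V A =
     \<lparr>carrier = carrier (cube_space V A), mult = undefined, one = undefined,
      ring.zero = \<zero>\<^bsub>cube_space V A\<^esub>, add = add (cube_space V A),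
      smult = (\<lambda>r x. \<lambda>D\<in>Pow A. finsum V
                (\<lambda>(B, C). (finprod K t (B \<inter> C) \<otimes>\<^bsub>K\<^esub> r B) \<odot>\<^bsub>V\<^esub> x C)
                {(B, C). B \<subseteq> A \<and> C \<subseteq> A \<and> B \<union> C = D}),
      mtop = mtop (cube_space V A)\<rparr>"


section \<open>The iterated manifolds \<open>M\<^sup>A\<close> and maps \<open>f\<^sup>A\<close>\<close>

text \<open>\<open>(x, v)\<close> is \<open>x + v e\<^sub>k\<close>, where \<open>x\<close> and \<open>v\<close> are in \<open>V\<^sup>A\<close> and \<open>k \<notin> A\<close>.\<close>

definition join :: "nat set \<Rightarrow> nat \<Rightarrow> (nat set \<Rightarrow> 'e) \<times> (nat set \<Rightarrow> 'e) \<Rightarrow> (nat set \<Rightarrow> 'e)" where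
  "join A k = (\<lambda>(x, v). \<lambda>B\<in>Pow (insert k A). if k \<in> B then v (B - {k}) else x B)"

text \<open>Renaming the points by \<open>h\<close> and the elements of the model space by \<open>c\<close>.\<close>

definition relabel_charted ::
  "('p \<Rightarrow> 'q) \<Rightarrow> ('e \<Rightarrow> 'f) \<Rightarrow> ('i, 'p, 'e) charted \<Rightarrow> ('i, 'q, 'f) charted" where
  "relabel_charted h c M =
     \<lparr>points = relabel_top h (points M), index = index M,
      chart = (\<lambda>i. map_option c \<circ> relabel_dom (topspace (points M)) h (chart M i))\<rparr>"

text \<open>Points of \<open>M\<close> itself are tagged \<open>Inl\<close>, points of \<open>M\<^sup>A\<close> for \<open>A \<noteq> {}\<close> are tagged \<open>Inr\<close>.\<close>

type_synonym ('i, 'p, 'e) cube_point = "'p + ('i \<times> (nat set \<Rightarrow> 'e)) set"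

definition cube_label ::
  "nat set \<Rightarrow> nat \<Rightarrow> ('i \<times> (nat set \<Rightarrow> 'e) \<times> (nat set \<Rightarrow> 'e)) set \<Rightarrow> ('i, 'p, 'e) cube_point" where
  "cube_label A k c = Inr ((\<lambda>(i, a). (i, join A k a)) ` c)"

text \<open>The list contains the elements of \<open>A\<close> in decreasing order, so its head is the index of the
  last step.\<close>

primrec cube_iter ::
  "'r top_ring \<Rightarrow> (nat \<Rightarrow> 'r) \<Rightarrow> ('r, 'e) top_module \<Rightarrow> ('i, 'p, 'e) charted \<Rightarrow> nat list \<Rightarrow>
   ('i, ('i, 'p, 'e) cube_point, nat set \<Rightarrow> 'e) charted" where
  "cube_iter K t V M [] = relabel_charted Inl (\<lambda>x. \<lambda>B\<in>Pow {}. x) M"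
| "cube_iter K t V M (k # ks) =
     relabel_charted (cube_label (set ks) k) (join (set ks) k)
       (tmanifold K (cube_space V (set ks)) (t k) (cube_iter K t V M ks))"

primrec cube_map_iter ::
  "'r top_ring \<Rightarrow> (nat \<Rightarrow> 'r) \<Rightarrow> ('r, 'e) top_module \<Rightarrow> ('i, 'p, 'e) charted \<Rightarrow>
   ('r, 'f) top_module \<Rightarrow> ('j, 'q, 'f) charted \<Rightarrow> ('p \<rightharpoonup> 'q) \<Rightarrow> nat list \<Rightarrow>
   (('i, 'p, 'e) cube_point \<rightharpoonup> ('j, 'q, 'f) cube_point)" where
  "cube_map_iter K t V M W N f [] =
     map_option Inl \<circ> relabel_dom (topspace (points M)) Inl f"
| "cube_map_iter K t V M W N f (k # ks) =
     (let E = cube_space V (set ks); F = cube_space W (set ks);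
          M' = cube_iter K t V M ks; N' = cube_iter K t W N ks
      in map_option (cube_label (set ks) k) \<circ>
         relabel_dom (topspace (points (tmanifold K E (t k) M'))) (cube_label (set ks) k)
           (tmanifold_map K E F (t k) M' N' (cube_map_iter K t V M W N f ks)))"

definition charted_of :: "'p topology \<Rightarrow> ('p \<rightharpoonup> 'e) set \<Rightarrow> ('p \<rightharpoonup> 'e, 'p, 'e) charted" where
  "charted_of X \<A> = \<lparr>points = X, index = \<A>, chart = (\<lambda>\<phi>. \<phi>)\<rparr>"

definition cube_manifold ::
  "'r top_ring \<Rightarrow> (nat \<Rightarrow> 'r) \<Rightarrow> nat set \<Rightarrow> ('r, 'e) top_module \<Rightarrow> 'p topology \<Rightarrow> ('p \<rightharpoonup> 'e) set \<Rightarrow>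
   ('p \<rightharpoonup> 'e, ('p \<rightharpoonup> 'e, 'p, 'e) cube_point, nat set \<Rightarrow> 'e) charted" where
  "cube_manifold K t A V X \<A> =
     cube_iter K t V (charted_of X \<A>) (rev (sorted_list_of_set A))"

abbreviation cube_points where
  "cube_points K t A V X \<A> \<equiv> points (cube_manifold K t A V X \<A>)"

text \<open>The charts of \<open>M\<^sup>A\<close> induced from those of \<open>M\<close>.\<close>

definition cube_charts ::
  "'r top_ring \<Rightarrow> (nat \<Rightarrow> 'r) \<Rightarrow> nat set \<Rightarrow> ('r, 'e) top_module \<Rightarrow> 'p topology \<Rightarrow> ('p \<rightharpoonup> 'e) set \<Rightarrow>
   (('p \<rightharpoonup> 'e, 'p, 'e) cube_point \<rightharpoonup> (nat set \<Rightarrow> 'e)) set" where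
  "cube_charts K t A V X \<A> =
     chart (cube_manifold K t A V X \<A>) ` index (cube_manifold K t A V X \<A>)"

definition cube_map ::
  "'r top_ring \<Rightarrow> (nat \<Rightarrow> 'r) \<Rightarrow> nat set \<Rightarrow> ('r, 'e) top_module \<Rightarrow> 'p topology \<Rightarrow> ('p \<rightharpoonup> 'e) set \<Rightarrow>
   ('r, 'f) top_module \<Rightarrow> 'q topology \<Rightarrow> ('q \<rightharpoonup> 'f) set \<Rightarrow> ('p \<rightharpoonup> 'q) \<Rightarrow>
   (('p \<rightharpoonup> 'e, 'p, 'e) cube_point \<rightharpoonup> ('q \<rightharpoonup> 'f, 'q, 'f) cube_point)" where
  "cube_map K t A V X \<A> W Y \<B> f =
     cube_map_iter K t V (charted_of X \<A>) W (charted_of Y \<B>) f (rev (sorted_list_of_set A))"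

text \<open>An element of \<open>U\<^sup>A\<close> encodes \<open>2\<^sup>|\<^sup>A\<^sup>|\<close> points of \<open>U\<close>, its vertices; in one step the vertices of
  \<open>(x, v)\<close> are \<open>x\<close> and \<open>x + t v\<close>. The local formula for \<open>f\<^sup>A\<close> at a point of \<open>M\<^sup>A\<close> needs one chart
  of \<open>N\<close> containing the images of all vertices of that point. Since chart domains need not be
  connected, such a chart normally exists. But let
  \<open>K = \<real>\<close>, let \<open>f\<close> send each of two disjoint lines to one of two points (a manifold \<open>N\<close> modelled on
  \<open>{0}\<close>): \<open>N\<^sub>1\<close> has two points, whereas a map \<open>f\<^sub>1\<close> on \<open>M\<^sub>1 = M \<times> M\<close> with the prescribed vertices
  would need four.\<close>

definition vertex ::
  "'r top_ring \<Rightarrow> (nat \<Rightarrow> 'r) \<Rightarrow> ('r, 'e) top_module \<Rightarrow> (nat set \<Rightarrow> 'e) \<Rightarrow> nat set \<Rightarrow> 'e" where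
  "vertex K t V z B = (\<Oplus>\<^bsub>V\<^esub>C\<in>Pow B. finprod K t C \<odot>\<^bsub>V\<^esub> z C)"

definition vertices_in_charts ::
  "'r top_ring \<Rightarrow> (nat \<Rightarrow> 'r) \<Rightarrow> nat set \<Rightarrow> ('r, 'e) top_module \<Rightarrow> ('p \<rightharpoonup> 'e) set \<Rightarrow>
   ('q \<rightharpoonup> 'f) set \<Rightarrow> ('p \<rightharpoonup> 'q) \<Rightarrow> bool" where
  "vertices_in_charts K t A V \<A> \<B> f \<longleftrightarrow>
     (\<forall>\<phi>\<in>\<A>. \<forall>z\<in>carrier (cube_space V A). (\<forall>B\<in>Pow A. vertex K t V z B \<in> ran \<phi>) \<longrightarrow>
        (\<exists>\<psi>\<in>\<B>. \<forall>B\<in>Pow A. vertex K t V z B \<in> dom (\<psi> \<circ>\<^sub>m f \<circ>\<^sub>m pinv \<phi>)))"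

end

theory Submission
  imports Defs
begin

text \<open>
  Write \<open>T\<close> for the operation that sends a map \<open>f\<close>, smooth over \<open>K\<close> on an open subset of a topological
  \<open>K\<close>-module, to the iterate \<open>f^A\<close> of \<open>f_t (x, v) = (f x, f^[1] (x, v, t))\<close>. Everything rests on three
  properties of \<open>T\<close>. It is a functor: it maps smooth maps over \<open>K\<close> to smooth maps over \<open>K\<close> and preserves
  composition, restriction and pairing (\<open>sm_T\<close>, \<open>T_comp\<close>, \<open>T_mono\<close>, \<open>T_ppair\<close>). It acts coordinatewise on continuous
  linear maps (\<open>T_lin\<close>). It turns the scalar multiplication \<open>K \<times> V \<rightarrow> V\<close> into the action of \<open>K^A\<close> on \<open>V^A\<close>
  (\<open>T_smul\<close>). As a first consequence, identities between polynomial maps over \<open>K\<close>, such as \<open>(r s) x = r (s x)\<close>,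
  are transported to \<open>K^A\<close>, which makes \<open>K^A\<close> a commutative ring and \<open>V^A\<close> a module over it.

  The local form of the theorem follows by applying \<open>T\<close> to the identity
  \<open>f (x + s v) = f x + s f^[1] (x, v, s)\<close>. Over the good ring \<open>K\<close> it holds for all scalars \<open>s\<close>, not only for units
  (\<open>diff_quot_formula\<close>). The result is \<open>f^A (x + s v) = f^A x + s h (x, v, s)\<close> for all \<open>s\<close> in \<open>K^A\<close>,
  where \<open>h = (f^[1])^A\<close> is continuous: so \<open>h\<close> is a difference quotient of \<open>f^A\<close> over \<open>K^A\<close>
  (\<open>T_diff_quot\<close>). As \<open>f^[1]\<close> is again smooth over \<open>K\<close>, induction on \<open>n\<close> shows that \<open>f^A\<close> is of class \<open>C^n\<close> over
  \<open>K^A\<close> for every \<open>n\<close> (\<open>cls_T\<close>).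

  Globally, the transition maps of \<open>M_t\<close> are exactly the maps \<open>(\<phi>_ij)_t\<close>, because functoriality makes the gluing
  relation an equivalence (\<open>trans_map_Mt\<close>), and the local representatives of \<open>f_t\<close> are exactly
  the maps \<open>(\<psi> f \<phi>^-1)_t\<close> (\<open>local_map_Mt\<close>). Iterating, those of \<open>M^A\<close> and \<open>f^A\<close> are images under \<open>T\<close> of those of
  \<open>M\<close> and \<open>f\<close>, and the local form applies. The map \<open>f^A\<close> is everywhere defined if the vertex condition holds,
  since the domain of \<open>T f\<close> consists of the points all of whose vertices lie in the domain of \<open>f\<close> (\<open>dom_T\<close>).
\<close>

section \<open>Partial maps\<close>

text \<open>A function on a set, as a partial map. Composing a partial map with it is precomposition, which
  keeps track of domains.\<close>

definition pfun :: "'a set \<Rightarrow> ('a \<Rightarrow> 'b) \<Rightarrow> ('a \<rightharpoonup> 'b)" where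
  "pfun S g = (\<lambda>x. if x \<in> S then Some (g x) else None)"

definition ppair :: "('a \<rightharpoonup> 'b) \<Rightarrow> ('a \<rightharpoonup> 'c) \<Rightarrow> ('a \<rightharpoonup> 'b \<times> 'c)" where
  "ppair f g = (\<lambda>x. case f x of None \<Rightarrow> None | Some a \<Rightarrow> map_option (Pair a) (g x))"

lemma dom_pfun [simp]: "dom (pfun S g) = S"
  by (auto simp: pfun_def dom_def)

lemma pfun_eq_Some: "pfun S g x = Some y \<longleftrightarrow> x \<in> S \<and> y = g x"
  by (auto simp: pfun_def)

lemma pfun_in [simp]: "x \<in> S \<Longrightarrow> pfun S g x = Some (g x)"
  by (simp add: pfun_def)

lemma pfun_notin [simp]: "x \<notin> S \<Longrightarrow> pfun S g x = None"
  by (simp add: pfun_def)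

lemma ppair_eq_Some: "ppair f g x = Some w \<longleftrightarrow> f x = Some (fst w) \<and> g x = Some (snd w)"
  by (cases w) (auto simp: ppair_def split: option.splits)

lemma dom_ppair [simp]: "dom (ppair f g) = dom f \<inter> dom g"
  by (auto simp: ppair_def dom_def split: option.splits)

lemma ppair_apply: "x \<in> dom f \<Longrightarrow> x \<in> dom g \<Longrightarrow> ppair f g x = Some (the (f x), the (g x))"
  by (auto simp: ppair_def)

lemma map_comp_pfun: "(f \<circ>\<^sub>m pfun S g) x = (if x \<in> S then f (g x) else None)"
  by (simp add: map_comp_def)

lemma dom_map_comp_pfun [simp]: "dom (f \<circ>\<^sub>m pfun S g) = {x \<in> S. g x \<in> dom f}"
  by (auto simp: map_comp_def pfun_def dom_def split: if_splits)

lemma dom_map_option [simp]: "dom (map_option c \<circ> f) = dom f"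
  by (auto simp: dom_def)

lemma relabel_dom_pfun: "relabel_dom S h f = f \<circ>\<^sub>m pfun (h ` S) (inv_into S h)"
  by (auto simp: relabel_dom_def map_comp_def pfun_def)

lemma pfun_comp_pfun: "g ` S \<subseteq> T \<Longrightarrow> pfun T f \<circ>\<^sub>m pfun S g = pfun S (f \<circ> g)"
  by (rule ext) (auto simp: map_comp_pfun pfun_def)

text \<open>Continuity with preimages taken in the whole space: as no subspace topology occurs, composition becomes
  immediate.\<close>

lemma continuous_partial_iff:
  "continuous_partial S T f \<longleftrightarrow> dom f \<subseteq> topspace S \<and> ran f \<subseteq> topspace T \<and>
     (\<forall>W. openin T W \<longrightarrow> openin S {x \<in> dom f. the (f x) \<in> W})" (is "_ \<longleftrightarrow> ?R")
proof
  assume L: "continuous_partial S T f"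
  then have o: "openin S (dom f)" and c: "continuous_map (subtopology S (dom f)) T (the \<circ> f)"
    by (auto simp: continuous_partial_def)
  have d: "dom f \<subseteq> topspace S" using o by (rule openin_subset)
  have "openin S {x \<in> dom f. the (f x) \<in> W}" if "openin T W" for W
  proof -
    have "openin (subtopology S (dom f)) {x \<in> topspace (subtopology S (dom f)). (the \<circ> f) x \<in> W}"
      using c that by (auto simp: continuous_map)
    moreover have "{x \<in> topspace (subtopology S (dom f)). (the \<circ> f) x \<in> W} = {x \<in> dom f. the (f x) \<in> W}"
      using d by auto
    ultimately show ?thesis using o by (simp add: openin_open_subtopology)
  qed
  moreover have "ran f \<subseteq> topspace T"
    using c d by (force simp: continuous_map_def ran_def Pi_iff dom_def)
  ultimately show ?R using d by auto
next
  assume R: ?R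
  have o: "openin S (dom f)"
  proof -
    have "openin S {x \<in> dom f. the (f x) \<in> topspace T}" using R by blast
    moreover have "{x \<in> dom f. the (f x) \<in> topspace T} = dom f" using R by (auto simp: ran_def)
    ultimately show ?thesis by simp
  qed
  moreover have "continuous_map (subtopology S (dom f)) T (the \<circ> f)"
    unfolding continuous_map
  proof (intro conjI allI impI)
    show "(the \<circ> f) ` topspace (subtopology S (dom f)) \<subseteq> topspace T"
      using R by (auto simp: ran_def)
    fix W assume "openin T W"
    moreover have "{x \<in> topspace (subtopology S (dom f)). (the \<circ> f) x \<in> W} = {x \<in> dom f. the (f x) \<in> W}"
      using R by auto
    ultimately show "openin (subtopology S (dom f)) {x \<in> topspace (subtopology S (dom f)). (the \<circ> f) x \<in> W}"
      using R o \<open>openin T W\<close> by (simp add: openin_open_subtopology)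
  qed
  ultimately show "continuous_partial S T f" by (simp add: continuous_partial_def)
qed

lemma continuous_partial_comp:
  assumes f: "continuous_partial S T f" and g: "continuous_partial T U g"
  shows "continuous_partial S U (g \<circ>\<^sub>m f)"
  unfolding continuous_partial_iff
proof (intro conjI allI impI)
  show "dom (g \<circ>\<^sub>m f) \<subseteq> topspace S"
    using f by (auto simp: continuous_partial_iff map_comp_def split: option.splits)
  show "ran (g \<circ>\<^sub>m f) \<subseteq> topspace U"
    using g by (force simp: continuous_partial_iff map_comp_def ran_def split: option.splits)
  fix W assume "openin U W"
  then have "openin T {y \<in> dom g. the (g y) \<in> W}" using g by (simp add: continuous_partial_iff)
  then have "openin S {x \<in> dom f. the (f x) \<in> {y \<in> dom g. the (g y) \<in> W}}"
    using f unfolding continuous_partial_iff by blast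
  moreover have "{x \<in> dom f. the (f x) \<in> {y \<in> dom g. the (g y) \<in> W}}
      = {x \<in> dom (g \<circ>\<^sub>m f). the ((g \<circ>\<^sub>m f) x) \<in> W}"
    by (auto simp: map_comp_def split: option.splits)
  ultimately show "openin S {x \<in> dom (g \<circ>\<^sub>m f). the ((g \<circ>\<^sub>m f) x) \<in> W}" by simp
qed

lemma continuous_partial_pfun:
  assumes "continuous_map S T g" shows "continuous_partial S T (pfun (topspace S) g)"
proof -
  have "{x \<in> topspace S. the (pfun (topspace S) g x) \<in> W} = {x \<in> topspace S. g x \<in> W}" for W
    by auto
  then show ?thesis
    using assms by (auto simp: continuous_partial_iff continuous_map ran_def pfun_eq_Some)
qed

lemma continuous_partial_post:
  assumes f: "continuous_partial S T f" and L: "continuous_map T U L"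
  shows "continuous_partial S U (map_option L \<circ> f)"
proof -
  have "map_option L \<circ> f = pfun (topspace T) L \<circ>\<^sub>m f"
    using f by (force simp: continuous_partial_iff map_comp_def pfun_def ran_def fun_eq_iff split: option.splits)
  then show ?thesis using continuous_partial_comp[OF f continuous_partial_pfun[OF L]] by simp
qed

lemma continuous_partial_ppair:
  assumes f: "continuous_partial S T f" and g: "continuous_partial S U g"
  shows "continuous_partial S (prod_topology T U) (ppair f g)"
proof -
  have o: "openin S (dom f \<inter> dom g)" using f g by (auto simp: continuous_partial_def)
  have "continuous_map (subtopology S (dom f \<inter> dom g)) T (the \<circ> f)"
       "continuous_map (subtopology S (dom f \<inter> dom g)) U (the \<circ> g)"
    using f g by (auto simp: continuous_partial_def intro: continuous_map_from_subtopology_mono)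
  then have "continuous_map (subtopology S (dom f \<inter> dom g)) (prod_topology T U) (\<lambda>x. ((the \<circ> f) x, (the \<circ> g) x))"
    by (rule continuous_map_pairedI)
  then have "continuous_map (subtopology S (dom f \<inter> dom g)) (prod_topology T U) (the \<circ> ppair f g)"
    by (rule continuous_map_eq) (auto simp: ppair_apply)
  then show ?thesis using o by (simp add: continuous_partial_def)
qed

section \<open>Topological modules, linear and affine maps\<close>

lemma topological_moduleD:
  assumes "topological_module R E"
  shows "topological_ring R" "Module.module R E" "topspace (mtop E) = carrier E"
    "Hausdorff_space (mtop E)" "cring R" "abelian_group E"
  using assms by (auto simp: topological_module_def Module.module_def)

lemma topological_ringD:
  assumes "topological_ring R"
  shows "cring R" "topspace (rtop R) = carrier R"
  using assms by (auto simp: topological_ring_def)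

lemma continuous_add:
  assumes "topological_module R E" "continuous_map T (mtop E) f" "continuous_map T (mtop E) g"
  shows "continuous_map T (mtop E) (\<lambda>z. f z \<oplus>\<^bsub>E\<^esub> g z)"
  using continuous_map_compose[OF continuous_map_pairedI[OF assms(2,3)],
      of "mtop E" "\<lambda>(x, y). x \<oplus>\<^bsub>E\<^esub> y"] assms(1)
  by (simp add: topological_module_def o_def)

lemma continuous_smult:
  assumes "topological_module R E" "continuous_map T (rtop R) f" "continuous_map T (mtop E) g"
  shows "continuous_map T (mtop E) (\<lambda>z. f z \<odot>\<^bsub>E\<^esub> g z)"
  using continuous_map_compose[OF continuous_map_pairedI[OF assms(2,3)],
      of "mtop E" "\<lambda>(x, y). x \<odot>\<^bsub>E\<^esub> y"] assms(1)
  by (simp add: topological_module_def o_def)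

lemma prod_module_simps [simp]:
  "carrier (prod_module E F) = carrier E \<times> carrier F"
  "\<zero>\<^bsub>prod_module E F\<^esub> = (\<zero>\<^bsub>E\<^esub>, \<zero>\<^bsub>F\<^esub>)"
  "(x, y) \<oplus>\<^bsub>prod_module E F\<^esub> (x', y') = (x \<oplus>\<^bsub>E\<^esub> x', y \<oplus>\<^bsub>F\<^esub> y')"
  "r \<odot>\<^bsub>prod_module E F\<^esub> (x, y) = (r \<odot>\<^bsub>E\<^esub> x, r \<odot>\<^bsub>F\<^esub> y)"
  "mtop (prod_module E F) = prod_topology (mtop E) (mtop F)"
  by (simp_all add: prod_module_def)

lemma regular_module_simps [simp]:
  "carrier (regular_module R) = carrier R"
  "\<zero>\<^bsub>regular_module R\<^esub> = \<zero>\<^bsub>R\<^esub>"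
  "x \<oplus>\<^bsub>regular_module R\<^esub> y = x \<oplus>\<^bsub>R\<^esub> y"
  "r \<odot>\<^bsub>regular_module R\<^esub> x = r \<otimes>\<^bsub>R\<^esub> x"
  "mtop (regular_module R) = rtop R"
  by (simp_all add: regular_module_def)

lemma topological_module_prod [intro]:
  assumes E: "topological_module R E" and F: "topological_module R F"
  shows "topological_module R (prod_module E F)"
proof -
  interpret E: Module.module R E by (rule topological_moduleD(2)[OF E])
  interpret F: Module.module R F by (rule topological_moduleD(2)[OF F])
  note [simp] = topological_moduleD(3)[OF E] topological_moduleD(3)[OF F]
  have ag: "abelian_group (prod_module E F)"
  proof (rule abelian_groupI)
    fix x assume "x \<in> carrier (prod_module E F)"
    then show "\<exists>y\<in>carrier (prod_module E F). y \<oplus>\<^bsub>prod_module E F\<^esub> x = \<zero>\<^bsub>prod_module E F\<^esub>"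
      by (intro bexI[of _ "(\<ominus>\<^bsub>E\<^esub> fst x, \<ominus>\<^bsub>F\<^esub> snd x)"]) (auto simp: E.l_neg F.l_neg)
  qed (auto simp: E.M.a_ac F.M.a_ac)
  have "Module.module R (prod_module E F)"
    by (rule moduleI[OF topological_moduleD(5)[OF E] ag])
      (auto simp: E.smult_l_distr F.smult_l_distr E.smult_r_distr F.smult_r_distr E.smult_assoc1 F.smult_assoc1)
  moreover have "continuous_map (prod_topology (prod_topology (mtop E) (mtop F)) (prod_topology (mtop E) (mtop F)))
      (prod_topology (mtop E) (mtop F))
      (\<lambda>p. (fst (fst p) \<oplus>\<^bsub>E\<^esub> fst (snd p), snd (fst p) \<oplus>\<^bsub>F\<^esub> snd (snd p)))"
    by (intro continuous_map_pairedI continuous_add[OF E] continuous_add[OF F]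
        continuous_map_compose[OF continuous_map_fst continuous_map_fst, unfolded o_def]
        continuous_map_compose[OF continuous_map_fst continuous_map_snd, unfolded o_def]
        continuous_map_compose[OF continuous_map_snd continuous_map_fst, unfolded o_def]
        continuous_map_compose[OF continuous_map_snd continuous_map_snd, unfolded o_def])
  moreover have "continuous_map (prod_topology (rtop R) (prod_topology (mtop E) (mtop F)))
      (prod_topology (mtop E) (mtop F))
      (\<lambda>p. (fst p \<odot>\<^bsub>E\<^esub> fst (snd p), fst p \<odot>\<^bsub>F\<^esub> snd (snd p)))"
    by (intro continuous_map_pairedI continuous_smult[OF E] continuous_smult[OF F] continuous_map_fst
        continuous_map_compose[OF continuous_map_snd continuous_map_fst, unfolded o_def]
        continuous_map_compose[OF continuous_map_snd continuous_map_snd, unfolded o_def])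
  ultimately show ?thesis
    using topological_moduleD[OF E] topological_moduleD[OF F]
    by (simp add: topological_module_def Hausdorff_space_prod_topology prod_module_def case_prod_unfold)
qed

lemma topological_module_regular [intro]:
  assumes R: "topological_ring R" and H: "Hausdorff_space (rtop R)"
  shows "topological_module R (regular_module R)"
proof -
  interpret cring R by (rule topological_ringD(1)[OF R])
  have ag: "abelian_group (regular_module R)"
  proof (rule abelian_groupI)
    fix x assume "x \<in> carrier (regular_module R)"
    then show "\<exists>y\<in>carrier (regular_module R). y \<oplus>\<^bsub>regular_module R\<^esub> x = \<zero>\<^bsub>regular_module R\<^esub>"
      by (intro bexI[of _ "\<ominus>\<^bsub>R\<^esub> x"]) (auto simp: l_neg)
  qed (auto simp: a_ac)
  have "Module.module R (regular_module R)"
    by (rule moduleI[OF topological_ringD(1)[OF R] ag]) (auto simp: l_distr r_distr m_assoc)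
  then show ?thesis using R H by (simp add: topological_module_def topological_ring_def)
qed

definition lin :: "'r top_ring \<Rightarrow> ('r, 'e) top_module \<Rightarrow> ('r, 'f) top_module \<Rightarrow> ('e \<Rightarrow> 'f) \<Rightarrow> bool" where
  "lin R E F L \<longleftrightarrow> continuous_map (mtop E) (mtop F) L \<and>
     (\<forall>x\<in>carrier E. \<forall>y\<in>carrier E. L (x \<oplus>\<^bsub>E\<^esub> y) = L x \<oplus>\<^bsub>F\<^esub> L y) \<and>
     (\<forall>r\<in>carrier R. \<forall>x\<in>carrier E. L (r \<odot>\<^bsub>E\<^esub> x) = r \<odot>\<^bsub>F\<^esub> L x)"

text \<open>An affine map is carried along with its linear part, since the map induced on brackets sends a point by
  the former and a direction by the latter.\<close>

definition aff :: "'r top_ring \<Rightarrow> ('r, 'e) top_module \<Rightarrow> ('r, 'f) top_module \<Rightarrow> ('e \<Rightarrow> 'f) \<Rightarrow> ('e \<Rightarrow> 'f) \<Rightarrow> bool" where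
  "aff R E F \<phi> L \<longleftrightarrow> lin R E F L \<and> continuous_map (mtop E) (mtop F) \<phi> \<and>
     (\<forall>x\<in>carrier E. \<forall>v\<in>carrier E. \<phi> (x \<oplus>\<^bsub>E\<^esub> v) = \<phi> x \<oplus>\<^bsub>F\<^esub> L v)"

lemma lin_aff: "lin R E F L \<Longrightarrow> aff R E F L L"
  by (auto simp: aff_def lin_def)

lemma lin_closed:
  "topological_module R E \<Longrightarrow> topological_module R F \<Longrightarrow> lin R E F L \<Longrightarrow> x \<in> carrier E \<Longrightarrow> L x \<in> carrier F"
  by (simp add: topological_module_def lin_def continuous_map_def Pi_iff)

lemma aff_closed:
  "topological_module R E \<Longrightarrow> topological_module R F \<Longrightarrow> aff R E F \<phi> L \<Longrightarrow> x \<in> carrier E \<Longrightarrow> \<phi> x \<in> carrier F"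
  by (simp add: topological_module_def aff_def continuous_map_def Pi_iff)

lemma lin_comp:
  assumes "topological_module R E" "topological_module R F" "lin R E F L" "lin R F G L'"
  shows "lin R E G (L' \<circ> L)"
  using assms(3,4) lin_closed[OF assms(1-3)]
  by (auto simp: lin_def intro: continuous_map_compose)

lemma aff_comp:
  assumes "topological_module R E" "topological_module R F" "aff R E F \<phi> L" "aff R F G \<phi>' L'"
  shows "aff R E G (\<phi>' \<circ> \<phi>) (L' \<circ> L)"
  using assms(3,4) aff_closed[OF assms(1-3)] lin_comp[OF assms(1,2)] lin_closed[OF assms(1,2)]
  by (auto simp: aff_def intro: continuous_map_compose)

lemma lin_minus:
  assumes E: "topological_module R E" and F: "topological_module R F" and L: "lin R E F L"
    and x: "x \<in> carrier E" and y: "y \<in> carrier E"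
  shows "L (x \<ominus>\<^bsub>E\<^esub> y) = L x \<ominus>\<^bsub>F\<^esub> L y"
proof -
  interpret E: Module.module R E by (rule topological_moduleD(2)[OF E])
  interpret F: Module.module R F by (rule topological_moduleD(2)[OF F])
  note c = lin_closed[OF E F L]
  have "L (x \<ominus>\<^bsub>E\<^esub> y) \<oplus>\<^bsub>F\<^esub> L y = L ((x \<ominus>\<^bsub>E\<^esub> y) \<oplus>\<^bsub>E\<^esub> y)"
    using L x y by (simp add: lin_def)
  also have "(x \<ominus>\<^bsub>E\<^esub> y) \<oplus>\<^bsub>E\<^esub> y = x"
    using x y by (simp add: E.M.minus_eq E.M.add.m_assoc E.l_neg)
  finally show ?thesis
    using x y c by (metis E.M.minus_closed F.M.add.inv_solve_right' F.M.minus_eq)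
qed

lemma topspace_relabel_top: "inj_on h (topspace T) \<Longrightarrow> topspace (relabel_top h T) = h ` topspace T"
  by (auto simp: relabel_top_def topspace_pullback_topology)

lemma openin_relabel_top:
  assumes "inj_on h (topspace T)"
  shows "openin (relabel_top h T) W \<longleftrightarrow> (\<exists>U. openin T U \<and> W = h ` U)"
proof -
  have "inv_into (topspace T) h -` U \<inter> h ` topspace T = h ` U" if "openin T U" for U
    using openin_subset[OF that] assms by (auto simp: inv_into_f_f)
  then show ?thesis unfolding relabel_top_def openin_pullback_topology by metis
qed

lemma homeomorphic_maps_relabel_top:
  assumes "inj_on h (topspace T)"
  shows "homeomorphic_maps T (relabel_top h T) h (inv_into (topspace T) h)"
proof -
  have "{x \<in> topspace T. h x \<in> h ` U} = U" if "openin T U" for U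
    using openin_subset[OF that] assms by (auto simp: inj_on_def)
  moreover have "{x \<in> h ` topspace T. inv_into (topspace T) h x \<in> U} = h ` U" if "openin T U" for U
    using openin_subset[OF that] assms by (auto simp: inv_into_f_f)
  ultimately show ?thesis using assms
    by (auto simp: homeomorphic_maps_def continuous_map topspace_relabel_top openin_relabel_top[OF assms])
qed

lemma relabel_module_simps [simp]:
  "carrier (relabel_module h E) = h ` carrier E"
  "\<zero>\<^bsub>relabel_module h E\<^esub> = h \<zero>\<^bsub>E\<^esub>"
  "mtop (relabel_module h E) = relabel_top h (mtop E)"
  by (simp_all add: relabel_module_def Let_def)

lemma relabel_module_ops [simp]:
  assumes "inj_on h (carrier E)"
  shows "x \<in> carrier E \<Longrightarrow> y \<in> carrier E \<Longrightarrow> h x \<oplus>\<^bsub>relabel_module h E\<^esub> h y = h (x \<oplus>\<^bsub>E\<^esub> y)"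
    "x \<in> carrier E \<Longrightarrow> r \<odot>\<^bsub>relabel_module h E\<^esub> h x = h (r \<odot>\<^bsub>E\<^esub> x)"
  using assms by (simp_all add: relabel_module_def Let_def)

text \<open>Used to move statements between a module and its renamed copies in the tree type.\<close>

lemma relabel_module_iso:
  assumes E: "topological_module R E" and h: "inj_on h (carrier E)"
  shows "topological_module R (relabel_module h E)"
    and "lin R E (relabel_module h E) h"
    and "lin R (relabel_module h E) E (inv_into (carrier E) h)"
proof -
  interpret E: Module.module R E by (rule topological_moduleD(2)[OF E])
  let ?g = "inv_into (carrier E) h" and ?H = "relabel_module h E"
  note [simp] = h topological_moduleD(3)[OF E]
  have hom: "homeomorphic_maps (mtop E) (mtop ?H) h ?g"
    using homeomorphic_maps_relabel_top[of h "mtop E"] by simp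
  then have ch: "continuous_map (mtop E) (mtop ?H) h" and cg: "continuous_map (mtop ?H) (mtop E) ?g"
    by (auto simp: homeomorphic_maps_def)
  show lh: "lin R E ?H h" using ch by (simp add: lin_def)
  show lg: "lin R ?H E ?g" using cg by (auto simp: lin_def)
  have ag: "abelian_group ?H"
  proof (rule abelian_groupI)
    fix x assume "x \<in> carrier ?H"
    then obtain y where "x = h y" "y \<in> carrier E" by auto
    then show "\<exists>y\<in>carrier ?H. y \<oplus>\<^bsub>?H\<^esub> x = \<zero>\<^bsub>?H\<^esub>"
      by (intro bexI[of _ "h (\<ominus>\<^bsub>E\<^esub> y)"]) (auto simp: E.l_neg)
  qed (auto simp: E.M.a_ac)
  have m: "Module.module R ?H"
    by (rule moduleI[OF topological_moduleD(5)[OF E] ag])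
      (auto simp: E.smult_l_distr E.smult_r_distr E.smult_assoc1)
  have "continuous_map (prod_topology (mtop ?H) (mtop ?H)) (mtop ?H) (\<lambda>p. h (?g (fst p) \<oplus>\<^bsub>E\<^esub> ?g (snd p)))"
    by (intro continuous_map_compose[OF _ ch, unfolded o_def] continuous_add[OF E]
        continuous_map_compose[OF continuous_map_fst cg, unfolded o_def]
        continuous_map_compose[OF continuous_map_snd cg, unfolded o_def])
  moreover have "continuous_map (prod_topology (rtop R) (mtop ?H)) (mtop ?H) (\<lambda>p. h (fst p \<odot>\<^bsub>E\<^esub> ?g (snd p)))"
    by (intro continuous_map_compose[OF _ ch, unfolded o_def] continuous_smult[OF E]
        continuous_map_fst
        continuous_map_compose[OF continuous_map_snd cg, unfolded o_def])
  moreover have "Hausdorff_space (mtop ?H)"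
    using hom topological_moduleD(4)[OF E] homeomorphic_Hausdorff_space homeomorphic_maps_imp_homeomorphic_space by blast
  ultimately show "topological_module R ?H"
    using m E by (simp add: topological_module_def case_prod_unfold relabel_module_def Let_def topspace_relabel_top)
qed

section \<open>Difference quotients and affine maps\<close>

lemma topological_module_bracket:
  assumes "topological_module R E" "Hausdorff_space (rtop R)"
  shows "topological_module R (bracket_module R E)"
  using assms topological_moduleD(1) by blast

abbreviation aff_bracket :: "('e \<Rightarrow> 'f) \<Rightarrow> ('e \<Rightarrow> 'f) \<Rightarrow> 'e \<times> 'e \<times> 'r \<Rightarrow> 'f \<times> 'f \<times> 'r" where
  "aff_bracket \<phi> L \<equiv> (\<lambda>(x, v, s). (\<phi> x, L v, s))"

text \<open>The induced map on brackets is affine again, which is what lets precomposition pass to higher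
  difference quotients.\<close>

lemma aff_aff_bracket:
  assumes "aff R E F \<phi> L"
  shows "aff R (bracket_module R E) (bracket_module R F) (aff_bracket \<phi> L) (aff_bracket L L)"
proof -
  have c: "continuous_map (prod_topology (mtop E) (prod_topology (mtop E) (rtop R)))
      (prod_topology (mtop F) (prod_topology (mtop F) (rtop R))) (aff_bracket f g)"
    if "continuous_map (mtop E) (mtop F) f" "continuous_map (mtop E) (mtop F) g" for f g
    unfolding case_prod_unfold
    by (intro continuous_map_pairedI continuous_map_compose[OF _ that(1), unfolded o_def]
      continuous_map_compose[OF _ that(2), unfolded o_def]
      continuous_map_compose[OF continuous_map_snd, unfolded o_def] continuous_map_fst continuous_map_snd)
  show ?thesis using assms unfolding aff_def lin_def by (auto intro!: c)
qed

lemma aff_scaled: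
  assumes E: "topological_module R E" and "aff R E F \<phi> L" "x \<in> carrier E" "v \<in> carrier E" "s \<in> carrier R"
  shows "\<phi> (x \<oplus>\<^bsub>E\<^esub> (s \<odot>\<^bsub>E\<^esub> v)) = \<phi> x \<oplus>\<^bsub>F\<^esub> (s \<odot>\<^bsub>F\<^esub> L v)"
proof -
  interpret E: Module.module R E by (rule topological_moduleD(2)[OF E])
  show ?thesis using assms(2-) by (simp add: aff_def lin_def)
qed

text \<open>Because \<open>\<phi> (x + s v) = \<phi> x + s (L v)\<close>, substituting into a difference quotient gives one. The ring is an arbitrary
  topological ring, so that this also serves over \<open>K^A\<close>.\<close>

lemma is_diff_quot_precomp:
  assumes E: "topological_module R E" and E': "topological_module R E'"
    and H: "Hausdorff_space (rtop R)"
    and a: "aff R E' E \<phi> L" and h: "is_diff_quot R E F f h"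
  shows "is_diff_quot R E' F (f \<circ>\<^sub>m pfun (carrier E') \<phi>)
    (h \<circ>\<^sub>m pfun (carrier (bracket_module R E')) (aff_bracket \<phi> L))"
proof -
  interpret E': Module.module R E' by (rule topological_moduleD(2)[OF E'])
  let ?B = "bracket_module R E" and ?B' = "bracket_module R E'"
  let ?f = "f \<circ>\<^sub>m pfun (carrier E') \<phi>" and ?h = "h \<circ>\<^sub>m pfun (carrier ?B') (aff_bracket \<phi> L)"
  have tB: "topspace (mtop ?B') = carrier ?B'"
    using topological_moduleD(3)[OF topological_module_bracket[OF E' H]] .
  have cl: "x \<in> carrier E' \<Longrightarrow> \<phi> x \<in> carrier E" "x \<in> carrier E' \<Longrightarrow> L x \<in> carrier E" for x
    using aff_closed[OF E' E a] lin_closed[OF E' E] a by (auto simp: aff_def)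
  have dh: "dom h = bracket1 R E (dom f)" using h by (simp add: is_diff_quot_def)
  note sc = aff_scaled[OF E' a]
  have d: "dom ?h = bracket1 R E' (dom ?f)"
    unfolding dom_map_comp_pfun dh bracket1_def using cl by (auto simp: sc)
  have c: "continuous_partial (mtop ?B') (mtop F) ?h"
  proof (rule continuous_partial_comp)
    have "continuous_map (mtop ?B') (mtop ?B) (aff_bracket \<phi> L)"
      using aff_aff_bracket[OF a] unfolding aff_def by blast
    then show "continuous_partial (mtop ?B') (mtop ?B) (pfun (carrier ?B') (aff_bracket \<phi> L))"
      using continuous_partial_pfun tB by metis
    show "continuous_partial (mtop ?B) (mtop F) h" using h unfolding is_diff_quot_def by blast
  qed
  have "?h (x, v, s) = Some (inv\<^bsub>R\<^esub> s \<odot>\<^bsub>F\<^esub> (the (?f (x \<oplus>\<^bsub>E'\<^esub> (s \<odot>\<^bsub>E'\<^esub> v))) \<ominus>\<^bsub>F\<^esub> the (?f x)))"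
    if b: "(x, v, s) \<in> bracket1 R E' (dom ?f)" and s: "s \<in> Units R" for x v s
  proof -
    have x: "x \<in> carrier E'" "v \<in> carrier E'" "s \<in> carrier R"
      using b by (auto simp: bracket1_def)
    have "(\<phi> x, L v, s) \<in> bracket1 R E (dom f)"
      using b x cl by (auto simp: bracket1_def sc)
    then show ?thesis using h s x by (simp add: is_diff_quot_def map_comp_pfun sc)
  qed
  then show ?thesis using d c by (simp add: is_diff_quot_def)
qed

lemma inj_node [simp]: "inj_on node S" by (auto simp: inj_on_def node_def)
lemma inj_Leaf [simp]: "inj_on Leaf S" by (auto simp: inj_on_def)

text \<open>Each step of the induction replaces both modules by their brackets, so both must be arbitrary.\<close>

lemma class_C_precomp:
  fixes E :: "('r, ('e, 'r) tup) top_module" and E' :: "('r, ('d, 'r) tup) top_module"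
  assumes "topological_module R E" and "topological_module R E'"
    and H: "Hausdorff_space (rtop R)"
    and "aff R E' E \<phi> L" and "class_C n R E F f"
  shows "class_C n R E' F (f \<circ>\<^sub>m pfun (carrier E') \<phi>)"
  using assms(1,2,4,5)
proof (induction n arbitrary: E E' f \<phi> L)
  case 0
  then show ?case
    using continuous_partial_comp[OF continuous_partial_pfun[of "mtop E'" "mtop E" \<phi>]]
      topological_moduleD(3)[of R E'] by (auto simp: aff_def)
next
  case (Suc n)
  note E = \<open>topological_module R E\<close> and E' = \<open>topological_module R E'\<close> and a = \<open>aff R E' E \<phi> L\<close>
  let ?B = "bracket_module R E" and ?B' = "bracket_module R E'"
  let ?N = "relabel_module node ?B" and ?N' = "relabel_module node ?B'"
  note B = topological_module_bracket[OF E H] and B' = topological_module_bracket[OF E' H]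
  note N = relabel_module_iso[OF B inj_node] and N' = relabel_module_iso[OF B' inj_node]
  obtain h where h: "is_diff_quot R E F f h"
    and C: "class_C n R ?N F (relabel_dom (carrier ?B) node h)"
    using Suc.prems(4) by auto
  let ?h = "h \<circ>\<^sub>m pfun (carrier ?B') (aff_bracket \<phi> L)"
  have "continuous_partial (mtop E') (mtop F) (f \<circ>\<^sub>m pfun (carrier E') \<phi>)"
    using Suc.prems continuous_partial_comp[OF continuous_partial_pfun[of "mtop E'" "mtop E" \<phi>]]
      topological_moduleD(3)[OF E'] by (auto simp: aff_def)
  moreover have "is_diff_quot R E' F (f \<circ>\<^sub>m pfun (carrier E') \<phi>) ?h"
    by (rule is_diff_quot_precomp[OF E E' H a h])
  moreover have "class_C n R ?N' F (relabel_dom (carrier ?B') node ?h)"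
  proof -
    let ?p = "(node \<circ> aff_bracket \<phi> L) \<circ> inv_into (carrier ?B') node"
    have ab: "aff R ?B' ?B (aff_bracket \<phi> L) (aff_bracket L L)" by (rule aff_aff_bracket[OF a])
    note cl = aff_closed[OF B' B ab]
    have "aff R ?N' ?N ?p ((node \<circ> aff_bracket L L) \<circ> inv_into (carrier ?B') node)"
      by (rule aff_comp[OF N'(1) B' lin_aff[OF N'(3)] aff_comp[OF B' B ab lin_aff[OF N(2)]]])
    from Suc.IH[OF N(1) N'(1) this C]
    have "class_C n R ?N' F (relabel_dom (carrier ?B) node h \<circ>\<^sub>m pfun (carrier ?N') ?p)" .
    moreover have "relabel_dom (carrier ?B) node h \<circ>\<^sub>m pfun (carrier ?N') ?p
        = relabel_dom (carrier ?B') node ?h"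
      unfolding relabel_dom_pfun
    proof (rule ext)
      fix y
      show "(h \<circ>\<^sub>m pfun (node ` carrier ?B) (inv_into (carrier ?B) node) \<circ>\<^sub>m pfun (carrier ?N') ?p) y =
         (h \<circ>\<^sub>m pfun (carrier ?B') (aff_bracket \<phi> L) \<circ>\<^sub>m pfun (node ` carrier ?B') (inv_into (carrier ?B') node)) y"
      proof (cases "y \<in> carrier ?N'")
        case True
        then obtain x where x: "x \<in> carrier ?B'" "y = node x" by auto
        then have "inv_into (carrier ?B') node y = x" by (simp only: inv_into_f_f[OF inj_node])
        moreover have "inv_into (carrier ?B) node (node (aff_bracket \<phi> L x)) = aff_bracket \<phi> L x"
          using cl[OF x(1)] by (simp only: inv_into_f_f[OF inj_node])
        ultimately show ?thesis using x cl[OF x(1)] True by (simp only: map_comp_pfun o_apply imageI relabel_module_simps if_True)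
      next
        case False
        then show ?thesis by (auto simp del: prod_module_simps simp add: map_comp_pfun)
      qed
    qed
    ultimately show ?thesis by simp
  qed
  ultimately show ?case by (auto simp del: prod_module_simps)
qed

section \<open>Maps of class \<open>C^n\<close> on modules of arbitrary type\<close>

text \<open>The notion \<open>class_C\<close> for modules on an arbitrary type, whose points become leaves. The condition on the
  domain prevents the renaming from silently dropping points outside the module.\<close>

definition cls :: "nat \<Rightarrow> 'r top_ring \<Rightarrow> ('r, 'e) top_module \<Rightarrow> ('r, 'f) top_module \<Rightarrow> ('e \<rightharpoonup> 'f) \<Rightarrow> bool" where
  "cls n R E F f \<longleftrightarrow> dom f \<subseteq> carrier E \<and>
     class_C n R (relabel_module Leaf E) F (relabel_dom (carrier E) Leaf f)"

lemma relabel_dom_precomp: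
  assumes "inj_on h S" "inj_on h' S'" "\<phi> ` S' \<subseteq> S"
  shows "relabel_dom S' h' (f \<circ>\<^sub>m pfun S' \<phi>)
    = relabel_dom S h f \<circ>\<^sub>m pfun (h' ` S') (h \<circ> \<phi> \<circ> inv_into S' h')"
proof
  fix y
  show "relabel_dom S' h' (f \<circ>\<^sub>m pfun S' \<phi>) y
    = (relabel_dom S h f \<circ>\<^sub>m pfun (h' ` S') (h \<circ> \<phi> \<circ> inv_into S' h')) y"
  proof (cases "y \<in> h' ` S'")
    case True
    then obtain x where x: "x \<in> S'" "y = h' x" by auto
    then have "\<phi> x \<in> S" using assms(3) by auto
    then show ?thesis using x assms by (simp add: relabel_dom_def map_comp_pfun)
  next
    case False
    then show ?thesis by (simp add: relabel_dom_def map_comp_pfun)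
  qed
qed

lemma relabel_dom_undo:
  assumes "inj_on h S" "dom f \<subseteq> S"
  shows "relabel_dom S h f \<circ>\<^sub>m pfun S h = f"
proof
  fix x show "(relabel_dom S h f \<circ>\<^sub>m pfun S h) x = f x"
    using assms by (cases "x \<in> S"; cases "f x") (auto simp: relabel_dom_def map_comp_pfun)
qed

lemma continuous_partial_precomp:
  assumes "topological_module R E'" "aff R E' E \<phi> L" "continuous_partial (mtop E) T f"
  shows "continuous_partial (mtop E') T (f \<circ>\<^sub>m pfun (carrier E') \<phi>)"
  using assms continuous_partial_comp[OF continuous_partial_pfun[of "mtop E'" "mtop E" \<phi>]]
      topological_moduleD(3)[of R E'] by (auto simp: aff_def)

lemma class_C_relabel_precomp:
  fixes h :: "'e \<Rightarrow> ('a, 'r) tup" and h' :: "'d \<Rightarrow> ('b, 'r) tup"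
  assumes E: "topological_module R E" and E': "topological_module R E'"
    and H: "Hausdorff_space (rtop R)"
    and h: "inj_on h (carrier E)" and h': "inj_on h' (carrier E')" and a: "aff R E' E \<phi> L"
    and C: "class_C n R (relabel_module h E) F (relabel_dom (carrier E) h f)"
  shows "class_C n R (relabel_module h' E') F (relabel_dom (carrier E') h' (f \<circ>\<^sub>m pfun (carrier E') \<phi>))"
proof -
  note i = relabel_module_iso[OF E h] and i' = relabel_module_iso[OF E' h']
  have "aff R (relabel_module h' E') (relabel_module h E) ((h \<circ> \<phi>) \<circ> inv_into (carrier E') h')
     ((h \<circ> L) \<circ> inv_into (carrier E') h')"
    by (rule aff_comp[OF i'(1) E' lin_aff[OF i'(3)] aff_comp[OF E' E a lin_aff[OF i(2)]]])
  from class_C_precomp[OF i(1) i'(1) H this C]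
  show ?thesis
    using relabel_dom_precomp[OF h h', of \<phi> f] aff_closed[OF E' E a] by (simp add: image_subset_iff)
qed

lemma cls_precomp:
  assumes "topological_module R E" "topological_module R E'" "Hausdorff_space (rtop R)"
    and "aff R E' E \<phi> L" and "cls n R E F f"
  shows "cls n R E' F (f \<circ>\<^sub>m pfun (carrier E') \<phi>)"
  using assms class_C_relabel_precomp[OF assms(1-3) inj_Leaf inj_Leaf assms(4)]
  by (auto simp: cls_def)

lemma cls_0:
  fixes E :: "('r, 'e) top_module"
  assumes E: "topological_module R E"
  shows "cls 0 R E F f \<longleftrightarrow> continuous_partial (mtop E) (mtop F) f"
proof -
  let ?Leaf = "Leaf :: 'e \<Rightarrow> ('e, 'r) tup"
  let ?L = "relabel_module ?Leaf E"
  note i = relabel_module_iso[OF E inj_Leaf]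
  have d: "continuous_partial (mtop E) (mtop F) f \<Longrightarrow> dom f \<subseteq> carrier E"
    using topological_moduleD(3)[OF E] by (auto simp: continuous_partial_iff)
  have 1: "continuous_partial (mtop ?L) (mtop F) (relabel_dom (carrier E) ?Leaf f)"
    if "continuous_partial (mtop E) (mtop F) f"
    using continuous_partial_precomp[OF i(1) lin_aff[OF i(3)] that] by (simp add: relabel_dom_pfun)
  have 2: "continuous_partial (mtop E) (mtop F) f" if "dom f \<subseteq> carrier E"
    "continuous_partial (mtop ?L) (mtop F) (relabel_dom (carrier E) ?Leaf f)"
    using continuous_partial_precomp[OF E lin_aff[OF i(2)] that(2)] relabel_dom_undo[where h = ?Leaf, OF inj_Leaf that(1)]
    by simp
  show ?thesis using 1 2 d unfolding cls_def class_C.simps by blast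
qed

lemma is_diff_quot_dom: "is_diff_quot R E F f h \<Longrightarrow> dom h = bracket1 R E (dom f)"
  by (simp add: is_diff_quot_def)

lemma bracket1_carrier: "dom f \<subseteq> carrier E \<Longrightarrow> bracket1 R E (dom f) \<subseteq> carrier (bracket_module R E)"
  by (auto simp: bracket1_def)

lemma class_C_continuous: "class_C n R E F f \<Longrightarrow> continuous_partial (mtop E) (mtop F) f"
  by (cases n) auto

text \<open>On the tree type itself, turning points into leaves is an isomorphism and changes nothing.\<close>

lemma class_C_iff_cls:
  fixes E :: "('r, ('e, 'r) tup) top_module"
  assumes E: "topological_module R E" and H: "Hausdorff_space (rtop R)"
  shows "class_C n R E F f \<longleftrightarrow> cls n R E F f"
proof -
  let ?Leaf = "Leaf :: ('e, 'r) tup \<Rightarrow> (('e, 'r) tup, 'r) tup"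
  let ?L = "relabel_module ?Leaf E"
  note i = relabel_module_iso[OF E inj_Leaf]
  have d: "class_C n R E F f \<Longrightarrow> dom f \<subseteq> carrier E"
    using topological_moduleD(3)[OF E] class_C_continuous by (force simp: continuous_partial_iff)
  have 1: "class_C n R ?L F (relabel_dom (carrier E) ?Leaf f)" if "class_C n R E F f"
    using class_C_precomp[OF E i(1) H lin_aff[OF i(3)] that] by (simp add: relabel_dom_pfun)
  have 2: "class_C n R E F f" if "dom f \<subseteq> carrier E"
    "class_C n R ?L F (relabel_dom (carrier E) ?Leaf f)"
    using class_C_precomp[OF i(1) E H lin_aff[OF i(2)] that(2)] relabel_dom_undo[where h = ?Leaf, OF inj_Leaf that(1)]
    by simp
  show ?thesis using 1 2 d unfolding cls_def by blast
qed

lemma cls_relabel: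
  assumes E: "topological_module R E" and H: "Hausdorff_space (rtop R)" and h: "inj_on h (carrier E)"
    and d: "dom f \<subseteq> carrier E"
  shows "cls n R (relabel_module h E) F (relabel_dom (carrier E) h f) \<longleftrightarrow> cls n R E F f"
proof -
  note i = relabel_module_iso[OF E h]
  show ?thesis
    using cls_precomp[OF E i(1) H lin_aff[OF i(3)], of n F f]
      cls_precomp[OF i(1) E H lin_aff[OF i(2)], of n F "relabel_dom (carrier E) h f"]
      relabel_dom_undo[OF h d] by (auto simp: relabel_dom_pfun)
qed

text \<open>The recursion for \<open>C^n\<close> without trees: renaming first and then forming the bracket, or the other way round,
  gives isomorphic modules, and \<open>C^n\<close> is invariant under isomorphisms.\<close>

lemma cls_Suc:
  fixes E :: "('r, 'e) top_module"
  assumes E: "topological_module R E" and H: "Hausdorff_space (rtop R)"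
  shows "cls (Suc n) R E F f \<longleftrightarrow> continuous_partial (mtop E) (mtop F) f \<and>
     (\<exists>h. is_diff_quot R E F f h \<and> cls n R (bracket_module R E) F h)" (is "_ \<longleftrightarrow> ?R")
proof -
  let ?Leaf = "Leaf :: 'e \<Rightarrow> ('e, 'r) tup"
  let ?L = "relabel_module ?Leaf E" and ?f = "relabel_dom (carrier E) ?Leaf f"
  let ?B = "bracket_module R E" and ?BL = "bracket_module R (relabel_module ?Leaf E)"
  let ?l = "inv_into (carrier E) ?Leaf"
  note i = relabel_module_iso[OF E inj_Leaf]
  note B = topological_module_bracket[OF E H] and BL = topological_module_bracket[OF i(1) H]
  have c0: "continuous_partial (mtop E) (mtop F) f \<longleftrightarrow>
      dom f \<subseteq> carrier E \<and> continuous_partial (mtop ?L) (mtop F) ?f"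
    using cls_0[OF E, of F f] unfolding cls_def class_C.simps by (rule sym)
  have bl: "topological_module R (relabel_module node ?BL)"
    using relabel_module_iso(1)[OF BL inj_node] .
  have node: "class_C n R (relabel_module node ?BL) F (relabel_dom (carrier ?BL) node h) \<longleftrightarrow> cls n R ?BL F h"
    if "dom h \<subseteq> carrier ?BL" for h
    unfolding class_C_iff_cls[OF bl H] by (rule cls_relabel[OF BL H inj_node that])
  show ?thesis
  proof
    assume L: "cls (Suc n) R E F f"
    then obtain h where h: "is_diff_quot R ?L F ?f h"
      and C: "class_C n R (relabel_module node ?BL) F (relabel_dom (carrier ?BL) node h)"
      by (auto simp: cls_def)
    have d: "dom f \<subseteq> carrier E" using L by (simp add: cls_def)
    have "dom ?f \<subseteq> carrier ?L" by (auto simp: relabel_dom_def split: if_splits)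
    then have dh: "dom h \<subseteq> carrier ?BL"
      unfolding is_diff_quot_dom[OF h] by (rule bracket1_carrier)
    let ?h = "h \<circ>\<^sub>m pfun (carrier ?B) (aff_bracket ?Leaf ?Leaf)"
    have "is_diff_quot R E F f ?h"
      using is_diff_quot_precomp[OF i(1) E H lin_aff[OF i(2)] h] relabel_dom_undo[where h = ?Leaf, OF inj_Leaf d] by simp
    moreover have "cls n R ?B F ?h"
      using cls_precomp[OF BL B H aff_aff_bracket[OF lin_aff[OF i(2)]]] C node[OF dh] by blast
    ultimately show ?R using L c0 unfolding cls_def class_C.simps by blast
  next
    assume R: ?R
    then obtain h where h: "is_diff_quot R E F f h" and C: "cls n R ?B F h" by blast
    have d: "dom f \<subseteq> carrier E" using R c0 by blast
    let ?h = "h \<circ>\<^sub>m pfun (carrier ?BL) (aff_bracket ?l ?l)"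
    have "is_diff_quot R ?L F ?f ?h"
      using is_diff_quot_precomp[OF E i(1) H lin_aff[OF i(3)] h] by (simp add: relabel_dom_pfun)
    moreover have "cls n R ?BL F ?h"
      by (rule cls_precomp[OF B BL H aff_aff_bracket[OF lin_aff[OF i(3)]] C])
    moreover have "dom ?h \<subseteq> carrier ?BL" by auto
    ultimately show "cls (Suc n) R E F f" using node d R c0 unfolding cls_def class_C.simps by blast
  qed
qed

lemma cls_continuous:
  "topological_module R E \<Longrightarrow> Hausdorff_space (rtop R) \<Longrightarrow> cls n R E F f \<Longrightarrow> continuous_partial (mtop E) (mtop F) f"
  by (cases n) (simp_all add: cls_0 cls_Suc)

lemma is_diff_quot_post:
  assumes F: "topological_module R F" and G: "topological_module R G"
    and f: "ran f \<subseteq> carrier F" and L: "lin R F G L" and h: "is_diff_quot R E F f h"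
  shows "is_diff_quot R E G (map_option L \<circ> f) (map_option L \<circ> h)"
proof -
  interpret F: Module.module R F by (rule topological_moduleD(2)[OF F])
  have "continuous_partial (mtop (bracket_module R E)) (mtop G) (map_option L \<circ> h)"
    using continuous_partial_post h L unfolding lin_def is_diff_quot_def by blast
  moreover have "L (inv\<^bsub>R\<^esub> s \<odot>\<^bsub>F\<^esub> (a \<ominus>\<^bsub>F\<^esub> b)) = inv\<^bsub>R\<^esub> s \<odot>\<^bsub>G\<^esub> (L a \<ominus>\<^bsub>G\<^esub> L b)"
    if "a \<in> carrier F" "b \<in> carrier F" "s \<in> Units R" for a b s
    using that lin_minus[OF F G L] L by (simp add: lin_def F.Units_inv_closed F.M.minus_closed)
  moreover have "the ((map_option L \<circ> f) x) = L (the (f x))" "the (f x) \<in> carrier F" if "x \<in> dom f" for x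
    using that f by (auto simp: ran_def)
  ultimately show ?thesis using h unfolding is_diff_quot_def by (auto simp: bracket1_def)
qed

lemma class_C_post:
  assumes "topological_module R F" "topological_module R G" "lin R F G L" "class_C n R E F f"
  shows "class_C n R E G (map_option L \<circ> f)"
  using assms(4)
proof (induction n arbitrary: E f)
  case 0
  then show ?case using continuous_partial_post assms(3) unfolding lin_def class_C.simps by blast
next
  case (Suc n)
  then obtain h where h: "is_diff_quot R E F f h"
    and C: "class_C n R (relabel_module node (bracket_module R E)) F (relabel_dom (carrier (bracket_module R E)) node h)"
    by auto
  have c: "continuous_partial (mtop E) (mtop F) f" using Suc.prems by auto
  then have r: "ran f \<subseteq> carrier F" using topological_moduleD(3)[OF assms(1)] by (auto simp: continuous_partial_iff)
  have "continuous_partial (mtop E) (mtop G) (map_option L \<circ> f)"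
    using continuous_partial_post[OF c] assms(3) by (auto simp: lin_def)
  moreover note is_diff_quot_post[OF assms(1,2) r assms(3) h]
  moreover have "map_option L \<circ> relabel_dom (carrier (bracket_module R E)) node h
    = relabel_dom (carrier (bracket_module R E)) node (map_option L \<circ> h)"
    by (auto simp: relabel_dom_def)
  ultimately show ?case using Suc.IH[OF C] unfolding class_C.simps by metis
qed

lemma class_C_ppair:
  assumes "topological_module R F" "topological_module R G" "class_C n R E F f" "class_C n R E G g"
  shows "class_C n R E (prod_module F G) (ppair f g)"
  using assms(3,4)
proof (induction n arbitrary: E f g)
  case 0
  then show ?case using continuous_partial_ppair by auto
next
  case (Suc n)
  let ?B = "bracket_module R E"
  obtain h k where h: "is_diff_quot R E F f h" and k: "is_diff_quot R E G g k"
    and C: "class_C n R (relabel_module node ?B) F (relabel_dom (carrier ?B) node h)"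
     "class_C n R (relabel_module node ?B) G (relabel_dom (carrier ?B) node k)"
    using Suc.prems by auto
  interpret F: Module.module R F by (rule topological_moduleD(2)[OF assms(1)])
  interpret G: Module.module R G by (rule topological_moduleD(2)[OF assms(2)])
  interpret P: Module.module R "prod_module F G"
    by (rule topological_moduleD(2)[OF topological_module_prod[OF assms(1,2)]])
  have c: "continuous_partial (mtop E) (mtop F) f" "continuous_partial (mtop E) (mtop G) g"
    using Suc.prems by auto
  then have r: "ran f \<subseteq> carrier F" "ran g \<subseteq> carrier G"
    using topological_moduleD(3)[OF assms(1)] topological_moduleD(3)[OF assms(2)] by (auto simp: continuous_partial_iff)
  have "is_diff_quot R E (prod_module F G) (ppair f g) (ppair h k)"
    unfolding is_diff_quot_def
  proof (intro conjI allI impI)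
    show "dom (ppair h k) = bracket1 R E (dom (ppair f g))"
      using is_diff_quot_dom[OF h] is_diff_quot_dom[OF k] by (auto simp: bracket1_def)
    show "continuous_partial (mtop ?B) (mtop (prod_module F G)) (ppair h k)"
      using continuous_partial_ppair h k unfolding is_diff_quot_def prod_module_simps(5) by blast
    fix x v s assume A: "(x, v, s) \<in> bracket1 R E (dom (ppair f g)) \<and> s \<in> Units R"
    let ?y = "x \<oplus>\<^bsub>E\<^esub> s \<odot>\<^bsub>E\<^esub> v"
    have m: "(x, v, s) \<in> bracket1 R E (dom f)" "(x, v, s) \<in> bracket1 R E (dom g)" "s \<in> Units R"
      "x \<in> dom f" "x \<in> dom g" "?y \<in> dom f" "?y \<in> dom g"
      using A by (auto simp: bracket1_def)
    have cl: "the (f x) \<in> carrier F" "the (g x) \<in> carrier G" "the (f ?y) \<in> carrier F" "the (g ?y) \<in> carrier G"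
      using m r by (auto simp: ran_def)
    have sub: "(a, b) \<ominus>\<^bsub>prod_module F G\<^esub> (a', b') = (a \<ominus>\<^bsub>F\<^esub> a', b \<ominus>\<^bsub>G\<^esub> b')"
      if "a \<in> carrier F" "a' \<in> carrier F" "b \<in> carrier G" "b' \<in> carrier G" for a a' b b'
    proof -
      have "(a \<ominus>\<^bsub>F\<^esub> a', b \<ominus>\<^bsub>G\<^esub> b') \<oplus>\<^bsub>prod_module F G\<^esub> (a', b') = (a, b)"
        using that by (simp add: F.M.minus_eq G.M.minus_eq F.M.add.m_assoc F.l_neg G.M.add.m_assoc G.l_neg)
      then show ?thesis
        using that by (metis F.M.minus_closed G.M.minus_closed P.M.add.inv_solve_right' P.M.minus_eq
            prod_module_simps(1) SigmaI)
    qed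
    show "ppair h k (x, v, s) = Some (inv\<^bsub>R\<^esub> s \<odot>\<^bsub>prod_module F G\<^esub>
        (the (ppair f g ?y) \<ominus>\<^bsub>prod_module F G\<^esub> the (ppair f g x)))"
    proof -
      have hk: "h (x, v, s) = Some (inv\<^bsub>R\<^esub> s \<odot>\<^bsub>F\<^esub> (the (f ?y) \<ominus>\<^bsub>F\<^esub> the (f x)))"
        "k (x, v, s) = Some (inv\<^bsub>R\<^esub> s \<odot>\<^bsub>G\<^esub> (the (g ?y) \<ominus>\<^bsub>G\<^esub> the (g x)))"
        using h k m unfolding is_diff_quot_def by blast+
      have e: "ppair f g ?y = Some (the (f ?y), the (g ?y))" "ppair f g x = Some (the (f x), the (g x))"
        using m by (metis ppair_apply)+
      show ?thesis unfolding e option.sel sub[OF cl(3,1,4,2)] prod_module_simps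
        by (simp add: ppair_eq_Some hk)
    qed
  qed
  moreover have "ppair (relabel_dom (carrier ?B) node h) (relabel_dom (carrier ?B) node k)
     = relabel_dom (carrier ?B) node (ppair h k)"
    by (auto simp: relabel_dom_def ppair_def)
  moreover have "continuous_partial (mtop E) (mtop (prod_module F G)) (ppair f g)"
    using continuous_partial_ppair c by auto
  ultimately show ?case using Suc.IH[OF C] unfolding class_C.simps by metis
qed

lemma class_C_down:
  "class_C (Suc n) R E F f \<Longrightarrow> class_C n R E F f"
proof (induction n arbitrary: E f)
  case (Suc n)
  then show ?case using class_C.simps(2) by metis
qed auto

lemma cls_post:
  assumes "topological_module R F" "topological_module R G" "lin R F G L" "cls n R E F f"
  shows "cls n R E G (map_option L \<circ> f)"
proof -
  have "relabel_dom (carrier E) Leaf (map_option L \<circ> f) = map_option L \<circ> relabel_dom (carrier E) Leaf f"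
    by (auto simp: relabel_dom_def)
  then show ?thesis using class_C_post[OF assms(1-3)] assms(4) unfolding cls_def dom_map_option by metis
qed

lemma cls_ppair:
  assumes "topological_module R F" "topological_module R G" "cls n R E F f" "cls n R E G g"
  shows "cls n R E (prod_module F G) (ppair f g)"
proof -
  have "relabel_dom (carrier E) Leaf (ppair f g) = ppair (relabel_dom (carrier E) Leaf f) (relabel_dom (carrier E) Leaf g)"
    by (auto simp: relabel_dom_def ppair_def)
  then show ?thesis using class_C_ppair[OF assms(1,2)] assms(3,4) unfolding cls_def dom_ppair by (metis le_infI1)
qed

lemma cls_down: "cls (Suc n) R E F f \<Longrightarrow> cls n R E F f"
  unfolding cls_def using class_C_down by blast

lemma smooth_cls: "dom f \<subseteq> carrier E \<Longrightarrow> smooth R E F f \<longleftrightarrow> (\<forall>n. cls n R E F f)"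
  by (simp add: smooth_def cls_def)

text \<open>It is enough to treat the identity, of which an affine map is a precomposition. The difference quotient
  \<open>(x, v, s) \<mapsto> v\<close> of the identity is the identity precomposed with a projection, so the induction closes.\<close>

lemma aff_pfun_cls:
  fixes F :: "('r, 'f) top_module"
  assumes E: "topological_module R E" and F: "topological_module R F" and H: "Hausdorff_space (rtop R)"
    and a: "aff R E F \<phi> L"
  shows "cls n R E F (pfun (carrier E) \<phi>)"
proof -
  have i: "aff R F F id id" by (auto simp: aff_def lin_def)
  have ci: "continuous_partial (mtop F) (mtop F) (pfun (carrier F) id)"
    using continuous_partial_pfun[OF continuous_map_id, of "mtop F"] topological_moduleD(3)[OF F] by metis
  have "cls n R F F (pfun (carrier F) id)"
  proof (induction n)
    case 0
    then show ?case using ci by (simp only: cls_0[OF F])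
  next
    case (Suc n)
    let ?B = "bracket_module R F"
    interpret F: Module.module R F by (rule topological_moduleD(2)[OF F])
    note B = topological_module_bracket[OF F H]
    let ?p = "\<lambda>q :: 'f \<times> 'f \<times> 'r. fst (snd q)"
    have l: "lin R ?B F ?p"
      unfolding lin_def using continuous_map_compose[OF continuous_map_snd continuous_map_fst, unfolded o_def] by auto
    have "is_diff_quot R F F (pfun (carrier F) id) (pfun (carrier F) id \<circ>\<^sub>m pfun (carrier ?B) ?p)"
      unfolding is_diff_quot_def
    proof (intro conjI allI impI)
      show "continuous_partial (mtop ?B) (mtop F) (pfun (carrier F) id \<circ>\<^sub>m pfun (carrier ?B) ?p)"
        by (rule continuous_partial_precomp[OF B lin_aff[OF l]])
          (rule ci)
      fix x v s assume "(x, v, s) \<in> bracket1 R F (dom (pfun (carrier F) id)) \<and> s \<in> Units R"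
      then have c: "x \<in> carrier F" "v \<in> carrier F" "s \<in> Units R" "s \<in> carrier R"
        by (auto simp: bracket1_def)
      have "(x \<oplus>\<^bsub>F\<^esub> s \<odot>\<^bsub>F\<^esub> v) \<ominus>\<^bsub>F\<^esub> x = s \<odot>\<^bsub>F\<^esub> v"
        using c by (simp add: F.M.minus_eq F.M.add.m_assoc F.M.add.m_comm F.M.add.m_lcomm F.r_neg F.M.r_neg1 F.M.r_neg2)
      then have "inv\<^bsub>R\<^esub> s \<odot>\<^bsub>F\<^esub> ((x \<oplus>\<^bsub>F\<^esub> s \<odot>\<^bsub>F\<^esub> v) \<ominus>\<^bsub>F\<^esub> x) = v"
        using c by (simp add: F.smult_assoc1[symmetric] F.Units_inv_closed F.Units_l_inv)
      then show "(pfun (carrier F) id \<circ>\<^sub>m pfun (carrier ?B) ?p) (x, v, s) = Some (inv\<^bsub>R\<^esub> s \<odot>\<^bsub>F\<^esub>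
         (the (pfun (carrier F) id (x \<oplus>\<^bsub>F\<^esub> s \<odot>\<^bsub>F\<^esub> v)) \<ominus>\<^bsub>F\<^esub> the (pfun (carrier F) id x)))"
        using c by (simp add: map_comp_pfun)
    qed (auto simp: bracket1_def)
    then show ?case
      using cls_precomp[OF F B H lin_aff[OF l] Suc] ci unfolding cls_Suc[OF F H] by blast
  qed
  from cls_precomp[OF F E H a this] show ?thesis
    using aff_closed[OF E F a] by (simp add: pfun_comp_pfun image_subset_iff)
qed

section \<open>Smooth maps over a good topological ring\<close>

lemma lin_fst: "lin R (prod_module E F) E fst" and lin_snd: "lin R (prod_module E F) F snd"
  by (auto simp: lin_def continuous_map_fst continuous_map_snd)

lemma lin_pair: "lin R E F L \<Longrightarrow> lin R E G L' \<Longrightarrow> lin R E (prod_module F G) (\<lambda>x. (L x, L' x))"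
  by (auto simp: lin_def continuous_map_pairedI)

lemma aff_pair: "aff R E F \<phi> L \<Longrightarrow> aff R E G \<phi>' L' \<Longrightarrow> aff R E (prod_module F G) (\<lambda>x. (\<phi> x, \<phi>' x)) (\<lambda>x. (L x, L' x))"
  by (auto simp: aff_def lin_pair continuous_map_pairedI)

lemma lin_plus:
  assumes V: "topological_module R V"
  shows "lin R (prod_module V V) V (\<lambda>p. fst p \<oplus>\<^bsub>V\<^esub> snd p)"
proof -
  interpret V: Module.module R V by (rule topological_moduleD(2)[OF V])
  show ?thesis
    using V by (auto simp: lin_def topological_module_def case_prod_unfold V.M.a_ac V.smult_r_distr)
qed

locale good_ring =
  fixes K :: "'k top_ring"
  assumes good: "good_topological_ring K"
begin

lemma ring: "topological_ring K" and H: "Hausdorff_space (rtop K)"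
  and dense: "rtop K closure_of Units K = carrier K"
  using good by (auto simp: good_topological_ring_def)

lemma topspace_K [simp]: "topspace (rtop K) = carrier K"
  using ring by (simp add: topological_ring_def)

sublocale K: cring K
  using ring by (simp add: topological_ring_def)

lemma tm_regular: "topological_module K (regular_module K)"
  using ring H by blast

lemmas tm_prod = topological_module_prod[where R = K]

lemma tm_bracket: "topological_module K E \<Longrightarrow> topological_module K (bracket_module K E)"
  using topological_module_bracket H by blast

text \<open>The density of the units enters here and nowhere else: a continuous identity in one scalar variable need only be
  checked for units.\<close>

lemma eq_by_density:
  assumes p: "continuous_partial (rtop K) Y p" and q: "continuous_partial (rtop K) Y q"
    and Y: "Hausdorff_space Y" and d: "dom p = dom q"
    and eq: "\<And>s. s \<in> dom p \<Longrightarrow> s \<in> Units K \<Longrightarrow> p s = q s"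
  shows "p = q"
proof
  fix s show "p s = q s"
  proof (cases "s \<in> dom p")
    case True
    let ?X = "subtopology (rtop K) (dom p)"
    have o: "openin (rtop K) (dom p)" using p by (simp add: continuous_partial_def)
    have "s \<in> carrier K" using True openin_subset[OF o] by auto
    then have "s \<in> rtop K closure_of (dom p \<inter> Units K)"
      using openin_Int_closure_of_subset[OF o, of "Units K"] True dense by auto
    then have "s \<in> ?X closure_of (dom p \<inter> Units K)"
      using closure_of_subtopology_open[of "rtop K" "dom p" "dom p \<inter> Units K"] o True by auto
    moreover have "continuous_map ?X Y (the \<circ> p)" "continuous_map ?X Y (the \<circ> q)"
      using p q d by (auto simp: continuous_partial_def)
    ultimately have "(the \<circ> p) s = (the \<circ> q) s"
      by (rule forall_in_closure_of_eq[OF _ Y]) (use eq in auto)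
    then show ?thesis using True d by (metis comp_apply domIff option.expand)
  next
    case False
    then show ?thesis using d by (metis domIff)
  qed
qed

lemma continuous_partial_slice:
  assumes E: "topological_module K E" and h: "continuous_partial (mtop (bracket_module K E)) T h"
    and x: "x \<in> carrier E" "v \<in> carrier E"
  shows "continuous_partial (rtop K) T (h \<circ>\<^sub>m pfun (carrier K) (\<lambda>s. (x, v, s)))"
proof -
  have "continuous_map (rtop K) (mtop (bracket_module K E)) (\<lambda>s. (x, v, s))"
    using x topological_moduleD(3)[OF E] by (auto intro!: continuous_map_pairedI)
  then have "continuous_partial (rtop K) (mtop (bracket_module K E)) (pfun (carrier K) (\<lambda>s. (x, v, s)))"
    using continuous_partial_pfun[of "rtop K"] by simp
  then show ?thesis using continuous_partial_comp h by blast
qed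

text \<open>The defining equation of \<open>f^[1]\<close>, multiplied by \<open>s\<close> and extended to all scalars by density. This form contains no
  division, so that functors can be applied to it.\<close>

lemma diff_quot_formula:
  assumes E: "topological_module K E" and F: "topological_module K F"
    and f: "continuous_partial (mtop E) (mtop F) f" and h: "is_diff_quot K E F f h"
    and b: "(x, v, s) \<in> bracket1 K E (dom f)"
  shows "the (f (x \<oplus>\<^bsub>E\<^esub> s \<odot>\<^bsub>E\<^esub> v)) = the (f x) \<oplus>\<^bsub>F\<^esub> s \<odot>\<^bsub>F\<^esub> the (h (x, v, s))"
proof -
  interpret E: Module.module K E by (rule topological_moduleD(2)[OF E])
  interpret F: Module.module K F by (rule topological_moduleD(2)[OF F])
  have dE: "dom f \<subseteq> carrier E" and rF: "ran f \<subseteq> carrier F"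
    using f topological_moduleD(3)[OF E] topological_moduleD(3)[OF F] by (auto simp: continuous_partial_iff)
  have x: "x \<in> dom f" "x \<in> carrier E" "v \<in> carrier E" "s \<in> carrier K" using b dE by (auto simp: bracket1_def)
  then have fx: "the (f x) \<in> carrier F" using rF by (auto simp: ran_def)
  let ?h = "h \<circ>\<^sub>m pfun (carrier K) (\<lambda>s. (x, v, s))"
  let ?f = "f \<circ>\<^sub>m pfun (carrier K) (\<lambda>s. x \<oplus>\<^bsub>E\<^esub> s \<odot>\<^bsub>E\<^esub> v)"
  let ?q = "map_option (\<lambda>p. the (f x) \<oplus>\<^bsub>F\<^esub> fst p \<odot>\<^bsub>F\<^esub> snd p) \<circ> ppair (pfun (carrier K) id) ?h"
  have ch: "continuous_partial (rtop K) (mtop F) ?h"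
    using continuous_partial_slice[OF E _ x(2,3)] h by (auto simp: is_diff_quot_def simp del: prod_module_simps)
  have rh: "ran h \<subseteq> carrier F"
    using h topological_moduleD(3)[OF F] by (auto simp: is_diff_quot_def continuous_partial_iff)
  have "?f = ?q"
  proof (rule eq_by_density[OF _ _ topological_moduleD(4)[OF F]])
    have "continuous_map (rtop K) (mtop E) (\<lambda>s. x \<oplus>\<^bsub>E\<^esub> s \<odot>\<^bsub>E\<^esub> v)"
      using x topological_moduleD(3)[OF E]
      by (intro continuous_add[OF E] continuous_smult[OF E]) (auto intro: continuous_map_id[unfolded id_def])
    then show "continuous_partial (rtop K) (mtop F) ?f"
      using continuous_partial_comp[OF continuous_partial_pfun f] by fastforce
    have "continuous_map (prod_topology (rtop K) (mtop F)) (mtop F) (\<lambda>p. the (f x) \<oplus>\<^bsub>F\<^esub> fst p \<odot>\<^bsub>F\<^esub> snd p)"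
      using fx topological_moduleD(3)[OF F]
      by (intro continuous_add[OF F] continuous_smult[OF F] continuous_map_fst continuous_map_snd) auto
    moreover have "continuous_partial (rtop K) (rtop K) (pfun (carrier K) id)"
      using continuous_partial_pfun[OF continuous_map_id, of "rtop K"] by simp
    ultimately show "continuous_partial (rtop K) (mtop F) ?q"
      using continuous_partial_post[OF continuous_partial_ppair[OF _ ch]] by blast
    have "dom ?h = dom ?f" using x is_diff_quot_dom[OF h] by (auto simp: bracket1_def)
    then show d: "dom ?f = dom ?q" by auto
    fix s assume s: "s \<in> dom ?f" "s \<in> Units K"
    then have sc: "s \<in> carrier K" and fs: "x \<oplus>\<^bsub>E\<^esub> s \<odot>\<^bsub>E\<^esub> v \<in> dom f" by auto
    let ?y = "the (f (x \<oplus>\<^bsub>E\<^esub> s \<odot>\<^bsub>E\<^esub> v))"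
    have y: "?y \<in> carrier F" using fs rF by (auto simp: ran_def)
    have "h (x, v, s) = Some (inv\<^bsub>K\<^esub> s \<odot>\<^bsub>F\<^esub> (?y \<ominus>\<^bsub>F\<^esub> the (f x)))"
      using h s fs x by (auto simp: is_diff_quot_def bracket1_def)
    moreover have "s \<odot>\<^bsub>F\<^esub> (inv\<^bsub>K\<^esub> s \<odot>\<^bsub>F\<^esub> (?y \<ominus>\<^bsub>F\<^esub> the (f x))) = ?y \<ominus>\<^bsub>F\<^esub> the (f x)"
      using s sc y fx by (simp add: F.smult_assoc1[symmetric] K.Units_inv_closed K.Units_r_inv)
    moreover have "the (f x) \<oplus>\<^bsub>F\<^esub> (?y \<ominus>\<^bsub>F\<^esub> the (f x)) = ?y"
      using y fx by (simp add: F.M.minus_eq F.M.add.m_lcomm[of "the (f x)"] F.M.r_neg)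
    ultimately show "?f s = ?q s"
      using sc fs by (simp add: map_comp_pfun ppair_def) (auto simp: map_comp_pfun domIff)
  qed
  then have "?f s = ?q s" by simp
  moreover have "(x, v, s) \<in> dom h" using b is_diff_quot_dom[OF h] by auto
  ultimately show ?thesis using x by (auto simp: map_comp_pfun ppair_def)
qed

lemma diff_quot_unique:
  fixes E :: "('k, 'e) top_module"
  assumes E: "topological_module K E" and F: "topological_module K F"
    and f: "dom f \<subseteq> carrier E" and h: "is_diff_quot K E F f h" and h': "is_diff_quot K E F f h'"
  shows "h = h'"
proof
  fix q :: "'e \<times> 'e \<times> 'k" obtain x v s where q: "q = (x, v, s)" by (cases q) auto
  show "h q = h' q"
  proof (cases "q \<in> dom h")
    case True
    then have b: "(x, v, s) \<in> bracket1 K E (dom f)" using is_diff_quot_dom[OF h] q by auto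
    then have x: "x \<in> carrier E" "v \<in> carrier E" "s \<in> carrier K" using f by (auto simp: bracket1_def)
    have "h \<circ>\<^sub>m pfun (carrier K) (\<lambda>s. (x, v, s)) = h' \<circ>\<^sub>m pfun (carrier K) (\<lambda>s. (x, v, s))"
    proof (rule eq_by_density[OF _ _ topological_moduleD(4)[OF F]])
      fix s assume "s \<in> dom (h \<circ>\<^sub>m pfun (carrier K) (\<lambda>s. (x, v, s)))" "s \<in> Units K"
      then show "(h \<circ>\<^sub>m pfun (carrier K) (\<lambda>s. (x, v, s))) s = (h' \<circ>\<^sub>m pfun (carrier K) (\<lambda>s. (x, v, s))) s"
        using h h' by (auto simp: map_comp_pfun is_diff_quot_def simp del: prod_module_simps)
    qed (use h h' continuous_partial_slice[OF E _ x(1,2)] in \<open>auto simp: is_diff_quot_def simp del: prod_module_simps\<close>)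
    then show ?thesis using q x by (metis map_comp_pfun)
  next
    case False
    then show ?thesis using is_diff_quot_dom[OF h] is_diff_quot_dom[OF h'] by (metis domIff)
  qed
qed

lemma lin_snd_snd: "lin R (prod_module E (prod_module F G)) G (\<lambda>q. snd (snd q))"
  and lin_fst_snd: "lin R (prod_module E (prod_module F G)) F (\<lambda>q. fst (snd q))"
  by (auto simp: lin_def intro: continuous_map_compose[OF continuous_map_snd continuous_map_snd, unfolded o_def]
    continuous_map_compose[OF continuous_map_snd continuous_map_fst, unfolded o_def])

text \<open>The inner map of the chain rule: \<open>(g \<circ> f)^[1]\<close> is the composite of \<open>g^[1]\<close> with this map for \<open>h = f^[1]\<close>.\<close>

definition bracket_map :: "('k, 'e) top_module \<Rightarrow> ('e \<rightharpoonup> 'f) \<Rightarrow> ('e \<times> 'e \<times> 'k \<rightharpoonup> 'f) \<Rightarrow> ('e \<times> 'e \<times> 'k \<rightharpoonup> 'f \<times> 'f \<times> 'k)" where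
  "bracket_map E f h = ppair (f \<circ>\<^sub>m pfun (carrier (bracket_module K E)) fst)
     (ppair h (pfun (carrier (bracket_module K E)) (\<lambda>q. snd (snd q))))"

lemma cls_bracket_map:
  assumes E: "topological_module K E" and F: "topological_module K F"
    and "cls n K E F f" "cls n K (bracket_module K E) F h"
  shows "cls n K (bracket_module K E) (bracket_module K F) (bracket_map E f h)"
  unfolding bracket_map_def
  by (rule cls_ppair[OF F tm_prod[OF F tm_regular] cls_precomp[OF E tm_bracket[OF E] H lin_aff[OF lin_fst] assms(3)]
      cls_ppair[OF F tm_regular assms(4) aff_pfun_cls[OF tm_bracket[OF E] tm_regular H lin_aff[OF lin_snd_snd]]]])

text \<open>Chain rule. By the division-free formula \<open>f x + s f^[1] (x, v, s) = f (x + s v)\<close> for all \<open>s\<close>, the bracket map of \<open>f\<close>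
  carries the bracket of the domain of \<open>g \<circ> f\<close> exactly into the bracket of the domain of \<open>g\<close>.\<close>

lemma diff_quot_comp:
  assumes E: "topological_module K E" and F: "topological_module K F" and G: "topological_module K G"
    and f: "continuous_partial (mtop E) (mtop F) f" and hf: "is_diff_quot K E F f hf"
    and g: "continuous_partial (mtop F) (mtop G) g" and hg: "is_diff_quot K F G g hg"
  shows "is_diff_quot K E G (g \<circ>\<^sub>m f) (hg \<circ>\<^sub>m bracket_map E f hf)"
proof -
  let ?p = "bracket_map E f hf" and ?B = "bracket_module K E" and ?BF = "bracket_module K F"
  have dE: "dom f \<subseteq> carrier E" and rF: "ran f \<subseteq> carrier F" and rh: "ran hf \<subseteq> carrier F"
    using f hf topological_moduleD(3)[OF E] topological_moduleD(3)[OF F]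
    by (auto simp: continuous_partial_iff is_diff_quot_def)
  have dp: "dom ?p = bracket1 K E (dom f)"
    using is_diff_quot_dom[OF hf] dE by (auto simp: bracket_map_def bracket1_def)
  have p: "?p (x, v, s) = Some (the (f x), the (hf (x, v, s)), s)"
    and fo: "the (f (x \<oplus>\<^bsub>E\<^esub> s \<odot>\<^bsub>E\<^esub> v)) = the (f x) \<oplus>\<^bsub>F\<^esub> s \<odot>\<^bsub>F\<^esub> the (hf (x, v, s))"
    and hc: "the (hf (x, v, s)) \<in> carrier F"
    if "(x, v, s) \<in> bracket1 K E (dom f)" for x v s
  proof -
    have d: "(x, v, s) \<in> dom hf" "x \<in> dom f" "(x, v, s) \<in> carrier ?B"
      using that dE is_diff_quot_dom[OF hf] by (auto simp: bracket1_def)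
    then show "?p (x, v, s) = Some (the (f x), the (hf (x, v, s)), s)"
      unfolding bracket_map_def ppair_eq_Some by (auto simp: map_comp_pfun ppair_eq_Some)
    show "the (hf (x, v, s)) \<in> carrier F" using d(1) rh by (metis domD option.sel ranI subsetD)
    show "the (f (x \<oplus>\<^bsub>E\<^esub> s \<odot>\<^bsub>E\<^esub> v)) = the (f x) \<oplus>\<^bsub>F\<^esub> s \<odot>\<^bsub>F\<^esub> the (hf (x, v, s))"
      by (rule diff_quot_formula[OF E F f hf that])
  qed
  have cp: "continuous_partial (mtop ?B) (mtop ?BF) ?p"
    using cls_bracket_map[OF E F, of 0 f hf] f hf unfolding is_diff_quot_def
    by (simp add: cls_0 E tm_bracket F del: prod_module_simps)
  show ?thesis
    unfolding is_diff_quot_def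
  proof (intro conjI allI impI)
    show "continuous_partial (mtop ?B) (mtop G) (hg \<circ>\<^sub>m ?p)"
      by (rule continuous_partial_comp[OF cp]) (use hg in \<open>simp add: is_diff_quot_def del: prod_module_simps\<close>)
    have *: "(x, v, s) \<in> dom (hg \<circ>\<^sub>m ?p) \<longleftrightarrow> (x, v, s) \<in> bracket1 K E (dom (g \<circ>\<^sub>m f))" for x v s
    proof (cases "(x, v, s) \<in> bracket1 K E (dom f)")
      case True
      then obtain a b where ab: "f x = Some a" "f (x \<oplus>\<^bsub>E\<^esub> s \<odot>\<^bsub>E\<^esub> v) = Some b"
        "v \<in> carrier E" "s \<in> carrier K" by (auto simp: bracket1_def)
      have "(x, v, s) \<in> dom (hg \<circ>\<^sub>m ?p) \<longleftrightarrow> (a, the (hf (x, v, s)), s) \<in> bracket1 K F (dom g)"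
        unfolding is_diff_quot_dom[OF hg, symmetric] using p[OF True] ab by (simp add: map_comp_def domIff)
      also have "\<dots> \<longleftrightarrow> a \<in> dom g \<and> b \<in> dom g"
        using hc[OF True] fo[OF True] ab by (auto simp: bracket1_def)
      also have "\<dots> \<longleftrightarrow> (x, v, s) \<in> bracket1 K E (dom (g \<circ>\<^sub>m f))"
        using ab by (simp add: bracket1_def map_comp_def dom_def)
      finally show ?thesis .
    next
      case False
      then have "?p (x, v, s) = None" "(x, v, s) \<notin> bracket1 K E (dom (g \<circ>\<^sub>m f))"
        using dp by (metis domIff) (use False in \<open>auto simp: bracket1_def map_comp_def split: option.splits\<close>)
      then show ?thesis by (simp add: domIff)
    qed
    then show "dom (hg \<circ>\<^sub>m ?p) = bracket1 K E (dom (g \<circ>\<^sub>m f))" by auto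
    fix x v s assume A: "(x, v, s) \<in> bracket1 K E (dom (g \<circ>\<^sub>m f)) \<and> s \<in> Units K"
    then have T: "(x, v, s) \<in> bracket1 K E (dom f)" by (auto simp: bracket1_def map_comp_def split: option.splits)
    then obtain a b where ab: "f x = Some a" "f (x \<oplus>\<^bsub>E\<^esub> s \<odot>\<^bsub>E\<^esub> v) = Some b" by (auto simp: bracket1_def)
    have "(a, the (hf (x, v, s)), s) \<in> bracket1 K F (dom g)"
      unfolding is_diff_quot_dom[OF hg, symmetric] using A *[of x v s] p[OF T] ab by (simp add: domIff)
    then show "(hg \<circ>\<^sub>m ?p) (x, v, s) = Some (inv\<^bsub>K\<^esub> s \<odot>\<^bsub>G\<^esub>
       (the ((g \<circ>\<^sub>m f) (x \<oplus>\<^bsub>E\<^esub> s \<odot>\<^bsub>E\<^esub> v)) \<ominus>\<^bsub>G\<^esub> the ((g \<circ>\<^sub>m f) x)))"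
      using hg A p[OF T] ab fo[OF T] by (simp add: is_diff_quot_def map_comp_def)
  qed
qed

text \<open>Passing to difference quotients changes the types of both modules. On the tree type the brackets can be renamed
  back into the same type, so that the induction hypothesis applies.\<close>

lemma cls_comp_tup:
  fixes E :: "('k, ('e, 'k) tup) top_module" and F :: "('k, ('f, 'k) tup) top_module"
  assumes "topological_module K E" "topological_module K F" and G: "topological_module K G"
    and "cls n K E F f" "cls n K F G g"
  shows "cls n K E G (g \<circ>\<^sub>m f)"
  using assms(1,2,4,5)
proof (induction n arbitrary: E F f g)
  case 0
  then show ?case using continuous_partial_comp by (auto simp: cls_0)
next
  case (Suc n)
  note E = Suc.prems(1) and F = Suc.prems(2)
  let ?B = "bracket_module K E" and ?BF = "bracket_module K F"
  note B = tm_bracket[OF E] and BF = tm_bracket[OF F]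
  note N = relabel_module_iso[OF B inj_node] and NF = relabel_module_iso[OF BF inj_node]
  obtain hf hg where hf: "is_diff_quot K E F f hf" and Cf: "cls n K ?B F hf"
    and hg: "is_diff_quot K F G g hg" and Cg: "cls n K ?BF G hg"
    using Suc.prems(3,4) by (auto simp: cls_Suc E F H)
  have cf: "continuous_partial (mtop E) (mtop F) f" and cg: "continuous_partial (mtop F) (mtop G) g"
    using Suc.prems cls_continuous H by blast+
  let ?p = "bracket_map E f hf"
  let ?p1 = "map_option node \<circ> relabel_dom (carrier ?B) node ?p"
  let ?hg1 = "relabel_dom (carrier ?BF) node hg"
  have p: "cls n K ?B ?BF ?p"
    by (rule cls_bracket_map[OF E F cls_down[OF Suc.prems(3)] Cf])
  then have dp: "dom ?p \<subseteq> carrier ?B" by (simp add: cls_def)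
  have rp: "ran ?p \<subseteq> carrier ?BF"
    using cls_continuous[OF B H p] topological_moduleD(3)[OF BF] by (auto simp: continuous_partial_iff simp del: prod_module_simps)
  have "cls n K (relabel_module node ?B) ?BF (relabel_dom (carrier ?B) node ?p)"
    using p cls_relabel[OF B H inj_node dp] by blast
  then have p1: "cls n K (relabel_module node ?B) (relabel_module node ?BF) ?p1"
    by (rule cls_post[OF BF NF(1,2)])
  have hg1: "cls n K (relabel_module node ?BF) G ?hg1"
    using Cg cls_relabel[OF BF H inj_node] by (metis cls_def)
  have "cls n K (relabel_module node ?B) G (?hg1 \<circ>\<^sub>m ?p1)"
    by (rule Suc.IH[OF N(1) NF(1) p1 hg1])
  then have "cls n K ?B G ((?hg1 \<circ>\<^sub>m ?p1) \<circ>\<^sub>m pfun (carrier ?B) node)"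
    by (rule cls_precomp[OF N(1) B H lin_aff[OF N(2)]])
  moreover have "(?hg1 \<circ>\<^sub>m ?p1) \<circ>\<^sub>m pfun (carrier ?B) node = hg \<circ>\<^sub>m ?p"
  proof
    fix q
    show "((?hg1 \<circ>\<^sub>m ?p1) \<circ>\<^sub>m pfun (carrier ?B) node) q = (hg \<circ>\<^sub>m ?p) q"
    proof (cases "?p q")
      case None
      then show ?thesis by (auto simp: map_comp_def pfun_def relabel_dom_def inv_into_f_f[OF inj_node] simp del: prod_module_simps)
    next
      case (Some y)
      then have "q \<in> carrier ?B" "y \<in> carrier ?BF" using dp rp by (auto intro: subsetD ranI simp del: prod_module_simps)
      then show ?thesis using Some by (simp add: map_comp_def pfun_def relabel_dom_def inv_into_f_f[OF inj_node] del: prod_module_simps)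
    qed
  qed
  ultimately have "cls n K ?B G (hg \<circ>\<^sub>m ?p)" by simp
  then show ?case
    using diff_quot_comp[OF E F G cf hf cg hg] continuous_partial_comp[OF cf cg]
    unfolding cls_Suc[OF E H] by blast
qed

lemma cls_comp:
  fixes E :: "('k, 'e) top_module" and F :: "('k, 'f) top_module"
  assumes E: "topological_module K E" and F: "topological_module K F" and G: "topological_module K G"
    and f: "cls n K E F f" and g: "cls n K F G g"
  shows "cls n K E G (g \<circ>\<^sub>m f)"
proof -
  let ?LE = "Leaf :: 'e \<Rightarrow> ('e, 'k) tup" and ?LF = "Leaf :: 'f \<Rightarrow> ('f, 'k) tup"
  note N = relabel_module_iso[where h = ?LE, OF E inj_Leaf] and NF = relabel_module_iso[where h = ?LF, OF F inj_Leaf]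
  let ?f = "map_option ?LF \<circ> relabel_dom (carrier E) ?LE f" and ?g = "relabel_dom (carrier F) ?LF g"
  have df: "dom f \<subseteq> carrier E" "dom g \<subseteq> carrier F" using f g by (auto simp: cls_def)
  have rf: "ran f \<subseteq> carrier F"
    using cls_continuous[OF E H f] topological_moduleD(3)[OF F] by (auto simp: continuous_partial_iff)
  have "cls n K (relabel_module ?LE E) (relabel_module ?LF F) ?f"
    by (rule cls_post[OF F NF(1,2)]) (use cls_relabel[where h = ?LE, OF E H inj_Leaf df(1)] f in blast)
  moreover have "cls n K (relabel_module ?LF F) G ?g"
    using cls_relabel[where h = ?LF, OF F H inj_Leaf df(2)] g by blast
  ultimately have "cls n K (relabel_module ?LE E) G (?g \<circ>\<^sub>m ?f)"
    by (rule cls_comp_tup[OF N(1) NF(1) G])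
  then have "cls n K E G ((?g \<circ>\<^sub>m ?f) \<circ>\<^sub>m pfun (carrier E) ?LE)"
    by (rule cls_precomp[OF N(1) E H lin_aff[OF N(2)]])
  moreover have "(?g \<circ>\<^sub>m ?f) \<circ>\<^sub>m pfun (carrier E) ?LE = g \<circ>\<^sub>m f"
  proof
    fix q
    show "((?g \<circ>\<^sub>m ?f) \<circ>\<^sub>m pfun (carrier E) ?LE) q = (g \<circ>\<^sub>m f) q"
    proof (cases "f q")
      case None
      then show ?thesis by (auto simp: map_comp_def pfun_def relabel_dom_def)
    next
      case (Some y)
      then have "q \<in> carrier E" "y \<in> carrier F" using df rf by (auto simp: ran_def)
      then show ?thesis using Some by (simp add: map_comp_def pfun_def relabel_dom_def)
    qed
  qed
  ultimately show ?thesis by simp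
qed

text \<open>Smoothness over \<open>K\<close>, for maps whose domain lies in the module.\<close>

definition sm :: "('k, 'e) top_module \<Rightarrow> ('k, 'f) top_module \<Rightarrow> ('e \<rightharpoonup> 'f) \<Rightarrow> bool" where
  "sm E F f \<longleftrightarrow> (\<forall>n. cls n K E F f)"

text \<open>The map \<open>f^[1]\<close>; over a good ring it is unique.\<close>

definition DQ :: "('k, 'e) top_module \<Rightarrow> ('k, 'f) top_module \<Rightarrow> ('e \<rightharpoonup> 'f) \<Rightarrow> ('e \<times> 'e \<times> 'k \<rightharpoonup> 'f)" where
  "DQ E F f = (THE h. is_diff_quot K E F f h)"

lemma sm_dom: "sm E F f \<Longrightarrow> dom f \<subseteq> carrier E"
  by (auto simp: sm_def cls_def)

lemma sm_continuous: "topological_module K E \<Longrightarrow> sm E F f \<Longrightarrow> continuous_partial (mtop E) (mtop F) f"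
  using H by (auto simp: sm_def intro: cls_continuous)

lemma sm_ran: "topological_module K E \<Longrightarrow> topological_module K F \<Longrightarrow> sm E F f \<Longrightarrow> ran f \<subseteq> carrier F"
  using sm_continuous[of E F f] topological_moduleD(3)[of K F] by (auto simp: continuous_partial_iff)

lemma DQ_eq:
  assumes "topological_module K E" "topological_module K F" "dom f \<subseteq> carrier E" "is_diff_quot K E F f h"
  shows "DQ E F f = h"
  unfolding DQ_def using assms diff_quot_unique[OF assms(1-3)] by blast

text \<open>Uniqueness makes the difference quotients found for the various \<open>n\<close> equal, hence \<open>f^[1]\<close> is itself smooth.\<close>

lemma sm_DQ:
  assumes E: "topological_module K E" and F: "topological_module K F" and f: "sm E F f"
  shows "is_diff_quot K E F f (DQ E F f)" and "sm (bracket_module K E) F (DQ E F f)"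
proof -
  have "\<exists>h. is_diff_quot K E F f h \<and> cls n K (bracket_module K E) F h" for n
    using f by (auto simp: sm_def cls_Suc[OF E H, symmetric] dest: spec[of _ "Suc n"]) (metis cls_Suc[OF E H])
  then show "is_diff_quot K E F f (DQ E F f)" "sm (bracket_module K E) F (DQ E F f)"
    using DQ_eq[OF E F sm_dom[OF f]] unfolding sm_def by metis+
qed

lemma sm_comp: "topological_module K E \<Longrightarrow> topological_module K F \<Longrightarrow> topological_module K G \<Longrightarrow>
    sm E F f \<Longrightarrow> sm F G g \<Longrightarrow> sm E G (g \<circ>\<^sub>m f)"
  unfolding sm_def using cls_comp by blast

lemma sm_precomp: "topological_module K E \<Longrightarrow> topological_module K E' \<Longrightarrow> aff K E' E \<phi> L \<Longrightarrow>
    sm E F f \<Longrightarrow> sm E' F (f \<circ>\<^sub>m pfun (carrier E') \<phi>)"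
  unfolding sm_def using cls_precomp H by blast

lemma sm_post: "topological_module K F \<Longrightarrow> topological_module K G \<Longrightarrow> lin K F G L \<Longrightarrow>
    sm E F f \<Longrightarrow> sm E G (map_option L \<circ> f)"
  unfolding sm_def using cls_post by blast

lemma sm_ppair: "topological_module K F \<Longrightarrow> topological_module K G \<Longrightarrow>
    sm E F f \<Longrightarrow> sm E G g \<Longrightarrow> sm E (prod_module F G) (ppair f g)"
  unfolding sm_def using cls_ppair by blast

lemma sm_pfun: "topological_module K E \<Longrightarrow> topological_module K F \<Longrightarrow> aff K E F \<phi> L \<Longrightarrow> sm E F (pfun (carrier E) \<phi>)"
  unfolding sm_def using aff_pfun_cls H by blast

text \<open>For a quadratic map with polar form \<open>\<beta>\<close>, the equation assumed is the division-free formula for the difference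
  quotient \<open>\<beta> p p\<^sub>1 + s q p\<^sub>1\<close>. It covers the scalar multiplication of \<open>K\<close> as well as the action of \<open>K^A\<close>.\<close>

lemma diff_quot_quadratic:
  fixes S :: "('k, 'e) top_module"
  assumes S: "topological_module K S" and G: "topological_module K G"
    and q: "continuous_map (mtop S) (mtop G) q"
    and b: "continuous_map (prod_topology (mtop S) (mtop S)) (mtop G) (\<lambda>p. \<beta> (fst p) (snd p))"
    and eq: "\<And>p p' s. p \<in> carrier S \<Longrightarrow> p' \<in> carrier S \<Longrightarrow> s \<in> carrier K \<Longrightarrow>
       q (p \<oplus>\<^bsub>S\<^esub> s \<odot>\<^bsub>S\<^esub> p') = q p \<oplus>\<^bsub>G\<^esub> s \<odot>\<^bsub>G\<^esub> (\<beta> p p' \<oplus>\<^bsub>G\<^esub> s \<odot>\<^bsub>G\<^esub> q p')"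
  shows "is_diff_quot K S G (pfun (carrier S) q) (pfun (carrier (bracket_module K S))
    (\<lambda>p. \<beta> (fst p) (fst (snd p)) \<oplus>\<^bsub>G\<^esub> snd (snd p) \<odot>\<^bsub>G\<^esub> q (fst (snd p))))"
proof -
  interpret S: Module.module K S by (rule topological_moduleD(2)[OF S])
  interpret G: Module.module K G by (rule topological_moduleD(2)[OF G])
  let ?B = "bracket_module K S"
  let ?h = "pfun (carrier ?B) (\<lambda>p. \<beta> (fst p) (fst (snd p)) \<oplus>\<^bsub>G\<^esub> snd (snd p) \<odot>\<^bsub>G\<^esub> q (fst (snd p)))"
  have qc: "p \<in> carrier S \<Longrightarrow> q p \<in> carrier G" for p
    using q topological_moduleD(3)[OF S] topological_moduleD(3)[OF G] by (auto simp: continuous_map_def)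
  have "(\<lambda>p. \<beta> (fst p) (snd p)) \<in> carrier S \<times> carrier S \<rightarrow> carrier G"
    using b topological_moduleD(3)[OF S] topological_moduleD(3)[OF G] by (simp add: continuous_map_def)
  then have bc: "p \<in> carrier S \<Longrightarrow> p' \<in> carrier S \<Longrightarrow> \<beta> p p' \<in> carrier G" for p p'
    using funcset_mem[of _ _ _ "(p, p')"] by fastforce
  show ?thesis
    unfolding is_diff_quot_def
  proof (intro conjI allI impI)
    let ?P = "prod_topology (mtop S) (prod_topology (mtop S) (rtop K))"
    note c1 = continuous_map_compose[OF continuous_map_snd continuous_map_fst, unfolded o_def, of "mtop S" "mtop S" "rtop K"]
      and c2 = continuous_map_compose[OF continuous_map_snd continuous_map_snd, unfolded o_def, of "mtop S" "mtop S" "rtop K"]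
    have "continuous_map ?P (mtop G) (\<lambda>p. \<beta> (fst p) (fst (snd p)))"
      using continuous_map_compose[OF continuous_map_pairedI[OF continuous_map_fst c1] b] by (simp add: o_def)
    then have "continuous_map ?P (mtop G) (\<lambda>p. \<beta> (fst p) (fst (snd p)) \<oplus>\<^bsub>G\<^esub> snd (snd p) \<odot>\<^bsub>G\<^esub> q (fst (snd p)))"
      by (intro continuous_add[OF G] continuous_smult[OF G] c2 continuous_map_compose[OF c1 q, unfolded o_def])
    then show "continuous_partial (mtop ?B) (mtop G) ?h"
      using continuous_partial_pfun[of "mtop ?B" "mtop G"] topological_moduleD(3)[OF tm_bracket[OF S]] by simp
    fix p p' s assume A: "(p, p', s) \<in> bracket1 K S (dom (pfun (carrier S) q)) \<and> s \<in> Units K"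
    then have cc: "p \<in> carrier S" "p' \<in> carrier S" "s \<in> carrier K" "s \<in> Units K" by (auto simp: bracket1_def)
    let ?d = "\<beta> p p' \<oplus>\<^bsub>G\<^esub> s \<odot>\<^bsub>G\<^esub> q p'"
    have d: "?d \<in> carrier G" "q p \<in> carrier G" using cc qc bc by auto
    have "(q p \<oplus>\<^bsub>G\<^esub> s \<odot>\<^bsub>G\<^esub> ?d) \<ominus>\<^bsub>G\<^esub> q p = s \<odot>\<^bsub>G\<^esub> ?d"
      using cc(3) d by (simp add: G.M.minus_eq G.M.add.m_lcomm[of "s \<odot>\<^bsub>G\<^esub> ?d"] G.M.add.m_assoc G.M.add.m_comm[of "s \<odot>\<^bsub>G\<^esub> ?d"] G.M.r_neg2 G.M.r_neg)
    then have "inv\<^bsub>K\<^esub> s \<odot>\<^bsub>G\<^esub> ((q p \<oplus>\<^bsub>G\<^esub> s \<odot>\<^bsub>G\<^esub> ?d) \<ominus>\<^bsub>G\<^esub> q p) = ?d"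
      using cc(3,4) d by (simp only: G.smult_assoc1[symmetric] K.Units_inv_closed K.Units_l_inv G.smult_one)
    then show "?h (p, p', s) = Some (inv\<^bsub>K\<^esub> s \<odot>\<^bsub>G\<^esub>
        (the (pfun (carrier S) q (p \<oplus>\<^bsub>S\<^esub> s \<odot>\<^bsub>S\<^esub> p')) \<ominus>\<^bsub>G\<^esub> the (pfun (carrier S) q p)))"
      using cc eq by simp
  qed (auto simp: bracket1_def)
qed

definition smul :: "('k, 'e) top_module \<Rightarrow> 'k \<times> 'e \<rightharpoonup> 'e" where
  "smul V = pfun (carrier K \<times> carrier V) (\<lambda>p. fst p \<odot>\<^bsub>V\<^esub> snd p)"

abbreviation scalars where "scalars V \<equiv> prod_module (regular_module K) V"

text \<open>The difference quotient \<open>r x\<^sub>1 + r\<^sub>1 x + s (r\<^sub>1 x\<^sub>1)\<close> is built from scalar multiplications, linear maps and sums, so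
  that \<open>C^n\<close> for the scalar multiplication implies \<open>C^n\<close> for its difference quotient.\<close>

lemma sm_smul:
  assumes V: "topological_module K V"
  shows "sm (scalars V) V (smul V)"
proof -
  interpret V: Module.module K V by (rule topological_moduleD(2)[OF V])
  let ?S = "scalars V" and ?B = "bracket_module K (scalars V)"
  note S = tm_prod[OF tm_regular V]
  note B = tm_bracket[OF S]
  note VV = tm_prod[OF V V]
  let ?q = "\<lambda>p. fst p \<odot>\<^bsub>V\<^esub> snd p" and ?b = "\<lambda>p p'. fst p \<odot>\<^bsub>V\<^esub> snd p' \<oplus>\<^bsub>V\<^esub> fst p' \<odot>\<^bsub>V\<^esub> snd p"
  have sm: "smul V = pfun (carrier ?S) ?q" by (simp add: smul_def)
  have q: "continuous_map (mtop ?S) (mtop V) ?q"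
    using V by (simp add: topological_module_def case_prod_unfold)
  have b: "continuous_map (prod_topology (mtop ?S) (mtop ?S)) (mtop V) (\<lambda>p. ?b (fst p) (snd p))"
    unfolding prod_module_simps regular_module_simps
    by (intro continuous_add[OF V] continuous_smult[OF V]
        continuous_map_compose[OF continuous_map_fst continuous_map_fst, unfolded o_def]
        continuous_map_compose[OF continuous_map_fst continuous_map_snd, unfolded o_def]
        continuous_map_compose[OF continuous_map_snd continuous_map_fst, unfolded o_def]
        continuous_map_compose[OF continuous_map_snd continuous_map_snd, unfolded o_def])
  have eq: "?q (p \<oplus>\<^bsub>?S\<^esub> s \<odot>\<^bsub>?S\<^esub> p') = ?q p \<oplus>\<^bsub>V\<^esub> s \<odot>\<^bsub>V\<^esub> (?b p p' \<oplus>\<^bsub>V\<^esub> s \<odot>\<^bsub>V\<^esub> ?q p')"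
    if "p \<in> carrier ?S" "p' \<in> carrier ?S" and s: "s \<in> carrier K" for p p' s
  proof -
    obtain r x r' x' where p: "p = (r, x)" "p' = (r', x')" by (cases p; cases p') auto
    have c: "r \<in> carrier K" "x \<in> carrier V" "r' \<in> carrier K" "x' \<in> carrier V" using that p by auto
    have com: "s \<odot>\<^bsub>V\<^esub> (a \<odot>\<^bsub>V\<^esub> y) = a \<odot>\<^bsub>V\<^esub> (s \<odot>\<^bsub>V\<^esub> y)" if "a \<in> carrier K" "y \<in> carrier V" for a y
      using that s by (metis K.m_comm V.smult_assoc1)
    show ?thesis
      using c s by (simp add: p V.smult_l_distr V.smult_r_distr V.smult_assoc1 com[of r x'] com[of r' x'] V.M.a_ac)
  qed
  note dq = diff_quot_quadratic[OF S V q b eq, folded sm]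
  have l: "lin K ?B ?S (\<lambda>p. (fst (fst p), snd (fst (snd p))))"
    "lin K ?B ?S (\<lambda>p. (fst (fst (snd p)), snd (fst p)))" "lin K ?B ?S (\<lambda>p. fst (snd p))"
    using lin_pair[OF lin_comp[OF B S lin_fst lin_fst] lin_comp[OF B S lin_fst_snd lin_snd]]
      lin_pair[OF lin_comp[OF B S lin_fst_snd lin_fst] lin_comp[OF B S lin_fst lin_snd]] lin_fst_snd
    by (simp_all add: o_def)
  define m where "m f = smul V \<circ>\<^sub>m pfun (carrier ?B) f" for f
  define h where "h = map_option (\<lambda>p. fst p \<oplus>\<^bsub>V\<^esub> snd p) \<circ> ppair
      (map_option (\<lambda>p. fst p \<oplus>\<^bsub>V\<^esub> snd p) \<circ> ppair (m (\<lambda>p. (fst (fst p), snd (fst (snd p))))) (m (\<lambda>p. (fst (fst (snd p)), snd (fst p)))))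
      (smul V \<circ>\<^sub>m ppair (pfun (carrier ?B) (\<lambda>q. snd (snd q))) (m (\<lambda>p. fst (snd p))))"
  have h: "pfun (carrier ?B) (\<lambda>p. ?b (fst p) (fst (snd p)) \<oplus>\<^bsub>V\<^esub> snd (snd p) \<odot>\<^bsub>V\<^esub> ?q (fst (snd p))) = h"
    by (rule ext) (auto simp: h_def m_def smul_def pfun_def map_comp_def ppair_def)
  have step: "cls n K ?B V h" if n: "cls n K ?S V (smul V)" for n
  proof -
    have m: "cls n K ?B V (m f)" if "lin K ?B ?S f" for f
      unfolding m_def by (rule cls_precomp[OF S B H lin_aff[OF that] n])
    show ?thesis
      unfolding h_def
      by (intro cls_post[OF VV V lin_plus[OF V]] cls_ppair[OF V V] m l cls_comp[OF B S V _ n]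
        cls_ppair[OF tm_regular V] aff_pfun_cls[OF B tm_regular H lin_aff[OF lin_snd_snd]])
  qed
  have c: "continuous_partial (mtop ?S) (mtop V) (smul V)"
    unfolding sm using continuous_partial_pfun[OF q] topological_moduleD(3)[OF S] by metis
  have "cls n K ?S V (smul V)" for n
  proof (induction n)
    case (Suc n)
    then show ?case using step[OF Suc] dq c unfolding cls_Suc[OF S H] h by blast
  qed (use c in \<open>simp only: cls_0[OF S]\<close>)
  then show ?thesis by (simp add: sm_def)
qed

end

section \<open>Functoriality of \<open>f_t\<close>\<close>

context good_ring begin

lemma tset_carrier: "U \<subseteq> carrier E \<Longrightarrow> tset E s U \<subseteq> carrier E \<times> carrier E"
  by (auto simp: tset_def)

lemma tset_iff_bracket: "s \<in> carrier K \<Longrightarrow> (x, v) \<in> tset E s U \<longleftrightarrow> (x, v, s) \<in> bracket1 K E U"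
  by (auto simp: tset_def bracket1_def)

lemma dom_tmap [simp]: "dom (tmap K E F s f) = tset E s (dom f)"
  by (auto simp: tmap_def split: if_splits)

lemma tmap_apply: "(x, v) \<in> tset E s (dom f) \<Longrightarrow> tmap K E F s f (x, v) = Some (the (f x), the (DQ E F f (x, v, s)))"
  by (simp add: tmap_def DQ_def)

lemma aff_const: 
  assumes F: "topological_module K F" and E: "topological_module K E" and c: "c \<in> carrier F"
  shows "aff K E F (\<lambda>_. c) (\<lambda>_. \<zero>\<^bsub>F\<^esub>)"
proof -
  interpret F: Module.module K F by (rule topological_moduleD(2)[OF F])
  show ?thesis using c topological_moduleD(3)[OF F] by (auto simp: aff_def lin_def)
qed

text \<open>As \<open>f_t\<close> is obtained from \<open>f\<close> and from \<open>f^[1]\<close> with its scalar frozen at \<open>t\<close>, it is smooth.\<close>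

lemma tmap_eq:
  fixes E :: "('k, 'e) top_module"
  assumes s: "s \<in> carrier K" and E: "topological_module K E" and F: "topological_module K F" and f: "sm E F f"
  shows "tmap K E F s f = ppair (f \<circ>\<^sub>m pfun (carrier E \<times> carrier E) fst)
    (DQ E F f \<circ>\<^sub>m pfun (carrier E \<times> carrier E) (\<lambda>p. (fst p, snd p, s)))" (is "_ = ?r")
proof
  fix p :: "'e \<times> 'e" obtain x v where p: "p = (x, v)" by (cases p)
  have d: "dom (DQ E F f) = bracket1 K E (dom f)"
    using is_diff_quot_dom[OF sm_DQ(1)[OF E F f]] .
  show "tmap K E F s f p = ?r p"
  proof (cases "p \<in> tset E s (dom f)")
    case True
    then have "(x, v, s) \<in> dom (DQ E F f)" "x \<in> dom f" "p \<in> carrier E \<times> carrier E"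
      using sm_dom[OF f] p s d by (auto simp: tset_def bracket1_def)
    then show ?thesis using True p by (auto simp: tmap_apply ppair_def map_comp_pfun)
  next
    case False
    then have "(x, v, s) \<notin> dom (DQ E F f)" unfolding d p tset_iff_bracket[OF s] .
    then have "p \<notin> dom ?r" unfolding dom_ppair dom_map_comp_pfun p by simp
    moreover have "p \<notin> dom (tmap K E F s f)" using False by simp
    ultimately show ?thesis by (simp only: domIff not_not)
  qed
qed

lemma tmap_sm:
  assumes s: "s \<in> carrier K" and E: "topological_module K E" and F: "topological_module K F" and f: "sm E F f"
  shows "sm (prod_module E E) (prod_module F F) (tmap K E F s f)"
proof -
  note EE = tm_prod[OF E E]
  have "aff K (prod_module E E) (bracket_module K E) (\<lambda>p. (fst p, snd p, s)) (\<lambda>p. (fst p, snd p, \<zero>\<^bsub>K\<^esub>))"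
    using aff_pair[OF lin_aff[OF lin_fst] aff_pair[OF lin_aff[OF lin_snd] aff_const[OF tm_regular EE, of s]]] s by simp
  from sm_precomp[OF tm_bracket[OF E] EE this sm_DQ(2)[OF E F f]]
    sm_precomp[OF E EE lin_aff[OF lin_fst] f]
  show ?thesis unfolding tmap_eq[OF assms] using sm_ppair[OF F F] by simp
qed

text \<open>Preservation of the vertices \<open>x\<close> and \<open>x + t v\<close> of a point, which makes domains match under composition.\<close>

lemma tmap_vertices:
  assumes s: "s \<in> carrier K" and E: "topological_module K E" and F: "topological_module K F" and f: "sm E F f"
    and y: "tmap K E F s f (x, v) = Some (y, w)"
  shows "f x = Some y" and "w \<in> carrier F" and "f (x \<oplus>\<^bsub>E\<^esub> s \<odot>\<^bsub>E\<^esub> v) = Some (y \<oplus>\<^bsub>F\<^esub> s \<odot>\<^bsub>F\<^esub> w)"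
proof -
  have t: "(x, v) \<in> tset E s (dom f)" using domI[of "tmap K E F s f", OF y] by simp
  then have b: "(x, v, s) \<in> bracket1 K E (dom f)" unfolding tset_iff_bracket[OF s] .
  have yw: "y = the (f x)" "w = the (DQ E F f (x, v, s))" using y unfolding tmap_apply[where F = F, OF t] by simp_all
  have "(x, v, s) \<in> dom (DQ E F f)" using b is_diff_quot_dom[OF sm_DQ(1)[OF E F f]] by simp
  then show "w \<in> carrier F" using yw sm_ran[OF tm_bracket[OF E] F sm_DQ(2)[OF E F f]]
    by (metis domD option.sel ranI subsetD)
  have "x \<in> dom f" "x \<oplus>\<^bsub>E\<^esub> s \<odot>\<^bsub>E\<^esub> v \<in> dom f" using t by (auto simp: tset_def)
  then have fx: "f x = Some (the (f x))" "f (x \<oplus>\<^bsub>E\<^esub> s \<odot>\<^bsub>E\<^esub> v) = Some (the (f (x \<oplus>\<^bsub>E\<^esub> s \<odot>\<^bsub>E\<^esub> v)))"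
    by (simp_all add: domIff)
  show "f x = Some y" using fx(1) yw(1) by metis
  show "f (x \<oplus>\<^bsub>E\<^esub> s \<odot>\<^bsub>E\<^esub> v) = Some (y \<oplus>\<^bsub>F\<^esub> s \<odot>\<^bsub>F\<^esub> w)"
    using diff_quot_formula[OF E F sm_continuous[OF E f] sm_DQ(1)[OF E F f] b] fx(2) yw by metis
qed

text \<open>Functoriality, as an equality of partial maps. The domains agree because \<open>f_t\<close> preserves vertices.\<close>

lemma tmap_comp:
  fixes E :: "('k, 'e) top_module"
  assumes s: "s \<in> carrier K" and E: "topological_module K E" and F: "topological_module K F"
    and G: "topological_module K G" and f: "sm E F f" and g: "sm F G g"
  shows "tmap K E G s (g \<circ>\<^sub>m f) = tmap K F G s g \<circ>\<^sub>m tmap K E F s f"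
proof
  fix p :: "'e \<times> 'e" obtain x v where p: "p = (x, v)" by (cases p)
  have gf: "sm E G (g \<circ>\<^sub>m f)" by (rule sm_comp[OF E F G f g])
  have D: "DQ E G (g \<circ>\<^sub>m f) = DQ F G g \<circ>\<^sub>m bracket_map E f (DQ E F f)"
    by (rule DQ_eq[OF E G sm_dom[OF gf] diff_quot_comp[OF E F G sm_continuous[OF E f] sm_DQ(1)[OF E F f]
          sm_continuous[OF F g] sm_DQ(1)[OF F G g]]])
  show "tmap K E G s (g \<circ>\<^sub>m f) p = (tmap K F G s g \<circ>\<^sub>m tmap K E F s f) p"
  proof (cases "p \<in> tset E s (dom f)")
    case True
    then obtain y w where yw: "tmap K E F s f (x, v) = Some (y, w)"
      using p dom_tmap[of E F s f] by (metis domD prod.exhaust)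
    note ve = tmap_vertices[OF s E F f yw]
    have t: "(x, v) \<in> tset E s (dom f)" using True p by simp
    have c: "(x, v, s) \<in> carrier (bracket_module K E)"
      using t s tset_carrier[OF sm_dom[OF f]] by auto
    have "(x, v, s) \<in> dom (DQ E F f)"
      using t s is_diff_quot_dom[OF sm_DQ(1)[OF E F f]] by (simp add: tset_iff_bracket)
    moreover have "w = the (DQ E F f (x, v, s))" using yw unfolding tmap_apply[where F = F, OF t] by simp
    ultimately have "bracket_map E f (DQ E F f) (x, v, s) = Some (y, w, s)"
      using ve c by (auto simp: bracket_map_def ppair_eq_Some map_comp_pfun)
    then have D': "DQ E G (g \<circ>\<^sub>m f) (x, v, s) = DQ F G g (y, w, s)" by (simp add: D)
    have "(x, v) \<in> tset E s (dom (g \<circ>\<^sub>m f)) \<longleftrightarrow> (y, w) \<in> tset F s (dom g)"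
      using t ve by (auto simp: tset_def map_comp_def dom_def)
    moreover have "the ((g \<circ>\<^sub>m f) x) = the (g y)" using ve by simp
    ultimately show ?thesis using D' p yw by (simp add: tmap_def DQ_def)
  next
    case False
    then have "tmap K E F s f p = None" "p \<notin> tset E s (dom (g \<circ>\<^sub>m f))"
      using dom_tmap[of E F s f] by (metis domIff) (use False in \<open>auto simp: tset_def map_comp_def split: option.splits\<close>)
    moreover have "tmap K E G s (g \<circ>\<^sub>m f) p = None"
      using calculation(2) dom_tmap[of E G s "g \<circ>\<^sub>m f"] by (metis domIff)
    ultimately show ?thesis by simp
  qed
qed

lemma continuous_partial_restrict:
  assumes f: "continuous_partial S T f" and U: "openin S U"
  shows "continuous_partial S T (f |` U)"
proof -
  have "{x \<in> dom (f |` U). the ((f |` U) x) \<in> W} = U \<inter> {x \<in> dom f. the (f x) \<in> W}" for W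
    by (auto simp: restrict_map_def split: if_splits)
  then show ?thesis using f U unfolding continuous_partial_iff
    by (auto simp: ran_def restrict_map_def split: if_splits)
qed

text \<open>The restriction of \<open>g^[1]\<close> is a difference quotient of the restriction of \<open>g\<close>, hence the only one.\<close>

lemma tmap_mono:
  assumes E: "topological_module K E" and F: "topological_module K F"
    and f: "sm E F f" and g: "sm E F g" and le: "f \<subseteq>\<^sub>m g"
  shows "tmap K E F s f \<subseteq>\<^sub>m tmap K E F s g"
proof -
  let ?h = "DQ E F g |` bracket1 K E (dom f)"
  have fg: "dom f \<subseteq> dom g" "\<And>x. x \<in> dom f \<Longrightarrow> f x = g x" using le by (auto simp: map_le_def map_le_implies_dom_le)
  have dg: "dom (DQ E F g) = bracket1 K E (dom g)" by (rule is_diff_quot_dom[OF sm_DQ(1)[OF E F g]])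
  have sub: "bracket1 K E (dom f) \<subseteq> bracket1 K E (dom g)" using fg by (auto simp: bracket1_def)
  have "openin (mtop (bracket_module K E)) (bracket1 K E (dom f))"
    using sm_DQ(1)[OF E F f] unfolding is_diff_quot_def continuous_partial_def by metis
  then have "continuous_partial (mtop (bracket_module K E)) (mtop F) ?h"
    using continuous_partial_restrict sm_DQ(1)[OF E F g] unfolding is_diff_quot_def by blast
  moreover have "?h (x, v, s) = Some (inv\<^bsub>K\<^esub> s \<odot>\<^bsub>F\<^esub> (the (f (x \<oplus>\<^bsub>E\<^esub> s \<odot>\<^bsub>E\<^esub> v)) \<ominus>\<^bsub>F\<^esub> the (f x)))"
    if "(x, v, s) \<in> bracket1 K E (dom f)" "s \<in> Units K" for x v s
  proof -
    have "DQ E F g (x, v, s) = Some (inv\<^bsub>K\<^esub> s \<odot>\<^bsub>F\<^esub> (the (g (x \<oplus>\<^bsub>E\<^esub> s \<odot>\<^bsub>E\<^esub> v)) \<ominus>\<^bsub>F\<^esub> the (g x)))"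
      using that sub sm_DQ(1)[OF E F g] unfolding is_diff_quot_def by blast
    moreover have "g x = f x" "g (x \<oplus>\<^bsub>E\<^esub> s \<odot>\<^bsub>E\<^esub> v) = f (x \<oplus>\<^bsub>E\<^esub> s \<odot>\<^bsub>E\<^esub> v)"
      using that(1) fg(2) by (auto simp: bracket1_def)
    ultimately show ?thesis using that(1) by simp
  qed
  ultimately have "is_diff_quot K E F f ?h"
    using sub dg unfolding is_diff_quot_def by auto
  then have D: "DQ E F f = ?h" by (rule DQ_eq[OF E F sm_dom[OF f]])
  show ?thesis
    unfolding map_le_def
  proof
    fix p assume p: "p \<in> dom (tmap K E F s f)"
    obtain x v where xv: "p = (x, v)" by (cases p)
    have t: "(x, v) \<in> tset E s (dom f)" "(x, v) \<in> tset E s (dom g)" using p xv fg by (auto simp: tset_def)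
    show "tmap K E F s f p = tmap K E F s g p"
    proof (cases "s \<in> carrier K")
      case True
      then have "DQ E F f (x, v, s) = DQ E F g (x, v, s)" using t D by (simp add: tset_iff_bracket)
      then show ?thesis using t xv fg by (auto simp: tmap_apply tset_def)
    next
      case False
      then have "(x, v, s) \<notin> dom (DQ E F f)" "(x, v, s) \<notin> dom (DQ E F g)"
        using dg is_diff_quot_dom[OF sm_DQ(1)[OF E F f]] by (auto simp: bracket1_def)
      then have "DQ E F f (x, v, s) = DQ E F g (x, v, s)" by (simp add: domIff)
      then show ?thesis using t xv fg by (auto simp: tmap_apply tset_def)
    qed
  qed
qed

lemma tmap_lin:
  fixes E :: "('k, 'e) top_module"
  assumes s: "s \<in> carrier K" and E: "topological_module K E" and F: "topological_module K F" and L: "lin K E F L"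
  shows "tmap K E F s (pfun (carrier E) L) = pfun (carrier E \<times> carrier E) (\<lambda>p. (L (fst p), L (snd p)))"
proof -
  interpret E: Module.module K E by (rule topological_moduleD(2)[OF E])
  interpret F: Module.module K F by (rule topological_moduleD(2)[OF F])
  note cl = lin_closed[OF E F L]
  let ?B = "bracket_module K E"
  let ?h = "pfun (carrier ?B) (\<lambda>q. L (fst (snd q)))"
  have "is_diff_quot K E F (pfun (carrier E) L) ?h"
    unfolding is_diff_quot_def
  proof (intro conjI allI impI)
    show "continuous_partial (mtop ?B) (mtop F) ?h"
      using continuous_partial_pfun[of "mtop ?B" "mtop F" "\<lambda>q. L (fst (snd q))"]
        lin_comp[OF tm_bracket[OF E] E lin_fst_snd L] topological_moduleD(3)[OF tm_bracket[OF E]]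
      unfolding lin_def o_def by metis
    fix x v s assume A: "(x, v, s) \<in> bracket1 K E (dom (pfun (carrier E) L)) \<and> s \<in> Units K"
    then have c: "x \<in> carrier E" "v \<in> carrier E" "s \<in> carrier K" "s \<in> Units K" by (auto simp: bracket1_def)
    have "L x \<oplus>\<^bsub>F\<^esub> s \<odot>\<^bsub>F\<^esub> L v \<ominus>\<^bsub>F\<^esub> L x = s \<odot>\<^bsub>F\<^esub> L v"
      using c cl by (simp add: F.M.minus_eq F.M.a_ac F.M.r_neg1 F.M.r_neg2)
    then have "inv\<^bsub>K\<^esub> s \<odot>\<^bsub>F\<^esub> (L x \<oplus>\<^bsub>F\<^esub> s \<odot>\<^bsub>F\<^esub> L v \<ominus>\<^bsub>F\<^esub> L x) = L v"
      using c cl by (simp add: F.smult_assoc1[symmetric] K.Units_inv_closed K.Units_l_inv)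
    then show "?h (x, v, s) = Some (inv\<^bsub>K\<^esub> s \<odot>\<^bsub>F\<^esub>
        (the (pfun (carrier E) L (x \<oplus>\<^bsub>E\<^esub> s \<odot>\<^bsub>E\<^esub> v)) \<ominus>\<^bsub>F\<^esub> the (pfun (carrier E) L x)))"
      using c L by (simp add: lin_def)
  qed (auto simp: bracket1_def)
  then have D: "DQ E F (pfun (carrier E) L) = ?h" by (intro DQ_eq[OF E F]) auto
  show ?thesis
  proof
    fix p :: "'e \<times> 'e" obtain x v where p: "p = (x, v)" by (cases p)
    show "tmap K E F s (pfun (carrier E) L) p = pfun (carrier E \<times> carrier E) (\<lambda>p. (L (fst p), L (snd p))) p"
      unfolding p tmap_def case_prod_conv DQ_def[symmetric] D using s by (auto simp: tset_def)
  qed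
qed

end

section \<open>The spaces \<open>V^A\<close>\<close>

lemma cube_space_simps [simp]:
  "carrier (cube_space V A) = (\<Pi>\<^sub>E B\<in>Pow A. carrier V)"
  "\<zero>\<^bsub>cube_space V A\<^esub> = (\<lambda>B\<in>Pow A. \<zero>\<^bsub>V\<^esub>)"
  "x \<oplus>\<^bsub>cube_space V A\<^esub> y = (\<lambda>B\<in>Pow A. x B \<oplus>\<^bsub>V\<^esub> y B)"
  "r \<odot>\<^bsub>cube_space V A\<^esub> x = (\<lambda>B\<in>Pow A. r \<odot>\<^bsub>V\<^esub> x B)"
  "mtop (cube_space V A) = product_topology (\<lambda>_. mtop V) (Pow A)"
  by (simp_all add: cube_space_def)

lemma continuous_coordinate: "B \<subseteq> A \<Longrightarrow> continuous_map (product_topology (\<lambda>_. T) (Pow A)) T (\<lambda>x. x B)"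
  using continuous_map_product_projection[of B "Pow A" "\<lambda>_. T"] by simp

lemma continuous_restrict:
  "continuous_map S (product_topology (\<lambda>_. T) (Pow A)) (\<lambda>x. \<lambda>B\<in>Pow A. f x B) \<longleftrightarrow>
    (\<forall>B\<in>Pow A. continuous_map S T (\<lambda>x. f x B))"
proof -
  have "continuous_map S T (\<lambda>x. (\<lambda>B\<in>Pow A. f x B) B) \<longleftrightarrow> continuous_map S T (\<lambda>x. f x B)" if "B \<in> Pow A" for B
    using that by simp
  moreover have "(\<lambda>x. \<lambda>B\<in>Pow A. f x B) \<in> topspace S \<rightarrow> extensional (Pow A)" by auto
  ultimately show ?thesis unfolding continuous_map_componentwise by blast
qed

lemma cube_eqI: "x \<in> carrier (cube_space V A) \<Longrightarrow> y \<in> carrier (cube_space V A) \<Longrightarrow> (\<And>B. B \<subseteq> A \<Longrightarrow> x B = y B) \<Longrightarrow> x = y"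
  using PiE_ext[of x "Pow A" "\<lambda>_. carrier V" y] by simp

lemma abelian_group_cube:
  assumes "abelian_group V" shows "abelian_group (cube_space V A)"
proof -
  interpret V: abelian_group V by fact
  show ?thesis
  proof (rule abelian_groupI)
    fix x assume x: "x \<in> carrier (cube_space V A)"
    then show "\<exists>y\<in>carrier (cube_space V A). y \<oplus>\<^bsub>cube_space V A\<^esub> x = \<zero>\<^bsub>cube_space V A\<^esub>"
      by (intro bexI[of _ "\<lambda>B\<in>Pow A. \<ominus>\<^bsub>V\<^esub> x B"]) (auto simp: V.l_neg PiE_iff fun_eq_iff)
  qed (auto simp: PiE_iff fun_eq_iff V.a_ac restrict_def extensional_def)
qed

lemma topological_module_cube [intro]:
  assumes V: "topological_module R V"
  shows "topological_module R (cube_space V A)"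
proof -
  interpret V: Module.module R V by (rule topological_moduleD(2)[OF V])
  note tV = topological_moduleD(3)[OF V]
  have "Module.module R (cube_space V A)"
    by (rule moduleI[OF topological_moduleD(5)[OF V] abelian_group_cube[OF topological_moduleD(6)[OF V]]])
      (auto simp: PiE_iff fun_eq_iff V.smult_l_distr V.smult_r_distr V.smult_assoc1 restrict_def extensional_def)
  moreover have "continuous_map (prod_topology (mtop (cube_space V A)) (mtop (cube_space V A))) (mtop (cube_space V A))
      (\<lambda>p. fst p \<oplus>\<^bsub>cube_space V A\<^esub> snd p)"
    unfolding cube_space_simps continuous_restrict
    by (intro ballI continuous_add[OF V] continuous_map_compose[OF continuous_map_fst continuous_coordinate, unfolded o_def]
      continuous_map_compose[OF continuous_map_snd continuous_coordinate, unfolded o_def]) auto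
  moreover have "continuous_map (prod_topology (rtop R) (mtop (cube_space V A))) (mtop (cube_space V A))
      (\<lambda>p. fst p \<odot>\<^bsub>cube_space V A\<^esub> snd p)"
    unfolding cube_space_simps continuous_restrict
    by (intro ballI continuous_smult[OF V] continuous_map_fst
      continuous_map_compose[OF continuous_map_snd continuous_coordinate, unfolded o_def]) auto
  ultimately show ?thesis
    using V tV unfolding topological_module_def case_prod_unfold
    by (simp add: Hausdorff_space_product_topology)
qed

text \<open>The inverse of \<open>join A k\<close>.\<close>

definition unjoin :: "nat set \<Rightarrow> nat \<Rightarrow> (nat set \<Rightarrow> 'e) \<Rightarrow> (nat set \<Rightarrow> 'e) \<times> (nat set \<Rightarrow> 'e)" where
  "unjoin A k z = (\<lambda>B\<in>Pow A. z B, \<lambda>B\<in>Pow A. z (insert k B))"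

lemma join_closed: "p \<in> carrier (prod_module (cube_space V A) (cube_space V A)) \<Longrightarrow> join A k p \<in> carrier (cube_space V (insert k A))"
  by (auto simp: join_def PiE_iff split: prod.splits)

lemma unjoin_closed: "z \<in> carrier (cube_space V (insert k A)) \<Longrightarrow> unjoin A k z \<in> carrier (prod_module (cube_space V A) (cube_space V A))"
  by (auto simp: unjoin_def PiE_iff)

lemma unjoin_join: "k \<notin> A \<Longrightarrow> p \<in> carrier (prod_module (cube_space V A) (cube_space V A)) \<Longrightarrow> unjoin A k (join A k p) = p"
proof -
  assume k: "k \<notin> A" and p: "p \<in> carrier (prod_module (cube_space V A) (cube_space V A))"
  have [simp]: "B - {k} = B" "k \<notin> B" if "B \<subseteq> A" for B using k that by auto
  show ?thesis using p
    by (cases p) (auto simp: unjoin_def join_def PiE_iff fun_eq_iff restrict_def extensional_def)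
qed

lemma join_unjoin: "k \<notin> A \<Longrightarrow> z \<in> carrier (cube_space V (insert k A)) \<Longrightarrow> join A k (unjoin A k z) = z"
  by (auto simp: unjoin_def join_def PiE_iff fun_eq_iff restrict_def extensional_def insert_absorb subset_insert)

lemma join_lin:
  assumes V: "topological_module R V" and k: "k \<notin> A"
  shows "lin R (prod_module (cube_space V A) (cube_space V A)) (cube_space V (insert k A)) (join A k)"
  unfolding lin_def
proof (intro conjI ballI)
  have "continuous_map (prod_topology (product_topology (\<lambda>_. mtop V) (Pow A)) (product_topology (\<lambda>_. mtop V) (Pow A))) (mtop V)
     (\<lambda>p. if k \<in> B then snd p (B - {k}) else fst p B)" if "B \<in> Pow (insert k A)" for B
    using that by (cases "k \<in> B")
      (auto intro!: continuous_map_compose[OF continuous_map_fst continuous_coordinate, unfolded o_def]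
      continuous_map_compose[OF continuous_map_snd continuous_coordinate, unfolded o_def])
  then show "continuous_map (mtop (prod_module (cube_space V A) (cube_space V A))) (mtop (cube_space V (insert k A))) (join A k)"
    by (simp add: join_def case_prod_unfold continuous_restrict del: Pow_iff)
qed (use k in \<open>auto simp: join_def fun_eq_iff restrict_def split: if_splits\<close>)

lemma unjoin_lin:
  "lin R (cube_space V (insert k A)) (prod_module (cube_space V A) (cube_space V A)) (unjoin A k)"
  unfolding lin_def
proof (intro conjI ballI)
  show "continuous_map (mtop (cube_space V (insert k A))) (mtop (prod_module (cube_space V A) (cube_space V A))) (unjoin A k)"
    unfolding unjoin_def cube_space_simps prod_module_simps continuous_map_paired continuous_restrict
    by (auto intro!: continuous_coordinate)
qed (auto simp: unjoin_def fun_eq_iff restrict_def)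

text \<open>The identification of \<open>V\<close> with its power over the empty set.\<close>

definition cube0 :: "'e \<Rightarrow> nat set \<Rightarrow> 'e" where "cube0 x = (\<lambda>B\<in>Pow {}. x)"

lemma cube0_lin: "lin R V (cube_space V {}) cube0" and uncube0_lin: "lin R (cube_space V {}) V (\<lambda>z. z {})"
proof -
  have "continuous_map (mtop V) (mtop (cube_space V {})) cube0"
    unfolding cube0_def cube_space_simps continuous_restrict by simp
  then show "lin R V (cube_space V {}) cube0" by (simp add: lin_def cube0_def fun_eq_iff)
  have "continuous_map (mtop (cube_space V {})) (mtop V) (\<lambda>z. z {})"
    unfolding cube_space_simps by (rule continuous_coordinate) simp
  then show "lin R (cube_space V {}) V (\<lambda>z. z {})" by (simp add: lin_def)
qed

lemma uncube0_cube0 [simp]: "cube0 x {} = x" by (simp add: cube0_def)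

lemma cube0_uncube0: "z \<in> carrier (cube_space V {}) \<Longrightarrow> cube0 (z {}) = z"
  by (auto simp: cube0_def PiE_iff fun_eq_iff restrict_def extensional_def)

section \<open>Conjugation of partial maps by isomorphisms\<close>

text \<open>The form of a partial map after its source and its target have been renamed: \<open>i\<close> undoes the renaming of the
  source, \<open>j\<close> is the renaming of the target.\<close>

definition conj_map :: "'a set \<Rightarrow> ('a \<Rightarrow> 'b) \<Rightarrow> ('c \<Rightarrow> 'd) \<Rightarrow> ('b \<rightharpoonup> 'c) \<Rightarrow> ('a \<rightharpoonup> 'd)" where
  "conj_map S i j g = map_option j \<circ> (g \<circ>\<^sub>m pfun S i)"

lemma conj_map_apply: "conj_map S i j g x = (if x \<in> S then map_option j (g (i x)) else None)"
  by (simp add: conj_map_def map_comp_pfun)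

lemma dom_conj_map [simp]: "dom (conj_map S i j g) = {x \<in> S. i x \<in> dom g}"
  by (auto simp: conj_map_apply dom_def split: if_splits)

lemma conj_map_comp:
  assumes "ran f \<subseteq> S'" "\<And>y. y \<in> S' \<Longrightarrow> j y \<in> T" "\<And>y. y \<in> S' \<Longrightarrow> i' (j y) = y"
  shows "conj_map T i' j' g \<circ>\<^sub>m conj_map S i j f = conj_map S i j' (g \<circ>\<^sub>m f)"
proof
  fix x
  show "(conj_map T i' j' g \<circ>\<^sub>m conj_map S i j f) x = conj_map S i j' (g \<circ>\<^sub>m f) x"
  proof (cases "x \<in> S \<and> f (i x) \<noteq> None")
    case True
    then obtain y where "f (i x) = Some y" by auto
    moreover then have "y \<in> S'" using assms(1) by (auto intro: ranI subsetD)
    ultimately show ?thesis using True assms by (simp add: map_comp_def conj_map_apply)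
  qed (auto simp: map_comp_def conj_map_apply split: if_splits)
qed

lemma conj_map_mono: "f \<subseteq>\<^sub>m g \<Longrightarrow> conj_map S i j f \<subseteq>\<^sub>m conj_map S i j g"
  unfolding map_le_def dom_conj_map by (auto simp: conj_map_apply)

lemma conj_map_pfun: "i ` S \<subseteq> T \<Longrightarrow> conj_map S i j (pfun T L) = pfun S (\<lambda>x. j (L (i x)))"
  by (auto simp: conj_map_apply pfun_def fun_eq_iff)

section \<open>The map \<open>f_t\<close> of a quadratic map\<close>

context good_ring begin

lemma sm_conj_map:
  assumes "topological_module K E" "topological_module K E'" "topological_module K F" "topological_module K F'"
    "lin K E E' i" "lin K F' F j" "sm E' F' g"
  shows "sm E F (conj_map (carrier E) i j g)"
  unfolding conj_map_def
  by (rule sm_post[OF assms(4,3,6) sm_precomp[OF assms(2,1) lin_aff[OF assms(5)] assms(7)]])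

text \<open>In particular, for a bilinear action the second component is
  \<open>r x\<^sub>1 + r\<^sub>1 x + t r\<^sub>1 x\<^sub>1\<close>, the product of \<open>r + r\<^sub>1 e\<close> and \<open>x + x\<^sub>1 e\<close> when \<open>e e = t e\<close>.\<close>

lemma tmap_quadratic:
  fixes S :: "('k, 'e) top_module"
  assumes S: "topological_module K S" and G: "topological_module K G" and c: "c \<in> carrier K"
    and q: "continuous_map (mtop S) (mtop G) q"
    and b: "continuous_map (prod_topology (mtop S) (mtop S)) (mtop G) (\<lambda>p. \<beta> (fst p) (snd p))"
    and eq: "\<And>p p' s. p \<in> carrier S \<Longrightarrow> p' \<in> carrier S \<Longrightarrow> s \<in> carrier K \<Longrightarrow>
       q (p \<oplus>\<^bsub>S\<^esub> s \<odot>\<^bsub>S\<^esub> p') = q p \<oplus>\<^bsub>G\<^esub> s \<odot>\<^bsub>G\<^esub> (\<beta> p p' \<oplus>\<^bsub>G\<^esub> s \<odot>\<^bsub>G\<^esub> q p')"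
  shows "tmap K S G c (pfun (carrier S) q) = pfun (carrier S \<times> carrier S)
    (\<lambda>p. (q (fst p), \<beta> (fst p) (snd p) \<oplus>\<^bsub>G\<^esub> c \<odot>\<^bsub>G\<^esub> q (snd p)))"
proof -
  interpret S: Module.module K S by (rule topological_moduleD(2)[OF S])
  let ?h = "pfun (carrier (bracket_module K S)) (\<lambda>p. \<beta> (fst p) (fst (snd p)) \<oplus>\<^bsub>G\<^esub> snd (snd p) \<odot>\<^bsub>G\<^esub> q (fst (snd p)))"
  have D: "DQ S G (pfun (carrier S) q) = ?h"
    by (rule DQ_eq[OF S G _ diff_quot_quadratic[OF S G q b eq]]) auto
  show ?thesis
  proof
    fix p :: "'e \<times> 'e" obtain x v where p: "p = (x, v)" by (cases p)
    show "tmap K S G c (pfun (carrier S) q) p = pfun (carrier S \<times> carrier S)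
       (\<lambda>p. (q (fst p), \<beta> (fst p) (snd p) \<oplus>\<^bsub>G\<^esub> c \<odot>\<^bsub>G\<^esub> q (snd p))) p"
      unfolding p tmap_def case_prod_conv DQ_def[symmetric] D using c by (auto simp: tset_def)
  qed
qed

end

section \<open>The action of \<open>K^A\<close> on \<open>V^A\<close>\<close>

abbreviation upper :: "nat set \<Rightarrow> nat \<Rightarrow> (nat set \<Rightarrow> 'e) \<Rightarrow> (nat set \<Rightarrow> 'e)" where
  "upper A k z \<equiv> (\<lambda>B\<in>Pow A. z (insert k B))"

abbreviation lower :: "nat set \<Rightarrow> (nat set \<Rightarrow> 'e) \<Rightarrow> (nat set \<Rightarrow> 'e)" where
  "lower A z \<equiv> (\<lambda>B\<in>Pow A. z B)"

text \<open>The index set of the sum for the coefficient of \<open>e_D\<close> in a product. The sum does not see the ambient set \<open>A\<close>,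
  which makes the passage from \<open>A\<close> to a larger set possible.\<close>

definition covers :: "nat set \<Rightarrow> (nat set \<times> nat set) set" where
  "covers D = {(B, C). B \<union> C = D}"

lemma covers_eq: "D \<subseteq> A \<Longrightarrow> {(B, C). B \<subseteq> A \<and> C \<subseteq> A \<and> B \<union> C = D} = covers D"
  by (auto simp: covers_def)

lemma finite_covers [simp]: "finite D \<Longrightarrow> finite (covers D)"
  by (rule finite_subset[of _ "Pow D \<times> Pow D"]) (auto simp: covers_def)

lemma coversD: "p \<in> covers D \<Longrightarrow> fst p \<subseteq> D \<and> snd p \<subseteq> D"
  by (auto simp: covers_def)

locale good_cube = good_ring K for K :: "'k top_ring" +
  fixes t :: "nat \<Rightarrow> 'k"
begin

definition cterm :: "('k, 'e) top_module \<Rightarrow> (nat set \<Rightarrow> 'k) \<Rightarrow> (nat set \<Rightarrow> 'e) \<Rightarrow> nat set \<times> nat set \<Rightarrow> 'e" where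
  "cterm V r x p = (finprod K t (fst p \<inter> snd p) \<otimes>\<^bsub>K\<^esub> r (fst p)) \<odot>\<^bsub>V\<^esub> x (snd p)"

definition cmul :: "('k, 'e) top_module \<Rightarrow> nat set \<Rightarrow> (nat set \<Rightarrow> 'k) \<Rightarrow> (nat set \<Rightarrow> 'e) \<Rightarrow> (nat set \<Rightarrow> 'e)" where
  "cmul V A r x = (\<lambda>D\<in>Pow A. finsum V (cterm V r x) (covers D))"

lemma smult_cube_module: "r \<odot>\<^bsub>cube_module K t V A\<^esub> x = cmul V A r x"
proof -
  have "(\<lambda>(B, C). (finprod K t (B \<inter> C) \<otimes>\<^bsub>K\<^esub> r B) \<odot>\<^bsub>V\<^esub> x C) = cterm V r x"
    by (auto simp: cterm_def fun_eq_iff)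
  then show ?thesis
    unfolding cube_module_def cmul_def module.simps by (intro restrict_ext) (simp add: covers_eq)
qed

definition valid :: "nat set \<Rightarrow> bool" where
  "valid A \<longleftrightarrow> finite A \<and> t ` A \<subseteq> carrier K"

lemma valid_insertD: "valid (insert k A) \<Longrightarrow> valid A \<and> t k \<in> carrier K"
  by (auto simp: valid_def)

lemma finprod_t [simp]: "valid A \<Longrightarrow> B \<subseteq> A \<Longrightarrow> finprod K t B \<in> carrier K"
  by (rule K.finprod_closed) (auto simp: valid_def)

context
  fixes V :: "('k, 'e) top_module"
  assumes V: "topological_module K V"
begin

interpretation V: Module.module K V by (rule topological_moduleD(2)[OF V])

lemma cterm_closed:
  assumes "valid A" "r \<in> carrier (cube_space (regular_module K) A)" "x \<in> carrier (cube_space V A)" "D \<subseteq> A" "p \<in> covers D"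
  shows "cterm V r x p \<in> carrier V"
proof -
  have "fst p \<subseteq> A" "snd p \<subseteq> A" using coversD[OF assms(5)] assms(4) by auto
  then show ?thesis using assms unfolding cterm_def
    by (intro V.smult_closed K.m_closed finprod_t[OF assms(1)]) (auto simp: PiE_iff)
qed

lemma cterm_Pi: "valid A \<Longrightarrow> r \<in> carrier (cube_space (regular_module K) A) \<Longrightarrow> x \<in> carrier (cube_space V A) \<Longrightarrow>
   D \<subseteq> A \<Longrightarrow> cterm V r x \<in> covers D \<rightarrow> carrier V"
  using cterm_closed by blast

lemma valid_fin: "valid A \<Longrightarrow> D \<subseteq> A \<Longrightarrow> finite D"
  using finite_subset by (auto simp: valid_def)

lemma cmul_closed:
  assumes "valid A" "r \<in> carrier (cube_space (regular_module K) A)" "x \<in> carrier (cube_space V A)"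
  shows "cmul V A r x \<in> carrier (cube_space V A)"
  using V.M.finsum_closed[OF cterm_Pi[OF assms]] by (auto simp: cmul_def)

lemma cmul_add_left:
  assumes A: "valid A" and r: "r \<in> carrier (cube_space (regular_module K) A)"
    and r': "r' \<in> carrier (cube_space (regular_module K) A)" and x: "x \<in> carrier (cube_space V A)"
  shows "cmul V A (r \<oplus>\<^bsub>cube_space (regular_module K) A\<^esub> r') x = cmul V A r x \<oplus>\<^bsub>cube_space V A\<^esub> cmul V A r' x"
proof -
  have "finsum V (cterm V (r \<oplus>\<^bsub>cube_space (regular_module K) A\<^esub> r') x) (covers D)
     = finsum V (cterm V r x) (covers D) \<oplus>\<^bsub>V\<^esub> finsum V (cterm V r' x) (covers D)" if D: "D \<subseteq> A" for D
  proof -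
    have "finsum V (cterm V (r \<oplus>\<^bsub>cube_space (regular_module K) A\<^esub> r') x) (covers D)
      = finsum V (\<lambda>p. cterm V r x p \<oplus>\<^bsub>V\<^esub> cterm V r' x p) (covers D)"
    proof (rule V.M.finsum_cong'[OF refl])
      show "(\<lambda>p. cterm V r x p \<oplus>\<^bsub>V\<^esub> cterm V r' x p) \<in> covers D \<rightarrow> carrier V"
        using cterm_closed[OF A r x D] cterm_closed[OF A r' x D] by auto
      fix p assume "p \<in> covers D"
      then have p: "fst p \<subseteq> A" "snd p \<subseteq> A" using coversD D by blast+
      then have "r (fst p) \<in> carrier K" "r' (fst p) \<in> carrier K" "x (snd p) \<in> carrier V"
        "finprod K t (fst p \<inter> snd p) \<in> carrier K" using r r' x A by (auto simp: PiE_iff le_infI1)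
      then show "cterm V (r \<oplus>\<^bsub>cube_space (regular_module K) A\<^esub> r') x p = cterm V r x p \<oplus>\<^bsub>V\<^esub> cterm V r' x p"
        using p by (simp add: cterm_def K.r_distr V.smult_l_distr)
    qed
    also have "\<dots> = finsum V (cterm V r x) (covers D) \<oplus>\<^bsub>V\<^esub> finsum V (cterm V r' x) (covers D)"
      by (rule V.M.finsum_addf[OF cterm_Pi[OF A r x D] cterm_Pi[OF A r' x D]])
    finally show ?thesis .
  qed
  then show ?thesis by (auto simp: cmul_def fun_eq_iff restrict_def)
qed

lemma cmul_add_right:
  assumes A: "valid A" and r: "r \<in> carrier (cube_space (regular_module K) A)"
    and x: "x \<in> carrier (cube_space V A)" and x': "x' \<in> carrier (cube_space V A)"
  shows "cmul V A r (x \<oplus>\<^bsub>cube_space V A\<^esub> x') = cmul V A r x \<oplus>\<^bsub>cube_space V A\<^esub> cmul V A r x'"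
proof -
  have "finsum V (cterm V r (x \<oplus>\<^bsub>cube_space V A\<^esub> x')) (covers D)
     = finsum V (cterm V r x) (covers D) \<oplus>\<^bsub>V\<^esub> finsum V (cterm V r x') (covers D)" if D: "D \<subseteq> A" for D
  proof -
    have "finsum V (cterm V r (x \<oplus>\<^bsub>cube_space V A\<^esub> x')) (covers D)
      = finsum V (\<lambda>p. cterm V r x p \<oplus>\<^bsub>V\<^esub> cterm V r x' p) (covers D)"
    proof (rule V.M.finsum_cong'[OF refl])
      show "(\<lambda>p. cterm V r x p \<oplus>\<^bsub>V\<^esub> cterm V r x' p) \<in> covers D \<rightarrow> carrier V"
        using cterm_closed[OF A r x D] cterm_closed[OF A r x' D] by auto
      fix p assume "p \<in> covers D"
      then have p: "fst p \<subseteq> A" "snd p \<subseteq> A" using coversD D by blast+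
      then have "r (fst p) \<in> carrier K" "x (snd p) \<in> carrier V" "x' (snd p) \<in> carrier V"
        "finprod K t (fst p \<inter> snd p) \<in> carrier K" using r x' x A by (auto simp: PiE_iff le_infI1)
      then show "cterm V r (x \<oplus>\<^bsub>cube_space V A\<^esub> x') p = cterm V r x p \<oplus>\<^bsub>V\<^esub> cterm V r x' p"
        using p by (simp add: cterm_def V.smult_r_distr)
    qed
    also have "\<dots> = finsum V (cterm V r x) (covers D) \<oplus>\<^bsub>V\<^esub> finsum V (cterm V r x') (covers D)"
      by (rule V.M.finsum_addf[OF cterm_Pi[OF A r x D] cterm_Pi[OF A r x' D]])
    finally show ?thesis .
  qed
  then show ?thesis by (auto simp: cmul_def fun_eq_iff restrict_def)
qed

lemma cmul_scale:
  assumes A: "valid A" and r: "r \<in> carrier (cube_space (regular_module K) A)"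
    and x: "x \<in> carrier (cube_space V A)" and s: "s \<in> carrier K"
  shows "cmul V A (s \<odot>\<^bsub>cube_space (regular_module K) A\<^esub> r) x = s \<odot>\<^bsub>cube_space V A\<^esub> cmul V A r x"
    and "cmul V A r (s \<odot>\<^bsub>cube_space V A\<^esub> x) = s \<odot>\<^bsub>cube_space V A\<^esub> cmul V A r x"
proof -
  have c: "cterm V (s \<odot>\<^bsub>cube_space (regular_module K) A\<^esub> r) x p = s \<odot>\<^bsub>V\<^esub> cterm V r x p"
    "cterm V r (s \<odot>\<^bsub>cube_space V A\<^esub> x) p = s \<odot>\<^bsub>V\<^esub> cterm V r x p"
    if "p \<in> covers D" and D: "D \<subseteq> A" for p D
  proof -
    have p: "fst p \<subseteq> A" "snd p \<subseteq> A" using coversD that by blast+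
    then have c: "r (fst p) \<in> carrier K" "x (snd p) \<in> carrier V"
      "finprod K t (fst p \<inter> snd p) \<in> carrier K" using r x A by (auto simp: PiE_iff le_infI1)
    show "cterm V (s \<odot>\<^bsub>cube_space (regular_module K) A\<^esub> r) x p = s \<odot>\<^bsub>V\<^esub> cterm V r x p"
      using p c s by (simp add: cterm_def V.smult_assoc1[symmetric] K.m_lcomm)
    have "(finprod K t (fst p \<inter> snd p) \<otimes>\<^bsub>K\<^esub> r (fst p)) \<otimes>\<^bsub>K\<^esub> s = s \<otimes>\<^bsub>K\<^esub> (finprod K t (fst p \<inter> snd p) \<otimes>\<^bsub>K\<^esub> r (fst p))"
      using c s by (simp add: K.m_comm)
    then show "cterm V r (s \<odot>\<^bsub>cube_space V A\<^esub> x) p = s \<odot>\<^bsub>V\<^esub> cterm V r x p"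
      using p c s by (simp add: cterm_def V.smult_assoc1[symmetric])
  qed
  have f: "finsum V (cterm V (s \<odot>\<^bsub>cube_space (regular_module K) A\<^esub> r) x) (covers D) = s \<odot>\<^bsub>V\<^esub> finsum V (cterm V r x) (covers D)"
    "finsum V (cterm V r (s \<odot>\<^bsub>cube_space V A\<^esub> x)) (covers D) = s \<odot>\<^bsub>V\<^esub> finsum V (cterm V r x) (covers D)"
    if D: "D \<subseteq> A" for D
    unfolding V.finsum_smult_ldistr[OF finite_covers[OF valid_fin[OF A D]] s cterm_Pi[OF A r x D]]
    by (rule V.M.finsum_cong'[OF refl]; use c D s cterm_closed[OF A r x D] in auto)+
  have *: "s \<odot>\<^bsub>cube_space V A\<^esub> cmul V A r x = (\<lambda>D\<in>Pow A. s \<odot>\<^bsub>V\<^esub> finsum V (cterm V r x) (covers D))"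
    unfolding cube_space_simps cmul_def by (rule restrict_ext) simp
  show "cmul V A (s \<odot>\<^bsub>cube_space (regular_module K) A\<^esub> r) x = s \<odot>\<^bsub>cube_space V A\<^esub> cmul V A r x"
    "cmul V A r (s \<odot>\<^bsub>cube_space V A\<^esub> x) = s \<odot>\<^bsub>cube_space V A\<^esub> cmul V A r x"
    unfolding * unfolding cmul_def by (rule restrict_ext; use f in \<open>simp only: Pow_iff\<close>)+
qed

lemma covers_insert:
  assumes "k \<notin> D"
  shows "covers (insert k D) = (\<lambda>(B, C). (B, insert k C)) ` covers D \<union>
     ((\<lambda>(B, C). (insert k B, C)) ` covers D \<union> (\<lambda>(B, C). (insert k B, insert k C)) ` covers D)" (is "_ = ?R")
proof
  show "covers (insert k D) \<subseteq> ?R"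
  proof
    fix p assume "p \<in> covers (insert k D)"
    then obtain B C where p: "p = (B, C)" "B \<union> C = insert k D" by (auto simp: covers_def)
    have c: "(B - {k}, C - {k}) \<in> covers D" using p assms by (auto simp: covers_def)
    show "p \<in> ?R"
    proof (cases "k \<in> B")
      case kB: True
      show ?thesis
      proof (cases "k \<in> C")
        case True
        then show ?thesis using kB p by (intro UnI2 image_eqI[OF _ c]) auto
      next
        case False
        then show ?thesis using kB p by (intro UnI2 UnI1 image_eqI[OF _ c]) auto
      qed
    next
      case False
      then have "k \<in> C" using p by auto
      then show ?thesis using False p by (intro UnI1 image_eqI[OF _ c]) auto
    qed
  qed
qed (auto simp: covers_def)

text \<open>Splitting the covers of \<open>D\<close> enlarged by \<open>k\<close> according to whether \<open>k\<close> lies in the second set, the first set or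
  both gives \<open>(r\<^sub>0 + r\<^sub>1 e_k) (x\<^sub>0 + x\<^sub>1 e_k) = r\<^sub>0 x\<^sub>0 + (r\<^sub>0 x\<^sub>1 + r\<^sub>1 x\<^sub>0 + t_k r\<^sub>1 x\<^sub>1) e_k\<close>. So \<open>K^A\<close> is built up one
  generator at a time, in step with the manifolds.\<close>

lemma cmul_join:
  assumes A: "valid (insert k A)" and k: "k \<notin> A" and r: "r \<in> carrier (cube_space (regular_module K) (insert k A))"
    and x: "x \<in> carrier (cube_space V (insert k A))" and D: "D \<subseteq> A"
  shows "cmul V (insert k A) r x D = cmul V A (lower A r) (lower A x) D"
    and "cmul V (insert k A) r x (insert k D) = (cmul V A (lower A r) (upper A k x) D \<oplus>\<^bsub>V\<^esub>
       cmul V A (upper A k r) (lower A x) D) \<oplus>\<^bsub>V\<^esub> t k \<odot>\<^bsub>V\<^esub> cmul V A (upper A k r) (upper A k x) D"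
proof -
  have A': "valid A" and tk: "t k \<in> carrier K" using valid_insertD[OF A] by auto
  have r0: "lower A r \<in> carrier (cube_space (regular_module K) A)" and r1: "upper A k r \<in> carrier (cube_space (regular_module K) A)"
    and x0: "lower A x \<in> carrier (cube_space V A)" and x1: "upper A k x \<in> carrier (cube_space V A)"
    using r x by (auto simp: PiE_iff)
  have kD: "k \<notin> D" and fD: "finite (covers D)" using k D valid_fin[OF A' D] by auto
  have cD: "fst p \<subseteq> A" "snd p \<subseteq> A" "k \<notin> fst p" "k \<notin> snd p" if "p \<in> covers D" for p
    using coversD[OF that] D k by auto
  have "finsum V (cterm V r x) (covers D) = finsum V (cterm V (lower A r) (lower A x)) (covers D)"
    by (rule V.M.finsum_cong'[OF refl cterm_Pi[OF A' r0 x0 D]]) (auto simp: cterm_def cD)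
  then show "cmul V (insert k A) r x D = cmul V A (lower A r) (lower A x) D"
    using D by (auto simp: cmul_def)
  have fD1: "cmul V A s y D = finsum V (cterm V s y) (covers D)" for s y
    using D by (simp add: cmul_def)
  have fD2: "cmul V (insert k A) r x (insert k D) = finsum V (cterm V r x) (covers (insert k D))"
    using insert_mono[OF D, of k] by (simp add: cmul_def)
  let ?f1 = "\<lambda>(B, C). (B, insert k C)" and ?f2 = "\<lambda>(B, C). (insert k B, C)" and ?f3 = "\<lambda>(B, C). (insert k B, insert k C)"
  let ?S1 = "?f1 ` covers D" and ?S2 = "?f2 ` covers D" and ?S3 = "?f3 ` covers D"
  have cl: "cterm V r x \<in> covers (insert k D) \<rightarrow> carrier V" using cterm_Pi[OF A r x, of "insert k D"] D by auto
  then have cl': "cterm V r x \<in> ?S1 \<rightarrow> carrier V" "cterm V r x \<in> ?S2 \<union> ?S3 \<rightarrow> carrier V" 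
    "cterm V r x \<in> ?S2 \<rightarrow> carrier V" "cterm V r x \<in> ?S3 \<rightarrow> carrier V"
    unfolding covers_insert[OF kD] by (auto simp: Pi_iff)
  have inj: "inj_on ?f1 (covers D)" "inj_on ?f2 (covers D)" "inj_on ?f3 (covers D)"
    using cD by (auto simp: inj_on_def) (metis insert_ident fst_conv snd_conv)+
  have disj: "?S1 \<inter> (?S2 \<union> ?S3) = {}" "?S2 \<inter> ?S3 = {}" using cD by auto (metis insertI1 fst_conv snd_conv)+
  have "finsum V (cterm V r x) (covers (insert k D)) = finsum V (cterm V r x) ?S1 \<oplus>\<^bsub>V\<^esub>
      (finsum V (cterm V r x) ?S2 \<oplus>\<^bsub>V\<^esub> finsum V (cterm V r x) ?S3)"
    unfolding covers_insert[OF kD]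
    using V.M.finsum_Un_disjoint[OF _ _ disj(1) cl'(1,2)] V.M.finsum_Un_disjoint[OF _ _ disj(2) cl'(3,4)] fD by simp
  also have "finsum V (cterm V r x) ?S1 = finsum V (cterm V (lower A r) (upper A k x)) (covers D)"
    unfolding V.M.finsum_reindex[OF cl'(1) inj(1)]
    by (rule V.M.finsum_cong'[OF refl cterm_Pi[OF A' r0 x1 D]]) (use cD in \<open>auto simp: cterm_def split: prod.splits\<close>)
  also have "finsum V (cterm V r x) ?S2 = finsum V (cterm V (upper A k r) (lower A x)) (covers D)"
    unfolding V.M.finsum_reindex[OF cl'(3) inj(2)]
    by (rule V.M.finsum_cong'[OF refl cterm_Pi[OF A' r1 x0 D]]) (use cD in \<open>auto simp: cterm_def split: prod.splits\<close>)
  also have "finsum V (cterm V r x) ?S3 = t k \<odot>\<^bsub>V\<^esub> finsum V (cterm V (upper A k r) (upper A k x)) (covers D)"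
    unfolding V.M.finsum_reindex[OF cl'(4) inj(3)] V.finsum_smult_ldistr[OF fD tk cterm_Pi[OF A' r1 x1 D]]
  proof (rule V.M.finsum_cong'[OF refl])
    show "(\<lambda>p. t k \<odot>\<^bsub>V\<^esub> cterm V (upper A k r) (upper A k x) p) \<in> covers D \<rightarrow> carrier V"
      using cterm_closed[OF A' r1 x1 D] tk by auto
    fix p assume p: "p \<in> covers D"
    obtain B C where BC: "p = (B, C)" by (cases p)
    have q: "B \<subseteq> A" "C \<subseteq> A" "k \<notin> B" "k \<notin> C" using cD[OF p] BC by auto
    have fin: "finite (B \<inter> C)" using q valid_fin[OF A'] by blast
    have c: "r (insert k B) \<in> carrier K" "x (insert k C) \<in> carrier V"
      using r x q by (auto simp: PiE_iff)
    have fp: "finprod K t (B \<inter> C) \<in> carrier K" using finprod_t[OF A'] q by blast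
    have "insert k B \<inter> insert k C = insert k (B \<inter> C)" by auto
    moreover have "finprod K t (insert k (B \<inter> C)) = t k \<otimes>\<^bsub>K\<^esub> finprod K t (B \<inter> C)"
      using q fin tk A' by (intro K.finprod_insert) (auto simp: valid_def)
    ultimately show "cterm V r x (?f3 p) = t k \<odot>\<^bsub>V\<^esub> cterm V (upper A k r) (upper A k x) p"
      using q c fp tk by (simp add: BC cterm_def V.smult_assoc1[symmetric] K.m_assoc)
  qed
  finally show "cmul V (insert k A) r x (insert k D) = (cmul V A (lower A r) (upper A k x) D \<oplus>\<^bsub>V\<^esub>
       cmul V A (upper A k r) (lower A x) D) \<oplus>\<^bsub>V\<^esub> t k \<odot>\<^bsub>V\<^esub> cmul V A (upper A k r) (upper A k x) D"
    unfolding fD1 fD2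
    using V.M.add.m_assoc[OF V.M.finsum_closed[OF cterm_Pi[OF A' r0 x1 D]] V.M.finsum_closed[OF cterm_Pi[OF A' r1 x0 D]]
      V.smult_closed[OF tk V.M.finsum_closed[OF cterm_Pi[OF A' r1 x1 D]]]]
    by (simp only:)
qed

text \<open>The vertices of \<open>x + v e_k\<close> are those of \<open>x\<close> and those of \<open>x + t_k v\<close>.\<close>

lemma vertex_join:
  assumes A: "valid (insert k A)" and k: "k \<notin> A" and z: "z \<in> carrier (cube_space V (insert k A))" and B: "B \<subseteq> A"
  shows "vertex K t V z B = vertex K t V (lower A z) B"
    and "vertex K t V z (insert k B) = vertex K t V (lower A z \<oplus>\<^bsub>cube_space V A\<^esub> t k \<odot>\<^bsub>cube_space V A\<^esub> upper A k z) B"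
proof -
  have A': "valid A" and tk: "t k \<in> carrier K" using valid_insertD[OF A] by auto
  have fB: "finite (Pow B)" using valid_fin[OF A' B] by auto
  have zc: "z C \<in> carrier V" "z (insert k C) \<in> carrier V" if "C \<subseteq> A" for C using z that by (auto simp: PiE_iff)
  have tc: "finprod K t C \<in> carrier K" if "C \<subseteq> B" for C using finprod_t[OF A'] that B by blast
  have sub: "C \<subseteq> A" if "C \<subseteq> B" for C using that B by blast
  show "vertex K t V z B = vertex K t V (lower A z) B"
    unfolding vertex_def using zc(1)[OF sub] tc by (intro V.M.finsum_cong'[OF refl]) (auto simp: sub)
  let ?f = "\<lambda>C. finprod K t C \<odot>\<^bsub>V\<^esub> z C"
  have k': "k \<notin> B" using k B by auto
  have inj: "inj_on (insert k) (Pow B)" using k' by (auto simp: inj_on_def)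
  have ins: "finprod K t (insert k C) = t k \<otimes>\<^bsub>K\<^esub> finprod K t C" if C: "C \<subseteq> B" for C
  proof (rule K.finprod_insert)
    show "finite C" "k \<notin> C" using C fB k' finite_subset by auto
    show "t \<in> C \<rightarrow> carrier K" "t k \<in> carrier K" using A' B C tk by (auto simp: valid_def)
  qed
  have c1: "?f \<in> Pow B \<rightarrow> carrier V" using B zc tc by auto
  have c2: "?f \<in> insert k ` Pow B \<rightarrow> carrier V" using B zc tc tk ins by auto
  have "finsum V ?f (Pow (insert k B)) = finsum V ?f (Pow B) \<oplus>\<^bsub>V\<^esub> finsum V ?f (insert k ` Pow B)"
    unfolding Pow_insert using fB k' c1 c2 by (intro V.M.finsum_Un_disjoint) auto
  also have "finsum V ?f (insert k ` Pow B) = finsum V (\<lambda>C. finprod K t C \<odot>\<^bsub>V\<^esub> (t k \<odot>\<^bsub>V\<^esub> z (insert k C))) (Pow B)"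
    unfolding V.M.finsum_reindex[OF c2 inj]
    using B zc tc tk ins by (intro V.M.finsum_cong'[OF refl]) (auto simp: V.smult_assoc1[symmetric] K.m_comm)
  also have "finsum V ?f (Pow B) \<oplus>\<^bsub>V\<^esub> \<dots> = finsum V (\<lambda>C. ?f C \<oplus>\<^bsub>V\<^esub> finprod K t C \<odot>\<^bsub>V\<^esub> (t k \<odot>\<^bsub>V\<^esub> z (insert k C))) (Pow B)"
    using B zc tc tk by (intro V.M.finsum_addf[symmetric]) auto
  also have "\<dots> = vertex K t V (lower A z \<oplus>\<^bsub>cube_space V A\<^esub> t k \<odot>\<^bsub>cube_space V A\<^esub> upper A k z) B"
    unfolding vertex_def using B zc tc tk by (intro V.M.finsum_cong'[OF refl]) (auto simp: V.smult_r_distr sub)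
  finally show "vertex K t V z (insert k B) = vertex K t V (lower A z \<oplus>\<^bsub>cube_space V A\<^esub> t k \<odot>\<^bsub>cube_space V A\<^esub> upper A k z) B"
    by (simp add: vertex_def)
qed

end

end

section \<open>Functoriality of \<open>f^A\<close>\<close>

definition cmap :: "nat set \<Rightarrow> ('a \<Rightarrow> 'b) \<Rightarrow> (nat set \<Rightarrow> 'a) \<Rightarrow> (nat set \<Rightarrow> 'b)" where
  "cmap A L z = (\<lambda>B\<in>Pow A. L (z B))"

lemma cmap_apply [simp]: "B \<subseteq> A \<Longrightarrow> cmap A L z B = L (z B)"
  by (simp add: cmap_def)

lemma cmap_closed:
  "z \<in> carrier (cube_space E A) \<Longrightarrow> (\<And>x. x \<in> carrier E \<Longrightarrow> L x \<in> carrier F) \<Longrightarrow> cmap A L z \<in> carrier (cube_space F A)"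
  by (auto simp: cmap_def PiE_iff)

lemma pfun_cong: "(\<And>x. x \<in> S \<Longrightarrow> f x = g x) \<Longrightarrow> pfun S f = pfun S g"
  by (auto simp: pfun_def)

lemma continuous_partial_pfunD:
  "continuous_partial S T (pfun (topspace S) g) \<Longrightarrow> continuous_map S T g"
  unfolding continuous_partial_def dom_pfun subtopology_topspace by (auto intro: continuous_map_eq)

lemma cmap_lin:
  assumes E: "topological_module R E" and F: "topological_module R F" and L: "lin R E F L"
  shows "lin R (cube_space E A) (cube_space F A) (cmap A L)"
proof -
  have c: "continuous_map (mtop E) (mtop F) L" using L by (simp add: lin_def)
  have "continuous_map (mtop (cube_space E A)) (mtop (cube_space F A)) (cmap A L)"
    unfolding cmap_def cube_space_simps continuous_restrict
    by (auto intro: continuous_map_compose[OF continuous_coordinate c, unfolded o_def])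
  then show ?thesis
    using L unfolding lin_def by (auto simp: cmap_def PiE_iff intro!: restrict_ext)
qed

lemma unjoin_image: "unjoin A k ` carrier (cube_space V (insert k A)) \<subseteq> carrier (cube_space V A) \<times> carrier (cube_space V A)"
  by (metis image_subsetI prod_module_simps(1) unjoin_closed)

lemma join_eqI:
  assumes "\<And>D. D \<subseteq> A \<Longrightarrow> y D = x D" "\<And>D. D \<subseteq> A \<Longrightarrow> y (insert k D) = v D"
    and "y \<in> extensional (Pow (insert k A))" and k: "k \<notin> A"
  shows "join A k (x, v) = y"
proof
  fix B show "join A k (x, v) B = y B"
  proof (cases "B \<subseteq> insert k A")
    case True
    show ?thesis
    proof (cases "k \<in> B")
      case kB: True
      then have "insert k (B - {k}) = B" "B - {k} \<subseteq> A" using True by auto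
      then have "y B = v (B - {k})" using assms(2)[of "B - {k}"] by simp
      then show ?thesis using kB True by (simp add: join_def)
    next
      case False
      then have "B \<subseteq> A" using True by auto
      then show ?thesis using False True assms(1) by (simp add: join_def)
    qed
  next
    case False
    then show ?thesis using assms(3) by (simp add: join_def extensional_def)
  qed
qed

context good_cube begin

text \<open>The recursion is that of the iterated manifolds, so that transition maps are literally values of \<open>T\<close>.\<close>

primrec T :: "nat list \<Rightarrow> ('k, 'e) top_module \<Rightarrow> ('k, 'f) top_module \<Rightarrow> ('e \<rightharpoonup> 'f) \<Rightarrow>
    ((nat set \<Rightarrow> 'e) \<rightharpoonup> (nat set \<Rightarrow> 'f))" where
  "T [] E F f = conj_map (carrier (cube_space E {})) (\<lambda>z. z {}) cube0 f"
| "T (k # ks) E F f = conj_map (carrier (cube_space E (insert k (set ks)))) (unjoin (set ks) k) (join (set ks) k)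
     (tmap K (cube_space E (set ks)) (cube_space F (set ks)) (t k) (T ks E F f))"

definition valid_list :: "nat list \<Rightarrow> bool" where
  "valid_list ks \<longleftrightarrow> distinct ks \<and> valid (set ks)"

lemma valid_list_Cons:
  "valid_list (k # ks) \<Longrightarrow> valid_list ks \<and> k \<notin> set ks \<and> t k \<in> carrier K \<and> valid (insert k (set ks))"
  by (auto simp: valid_list_def valid_def)

lemmas tm_cube = topological_module_cube[where R = K]

lemma sm_T:
  assumes ks: "valid_list ks" and E: "topological_module K E" and F: "topological_module K F" and f: "sm E F f"
  shows "sm (cube_space E (set ks)) (cube_space F (set ks)) (T ks E F f)"
  using ks
proof (induction ks)
  case Nil
  show ?case
    using sm_conj_map[OF tm_cube[OF E] E tm_cube[OF F] F uncube0_lin cube0_lin f] by simp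
next
  case (Cons k ks)
  note v = valid_list_Cons[OF Cons.prems]
  let ?E = "cube_space E (set ks)" and ?F = "cube_space F (set ks)"
  have "sm (prod_module ?E ?E) (prod_module ?F ?F) (tmap K ?E ?F (t k) (T ks E F f))"
    using v Cons.IH by (intro tmap_sm tm_cube E F) auto
  from sm_conj_map[OF tm_cube[OF E] tm_prod[OF tm_cube[OF E] tm_cube[OF E]] tm_cube[OF F]
      tm_prod[OF tm_cube[OF F] tm_cube[OF F]] unjoin_lin join_lin[OF F] this]
  show ?case unfolding T.simps list.set using v by blast
qed

lemma T_comp:
  assumes ks: "valid_list ks" and E: "topological_module K E" and F: "topological_module K F" and G: "topological_module K G"
    and f: "sm E F f" and g: "sm F G g"
  shows "T ks E G (g \<circ>\<^sub>m f) = T ks F G g \<circ>\<^sub>m T ks E F f"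
  using ks
proof (induction ks)
  case Nil
  show ?case unfolding T.simps
    by (rule conj_map_comp[symmetric, OF sm_ran[OF E F f]]) (auto simp: cube0_def)
next
  case (Cons k ks)
  note v = valid_list_Cons[OF Cons.prems]
  let ?E = "cube_space E (set ks)" and ?F = "cube_space F (set ks)" and ?G = "cube_space G (set ks)"
  have s: "sm ?E ?F (T ks E F f)" "sm ?F ?G (T ks F G g)" using v sm_T E F G f g by blast+
  have *: "tmap K ?E ?G (t k) (T ks E G (g \<circ>\<^sub>m f)) = tmap K ?F ?G (t k) (T ks F G g) \<circ>\<^sub>m tmap K ?E ?F (t k) (T ks E F f)"
    using v Cons.IH tmap_comp[OF _ tm_cube[OF E] tm_cube[OF F] tm_cube[OF G] s] by simp
  have st: "sm (prod_module ?E ?E) (prod_module ?F ?F) (tmap K ?E ?F (t k) (T ks E F f))"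
    using v s by (intro tmap_sm tm_cube E F) auto
  have r: "ran (tmap K ?E ?F (t k) (T ks E F f)) \<subseteq> carrier (prod_module ?F ?F)"
    by (intro sm_ran[OF _ _ st] tm_prod tm_cube E F)
  show ?case unfolding T.simps *
    using v by (intro conj_map_comp[symmetric, OF r] join_closed unjoin_join) auto
qed

lemma T_mono:
  assumes ks: "valid_list ks" and E: "topological_module K E" and F: "topological_module K F"
    and f: "sm E F f" and g: "sm E F g" and le: "f \<subseteq>\<^sub>m g"
  shows "T ks E F f \<subseteq>\<^sub>m T ks E F g"
  using ks
proof (induction ks)
  case Nil
  show ?case unfolding T.simps by (rule conj_map_mono[OF le])
next
  case (Cons k ks)
  note v = valid_list_Cons[OF Cons.prems]
  show ?case unfolding T.simps
    using v Cons.IH sm_T E F f g by (intro conj_map_mono tmap_mono tm_cube) auto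
qed

lemma T_lin:
  assumes ks: "valid_list ks" and E: "topological_module K E" and F: "topological_module K F" and L: "lin K E F L"
  shows "T ks E F (pfun (carrier E) L) = pfun (carrier (cube_space E (set ks))) (cmap (set ks) L)"
  using ks
proof (induction ks)
  case Nil
  have "T [] E F (pfun (carrier E) L) = pfun (carrier (cube_space E {})) (\<lambda>z. cube0 (L (z {})))"
    unfolding T.simps by (rule conj_map_pfun) auto
  also have "\<dots> = pfun (carrier (cube_space E {})) (cmap {} L)"
    by (rule pfun_cong) (auto simp: cmap_def cube0_def intro!: restrict_ext)
  finally show ?case by simp
next
  case (Cons k ks)
  note v = valid_list_Cons[OF Cons.prems]
  let ?A = "set ks"
  let ?E = "cube_space E ?A" and ?F = "cube_space F ?A" and ?S = "carrier (cube_space E (insert k (set ks)))"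
  have "T (k # ks) E F (pfun (carrier E) L) = conj_map ?S (unjoin ?A k) (join ?A k)
     (pfun (carrier ?E \<times> carrier ?E) (\<lambda>p. (cmap ?A L (fst p), cmap ?A L (snd p))))"
    unfolding T.simps using v Cons.IH tmap_lin[OF _ tm_cube[OF E] tm_cube[OF F] cmap_lin[OF E F L]] by simp
  also have "\<dots> = pfun ?S (\<lambda>z. join ?A k (cmap ?A L (fst (unjoin ?A k z)), cmap ?A L (snd (unjoin ?A k z))))"
    by (rule conj_map_pfun[OF unjoin_image])
  also have "\<dots> = pfun ?S (cmap (insert k ?A) L)"
  proof (rule pfun_cong)
    fix z assume "z \<in> ?S"
    show "join ?A k (cmap ?A L (fst (unjoin ?A k z)), cmap ?A L (snd (unjoin ?A k z))) = cmap (insert k ?A) L z"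
      by (rule join_eqI) (use v in \<open>auto simp: unjoin_def cmap_def subset_insertI2\<close>)
  qed
  finally show ?case by simp
qed

lemma dom_T:
  assumes ks: "valid_list ks" and E: "topological_module K E" and F: "topological_module K F" and d: "dom f \<subseteq> carrier E"
  shows "dom (T ks E F f) = {z \<in> carrier (cube_space E (set ks)). \<forall>B\<in>Pow (set ks). vertex K t E z B \<in> dom f}"
  using ks
proof (induction ks)
  case Nil
  interpret E: Module.module K E by (rule topological_moduleD(2)[OF E])
  have "vertex K t E z {} = z {}" if "z \<in> carrier (cube_space E {})" for z
  proof -
    have "z {} \<in> carrier E" using that by (auto simp: PiE_iff)
    then show ?thesis by (simp add: vertex_def)
  qed
  then show ?case by (auto simp del: cube_space_simps)
next
  case (Cons k ks)
  note v = valid_list_Cons[OF Cons.prems]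
  let ?A = "set ks" and ?E = "cube_space E (set ks)"
  interpret cE: Module.module K ?E by (rule topological_moduleD(2)[OF tm_cube[OF E]])
  have "z \<in> dom (T (k # ks) E F f) \<longleftrightarrow> (\<forall>B\<in>Pow (set (k # ks)). vertex K t E z B \<in> dom f)"
    if z: "z \<in> carrier (cube_space E (insert k ?A))" for z
  proof -
    have c: "lower ?A z \<in> carrier ?E" "upper ?A k z \<in> carrier ?E"
      using unjoin_closed[OF z] by (auto simp: unjoin_def simp del: cube_space_simps)
    have "z \<in> dom (T (k # ks) E F f) \<longleftrightarrow> lower ?A z \<in> dom (T ks E F f) \<and>
        (lower ?A z \<oplus>\<^bsub>?E\<^esub> t k \<odot>\<^bsub>?E\<^esub> upper ?A k z) \<in> dom (T ks E F f)"
      using z c by (simp add: tset_def unjoin_def del: cube_space_simps)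
    also have "\<dots> \<longleftrightarrow> (\<forall>B\<in>Pow ?A. vertex K t E (lower ?A z) B \<in> dom f \<and>
       vertex K t E (lower ?A z \<oplus>\<^bsub>?E\<^esub> t k \<odot>\<^bsub>?E\<^esub> upper ?A k z) B \<in> dom f)"
      unfolding Cons.IH[OF conjunct1[OF v]] using c v by (auto simp del: cube_space_simps)
    also have "\<dots> \<longleftrightarrow> (\<forall>B\<in>Pow ?A. vertex K t E z B \<in> dom f \<and> vertex K t E z (insert k B) \<in> dom f)"
      using vertex_join[OF E _ _ z] v by (simp del: cube_space_simps)
    also have "\<dots> \<longleftrightarrow> (\<forall>B\<in>Pow (set (k # ks)). vertex K t E z B \<in> dom f)"
      by (auto simp: Pow_insert ball_Un simp del: Pow_iff)
    finally show ?thesis .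
  qed
  then show ?case by (auto simp del: cube_space_simps Pow_iff)
qed

lemma dom_T_closed:
  assumes "valid_list ks" "topological_module K E" "topological_module K F" "sm E F f" "z \<in> dom (T ks E F f)"
  shows "z \<in> carrier (cube_space E (set ks))" "the (T ks E F f z) \<in> carrier (cube_space F (set ks))"
  using sm_dom[OF sm_T[OF assms(1-4)]] sm_ran[OF tm_cube[OF assms(2)] tm_cube[OF assms(3)] sm_T[OF assms(1-4)]] assms(5)
  by (blast, metis domD option.sel ranI subsetD)

text \<open>A pair is determined by its projections, which are linear, so functoriality computes both coordinates.\<close>

lemma T_ppair:
  assumes ks: "valid_list ks" and E: "topological_module K E" and F: "topological_module K F" and G: "topological_module K G"
    and f: "sm E F f" and g: "sm E G g" and z: "z \<in> dom (T ks E F f)" "z \<in> dom (T ks E G g)"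
  shows "T ks E (prod_module F G) (ppair f g) z =
    Some (\<lambda>B\<in>Pow (set ks). (the (T ks E F f z) B, the (T ks E G g z) B))"
proof -
  let ?A = "set ks"
  note FG = tm_prod[OF F G] and p = sm_ppair[OF F G f g]
  note d = dom_T[OF ks E]
  have "z \<in> dom (T ks E (prod_module F G) (ppair f g))"
    using z unfolding d[OF F sm_dom[OF f]] d[OF G sm_dom[OF g]] d[OF FG sm_dom[OF p]] by (auto simp del: cube_space_simps)
  then obtain w where w: "T ks E (prod_module F G) (ppair f g) z = Some w" by auto
  have wc: "w \<in> carrier (cube_space (prod_module F G) ?A)"
    using dom_T_closed(2)[OF ks E FG p, of z] w by auto
  have 1: "T ks E H h z = Some (cmap ?A L w)"
    if H: "topological_module K H" and L: "lin K (prod_module F G) H L" and h: "sm E H h"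
      and le: "map_option L \<circ> ppair f g \<subseteq>\<^sub>m h" for H h L
  proof -
    have sL: "sm (prod_module F G) H (pfun (carrier (prod_module F G)) L)" by (rule sm_pfun[OF FG H lin_aff[OF L]])
    have e: "pfun (carrier (prod_module F G)) L \<circ>\<^sub>m ppair f g = map_option L \<circ> ppair f g"
      using sm_ran[OF E FG p] by (force simp: map_comp_def pfun_def ran_def fun_eq_iff split: option.splits simp del: prod_module_simps)
    have s: "sm E H (map_option L \<circ> ppair f g)" by (rule sm_post[OF FG H L p])
    have "T ks E H (map_option L \<circ> ppair f g) z = Some (cmap ?A L w)"
      unfolding e[symmetric] T_comp[OF ks E FG H p sL] T_lin[OF ks FG H L] using w wc by (simp add: map_comp_def)
    then show ?thesis using T_mono[OF ks E H s h le] by (metis domI map_le_def)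
  qed
  have "map_option fst \<circ> ppair f g \<subseteq>\<^sub>m f" "map_option snd \<circ> ppair f g \<subseteq>\<^sub>m g"
    by (auto simp: map_le_def ppair_eq_Some)
  then have "T ks E F f z = Some (cmap ?A fst w)" "T ks E G g z = Some (cmap ?A snd w)"
    using 1[OF F lin_fst f] 1[OF G lin_snd g] by blast+
  moreover have "w = (\<lambda>B\<in>Pow ?A. (fst (w B), snd (w B)))"
    using wc by (auto simp: PiE_iff fun_eq_iff extensional_def)
  then have "w = (\<lambda>B\<in>Pow ?A. (cmap ?A fst w B, cmap ?A snd w B))"
    by (rule trans) (auto intro!: restrict_ext)
  ultimately show ?thesis using w by simp
qed

text \<open>Induction on the list. The action of \<open>K^A\<close> on \<open>V^A\<close> is a quadratic map over \<open>K\<close> whose polar form comes from the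
  same action, so one step of the functor yields the product rule for one more generator. Continuity of the
  action is part of the induction: it is a value of \<open>T\<close>, hence smooth.\<close>

lemma T_smul:
  fixes V :: "('k, 'v) top_module"
  assumes ks: "valid_list ks" and V: "topological_module K V"
  shows "T ks (scalars V) V (smul V) = pfun (carrier (cube_space (scalars V) (set ks)))
    (\<lambda>z. cmul V (set ks) (cmap (set ks) fst z) (cmap (set ks) snd z))"
  using ks
proof (induction ks)
  case Nil
  interpret V: Module.module K V by (rule topological_moduleD(2)[OF V])
  have sub: "(\<lambda>z. z {}) ` carrier (cube_space (scalars V) {}) \<subseteq> carrier K \<times> carrier V"
  proof (rule image_subsetI)
    fix z assume "z \<in> carrier (cube_space (scalars V) {})"
    then have "z {} \<in> carrier (scalars V)" by (simp add: PiE_iff del: prod_module_simps)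
    then show "z {} \<in> carrier K \<times> carrier V" by simp
  qed
  have cov: "covers {} = {({}, {})}" by (auto simp: covers_def)
  have "T [] (scalars V) V (smul V) = pfun (carrier (cube_space (scalars V) {})) (\<lambda>z. cube0 ((fst (z {}) \<odot>\<^bsub>V\<^esub> snd (z {}))))"
    unfolding T.simps smul_def by (rule conj_map_pfun[OF sub])
  also have "\<dots> = pfun (carrier (cube_space (scalars V) {})) (\<lambda>z. cmul V {} (cmap {} fst z) (cmap {} snd z))"
  proof (rule pfun_cong)
    fix z assume "z \<in> carrier (cube_space (scalars V) {})"
    then have "z {} \<in> carrier K \<times> carrier V" by (rule subsetD[OF sub imageI])
    then have "fst (z {}) \<in> carrier K" "snd (z {}) \<in> carrier V" by (simp_all add: mem_Times_iff)
    then show "cube0 ((fst (z {}) \<odot>\<^bsub>V\<^esub> snd (z {}))) = cmul V {} (cmap {} fst z) (cmap {} snd z)"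
      using V.M.finsum_insert[of "{}" "({}, {})" "cterm V (cmap {} fst z) (cmap {} snd z)"]
      unfolding cube0_def cmul_def by (intro restrict_ext) (simp add: cov cterm_def case_prod_unfold)
  qed
  finally show ?case by simp
next
  case (Cons k ks)
  note v = valid_list_Cons[OF Cons.prems]
  let ?A = "set ks"
  let ?S = "cube_space (scalars V) ?A" and ?G = "cube_space V ?A" and ?KA = "cube_space (regular_module K) ?A"
  let ?S' = "carrier (cube_space (scalars V) (insert k ?A))"
  note tS = tm_cube[OF tm_prod[OF tm_regular V], of ?A] and tG = tm_cube[OF V, of ?A]
  interpret G: Module.module K ?G by (rule topological_moduleD(2)[OF tG])
  have vA: "valid ?A" using v by (simp add: valid_list_def)
  define q where "q z = cmul V ?A (cmap ?A fst z) (cmap ?A snd z)" for z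
  define b where "b z z' = cmul V ?A (cmap ?A fst z) (cmap ?A snd z')"
    for z z' :: "nat set \<Rightarrow> 'k \<times> 'v"
  have cl: "cmap ?A fst z \<in> carrier ?KA" "cmap ?A snd z \<in> carrier ?G" if "z \<in> carrier ?S" for z
    by (rule cmap_closed[OF that]; auto)+
  have IH: "T ks (scalars V) V (smul V) = pfun (carrier ?S) q"
    unfolding q_def[abs_def] using Cons.IH v by simp
  have qc: "continuous_map (mtop ?S) (mtop ?G) q"
    using sm_continuous[OF tS sm_T[OF conjunct1[OF v] tm_prod[OF tm_regular V] V sm_smul[OF V]]]
    unfolding IH topological_moduleD(3)[OF tS, symmetric] by (rule continuous_partial_pfunD)
  let ?SS = "prod_topology (mtop ?S) (mtop ?S)"
  \<comment> \<open>The polar form is the action itself, evaluated at a point assembled from \<open>z\<close> and \<open>z'\<close>, hence continuous.\<close>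
  have bq: "b z z' = q (\<lambda>B\<in>Pow ?A. (fst (z B), snd (z' B)))" for z z'
    unfolding b_def q_def by (intro arg_cong2[of _ _ _ _ "cmul V ?A"]) (auto simp: cmap_def intro!: restrict_ext)
  have "continuous_map ?SS (mtop ?S) (\<lambda>p. \<lambda>B\<in>Pow ?A. (fst (fst p B), snd (snd p B)))"
    unfolding cube_space_simps continuous_restrict prod_module_simps
    by (auto intro!: continuous_map_pairedI
      continuous_map_compose[OF continuous_map_compose[OF continuous_map_fst continuous_coordinate] continuous_map_fst, unfolded o_def]
      continuous_map_compose[OF continuous_map_compose[OF continuous_map_snd continuous_coordinate] continuous_map_snd, unfolded o_def])
  note zc = this
  have bc: "continuous_map ?SS (mtop ?G) (\<lambda>p. b (fst p) (snd p))"
    using continuous_map_compose[OF zc qc] unfolding bq by (simp add: o_def)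
  have sw: "continuous_map ?SS ?SS (\<lambda>p. (snd p, fst p))"
    by (intro continuous_map_pairedI continuous_map_fst continuous_map_snd)
  have bc': "continuous_map ?SS (mtop ?G) (\<lambda>p. b (snd p) (fst p))"
    using continuous_map_compose[OF sw bc] by (simp add: o_def)
  have "tmap K ?S ?G (t k) (pfun (carrier ?S) q) = pfun (carrier ?S \<times> carrier ?S)
      (\<lambda>p. (q (fst p), (b (fst p) (snd p) \<oplus>\<^bsub>?G\<^esub> b (snd p) (fst p)) \<oplus>\<^bsub>?G\<^esub> t k \<odot>\<^bsub>?G\<^esub> q (snd p)))"
  proof (rule tmap_quadratic[OF tS tG _ qc, of "t k" "\<lambda>z z'. b z z' \<oplus>\<^bsub>?G\<^esub> b z' z"])
    show "t k \<in> carrier K" using v by simp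
    show "continuous_map ?SS (mtop ?G) (\<lambda>p. b (fst p) (snd p) \<oplus>\<^bsub>?G\<^esub> b (snd p) (fst p))"
      by (rule continuous_add[OF tG bc bc'])
    fix p p' s assume p: "p \<in> carrier ?S" "p' \<in> carrier ?S" and s: "s \<in> carrier K"
    let ?r = "cmap ?A fst p" and ?r' = "cmap ?A fst p'" and ?x = "cmap ?A snd p" and ?x' = "cmap ?A snd p'"
    note c = cl[OF p(1)] cl[OF p(2)]
    have lf: "lin K ?S ?KA (cmap ?A fst)" and ls: "lin K ?S ?G (cmap ?A snd)"
      by (rule cmap_lin[OF tm_prod[OF tm_regular V] tm_regular lin_fst],
          rule cmap_lin[OF tm_prod[OF tm_regular V] V lin_snd])
    interpret S: Module.module K ?S by (rule topological_moduleD(2)[OF tS])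
    interpret KA: Module.module K ?KA by (rule topological_moduleD(2)[OF tm_cube[OF tm_regular]])
    have "cmap ?A fst (p \<oplus>\<^bsub>?S\<^esub> s \<odot>\<^bsub>?S\<^esub> p') = ?r \<oplus>\<^bsub>?KA\<^esub> s \<odot>\<^bsub>?KA\<^esub> ?r'"
      "cmap ?A snd (p \<oplus>\<^bsub>?S\<^esub> s \<odot>\<^bsub>?S\<^esub> p') = ?x \<oplus>\<^bsub>?G\<^esub> s \<odot>\<^bsub>?G\<^esub> ?x'"
      using lf ls p s S.smult_closed[OF s p(2)] unfolding lin_def by (simp_all del: cube_space_simps)
    then have "q (p \<oplus>\<^bsub>?S\<^esub> s \<odot>\<^bsub>?S\<^esub> p') = cmul V ?A (?r \<oplus>\<^bsub>?KA\<^esub> s \<odot>\<^bsub>?KA\<^esub> ?r') (?x \<oplus>\<^bsub>?G\<^esub> s \<odot>\<^bsub>?G\<^esub> ?x')"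
      by (simp only: q_def)
    also have "\<dots> = (cmul V ?A ?r ?x \<oplus>\<^bsub>?G\<^esub> s \<odot>\<^bsub>?G\<^esub> cmul V ?A ?r ?x') \<oplus>\<^bsub>?G\<^esub>
       s \<odot>\<^bsub>?G\<^esub> (cmul V ?A ?r' ?x \<oplus>\<^bsub>?G\<^esub> s \<odot>\<^bsub>?G\<^esub> cmul V ?A ?r' ?x')"
      using c s
      by (simp only: cmul_add_left[OF V vA] cmul_add_right[OF V vA] cmul_scale[OF V vA] KA.smult_closed G.smult_closed G.M.add.m_closed
        cmul_closed[OF V vA] G.smult_r_distr)
    also have "\<dots> = q p \<oplus>\<^bsub>?G\<^esub> s \<odot>\<^bsub>?G\<^esub> ((b p p' \<oplus>\<^bsub>?G\<^esub> b p' p) \<oplus>\<^bsub>?G\<^esub> s \<odot>\<^bsub>?G\<^esub> q p')"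
    proof -
      have "q p \<in> carrier ?G" "b p p' \<in> carrier ?G" "b p' p \<in> carrier ?G" "q p' \<in> carrier ?G"
        unfolding q_def b_def using c by (intro cmul_closed[OF V vA]; simp only:)+
      then show ?thesis unfolding q_def[symmetric] b_def[symmetric] using s
        by (simp only: G.smult_closed G.M.add.m_closed G.smult_r_distr G.M.add.m_assoc)
    qed
    finally show "q (p \<oplus>\<^bsub>?S\<^esub> s \<odot>\<^bsub>?S\<^esub> p') = q p \<oplus>\<^bsub>?G\<^esub> s \<odot>\<^bsub>?G\<^esub> ((b p p' \<oplus>\<^bsub>?G\<^esub> b p' p) \<oplus>\<^bsub>?G\<^esub> s \<odot>\<^bsub>?G\<^esub> q p')" .
  qed
  then have "T (k # ks) (scalars V) V (smul V) = conj_map ?S' (unjoin ?A k) (join ?A k) (pfun (carrier ?S \<times> carrier ?S)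
      (\<lambda>p. (q (fst p), (b (fst p) (snd p) \<oplus>\<^bsub>?G\<^esub> b (snd p) (fst p)) \<oplus>\<^bsub>?G\<^esub> t k \<odot>\<^bsub>?G\<^esub> q (snd p))))"
    unfolding T.simps IH by simp
  also have "\<dots> = pfun ?S' (\<lambda>z. (\<lambda>p. join ?A k (q (fst p),
     (b (fst p) (snd p) \<oplus>\<^bsub>?G\<^esub> b (snd p) (fst p)) \<oplus>\<^bsub>?G\<^esub> t k \<odot>\<^bsub>?G\<^esub> q (snd p))) (unjoin ?A k z))"
    by (rule conj_map_pfun[OF unjoin_image])
  also have "\<dots> = pfun ?S' (\<lambda>z. cmul V (insert k ?A) (cmap (insert k ?A) fst z) (cmap (insert k ?A) snd z))"
  proof (rule pfun_cong)
    fix z assume z: "z \<in> ?S'"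
    let ?r = "cmap (insert k ?A) fst z" and ?x = "cmap (insert k ?A) snd z"
    let ?z = "lower ?A z" and ?z' = "upper ?A k z"
    have rx: "?r \<in> carrier (cube_space (regular_module K) (insert k ?A))" "?x \<in> carrier (cube_space V (insert k ?A))"
      by (rule cmap_closed[OF z]; auto)+
    have e: "lower ?A ?r = cmap ?A fst ?z" "upper ?A k ?r = cmap ?A fst ?z'"
      "lower ?A ?x = cmap ?A snd ?z" "upper ?A k ?x = cmap ?A snd ?z'"
      by (auto simp: cmap_def subset_insertI2 intro!: restrict_ext)
    note J = cmul_join[OF V _ _ rx, unfolded e]
    have "join ?A k (q ?z, (b ?z ?z' \<oplus>\<^bsub>?G\<^esub> b ?z' ?z) \<oplus>\<^bsub>?G\<^esub> t k \<odot>\<^bsub>?G\<^esub> q ?z') = cmul V (insert k ?A) ?r ?x"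
    proof (rule join_eqI)
      show "cmul V (insert k ?A) ?r ?x \<in> extensional (Pow (insert k ?A))" by (simp add: cmul_def)
      fix D assume D: "D \<subseteq> ?A"
      show "cmul V (insert k ?A) ?r ?x D = q ?z D" using v J(1) D by (simp add: q_def)
      show "cmul V (insert k ?A) ?r ?x (insert k D) =
          ((b ?z ?z' \<oplus>\<^bsub>?G\<^esub> b ?z' ?z) \<oplus>\<^bsub>?G\<^esub> t k \<odot>\<^bsub>?G\<^esub> q ?z') D"
        using v J(2) D by (simp add: q_def b_def)
    qed (use v in simp)
    then show "(\<lambda>p. join ?A k (q (fst p),
     (b (fst p) (snd p) \<oplus>\<^bsub>?G\<^esub> b (snd p) (fst p)) \<oplus>\<^bsub>?G\<^esub> t k \<odot>\<^bsub>?G\<^esub> q (snd p))) (unjoin ?A k z) = cmul V (insert k ?A) ?r ?x"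
      by (simp add: unjoin_def del: cube_space_simps)
  qed
  finally show ?case by simp
qed

end

section \<open>The ring \<open>K^A\<close> and the module \<open>V^A\<close>\<close>

lemma map_leD: "f \<subseteq>\<^sub>m g \<Longrightarrow> f x = Some y \<Longrightarrow> g x = Some y"
  unfolding map_le_def by force

lemma (in abelian_group) add_minus_cancel_left:
  "x \<in> carrier G \<Longrightarrow> y \<in> carrier G \<Longrightarrow> (x \<oplus> y) \<ominus> x = y"
  by (simp add: minus_eq a_assoc a_comm[of x y] r_neg)

lemma abelian_group_transfer:
  assumes "abelian_group M" "carrier N = carrier M" "\<And>x y. x \<oplus>\<^bsub>N\<^esub> y = x \<oplus>\<^bsub>M\<^esub> y" "\<zero>\<^bsub>N\<^esub> = \<zero>\<^bsub>M\<^esub>"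
  shows "abelian_group N"
proof -
  interpret M: abelian_group M by fact
  show ?thesis
  proof (rule abelian_groupI; unfold assms(2-4))
    fix x assume "x \<in> carrier M"
    then show "\<exists>y\<in>carrier M. y \<oplus>\<^bsub>M\<^esub> x = \<zero>\<^bsub>M\<^esub>" using M.l_neg M.a_inv_closed by blast
  qed (auto simp: M.a_ac)
qed

lemma cube_ring_simps [simp]:
  "carrier (cube_ring K t A) = (\<Pi>\<^sub>E B\<in>Pow A. carrier K)"
  "\<zero>\<^bsub>cube_ring K t A\<^esub> = (\<lambda>B\<in>Pow A. \<zero>\<^bsub>K\<^esub>)"
  "\<one>\<^bsub>cube_ring K t A\<^esub> = (\<lambda>B\<in>Pow A. if B = {} then \<one>\<^bsub>K\<^esub> else \<zero>\<^bsub>K\<^esub>)"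
  "x \<oplus>\<^bsub>cube_ring K t A\<^esub> y = (\<lambda>B\<in>Pow A. x B \<oplus>\<^bsub>K\<^esub> y B)"
  "rtop (cube_ring K t A) = product_topology (\<lambda>_. rtop K) (Pow A)"
  by (simp_all add: cube_ring_def)

lemma cube_module_simps [simp]:
  "carrier (cube_module K t V A) = carrier (cube_space V A)"
  "\<zero>\<^bsub>cube_module K t V A\<^esub> = \<zero>\<^bsub>cube_space V A\<^esub>"
  "x \<oplus>\<^bsub>cube_module K t V A\<^esub> y = x \<oplus>\<^bsub>cube_space V A\<^esub> y"
  "mtop (cube_module K t V A) = mtop (cube_space V A)"
  by (simp_all add: cube_module_def)

context good_cube begin

lemma T_pfun:
  assumes "valid_list ks" "topological_module K E" "topological_module K F" "lin K E F L" "z \<in> carrier (cube_space E (set ks))"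
  shows "T ks E F (pfun (carrier E) L) z = Some (cmap (set ks) L z)"
  using T_lin[OF assms(1-4)] assms(5) by simp

lemma sm_add:
  assumes "topological_module K F" "sm E F a" "sm E F b"
  shows "sm E F (map_option (\<lambda>p. fst p \<oplus>\<^bsub>F\<^esub> snd p) \<circ> ppair a b)"
  by (rule sm_post[OF tm_prod[OF assms(1,1)] assms(1) lin_plus[OF assms(1)] sm_ppair[OF assms(1,1,2,3)]])

lemma sm_scaled:
  assumes "topological_module K E" "topological_module K V" "sm E (regular_module K) a" "sm E V b"
  shows "sm E V (smul V \<circ>\<^sub>m ppair a b)"
  by (rule sm_comp[OF assms(1) tm_prod[OF tm_regular assms(2)] assms(2) sm_ppair[OF tm_regular assms(2-4)] sm_smul[OF assms(2)]])

lemma T_Some_closed: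
  assumes "valid_list ks" "topological_module K E" "topological_module K F" "sm E F f" "T ks E F f z = Some y"
  shows "y \<in> carrier (cube_space F (set ks))"
  using dom_T_closed(2)[OF assms(1-4), of z] assms(5) by (simp add: domI)

text \<open>Rules to evaluate \<open>T\<close> at a point: together with \<open>T_pfun\<close> and \<open>T_add_ppair\<close> they transport any polynomial identity
  from \<open>K\<close> to \<open>K^A\<close>.\<close>

lemma T_smul_ppair:
  assumes ks: "valid_list ks" and E: "topological_module K E" and V: "topological_module K V"
    and a: "sm E (regular_module K) a" and b: "sm E V b"
    and r: "T ks E (regular_module K) a z = Some r" and x: "T ks E V b z = Some x"
  shows "T ks E V (smul V \<circ>\<^sub>m ppair a b) z = Some (cmul V (set ks) r x)"
proof -
  let ?A = "set ks" and ?w = "\<lambda>B\<in>Pow (set ks). (r B, x B)"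
  have c: "r \<in> carrier (cube_space (regular_module K) ?A)" "x \<in> carrier (cube_space V ?A)"
    using T_Some_closed[OF ks E tm_regular a r] T_Some_closed[OF ks E V b x] .
  have p: "T ks E (scalars V) (ppair a b) z = Some ?w"
    using T_ppair[OF ks E tm_regular V a b, of z] r x by auto
  have w: "?w \<in> carrier (cube_space (scalars V) ?A)" using c by (auto simp: PiE_iff)
  have "cmap ?A fst ?w = r" "cmap ?A snd ?w = x"
    using c by (auto simp: cmap_def PiE_iff fun_eq_iff extensional_def)
  then have "pfun (carrier (cube_space (scalars V) ?A)) (\<lambda>z. cmul V ?A (cmap ?A fst z) (cmap ?A snd z)) ?w = Some (cmul V ?A r x)"
    using w by (simp only: pfun_in)
  then show ?thesis
    unfolding T_comp[OF ks E tm_prod[OF tm_regular V] V sm_ppair[OF tm_regular V a b] sm_smul[OF V]] T_smul[OF ks V]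
    using p by (simp only: map_comp_simps(2))
qed

lemma T_add_ppair:
  assumes ks: "valid_list ks" and E: "topological_module K E" and F: "topological_module K F"
    and a: "sm E F a" and b: "sm E F b"
    and x: "T ks E F a z = Some x" and y: "T ks E F b z = Some y"
  shows "T ks E F (map_option (\<lambda>p. fst p \<oplus>\<^bsub>F\<^esub> snd p) \<circ> ppair a b) z = Some (x \<oplus>\<^bsub>cube_space F (set ks)\<^esub> y)"
proof -
  let ?A = "set ks" and ?w = "\<lambda>B\<in>Pow (set ks). (x B, y B)" and ?P = "\<lambda>p. fst p \<oplus>\<^bsub>F\<^esub> snd p"
  note FF = tm_prod[OF F F] and ab = sm_ppair[OF F F a b]
  have c: "x \<in> carrier (cube_space F ?A)" "y \<in> carrier (cube_space F ?A)"
    using T_Some_closed[OF ks E F a x] T_Some_closed[OF ks E F b y] .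
  have p: "T ks E (prod_module F F) (ppair a b) z = Some ?w"
    using T_ppair[OF ks E F F a b, of z] x y by auto
  have w: "?w \<in> carrier (cube_space (prod_module F F) ?A)" using c by (auto simp: PiE_iff)
  have "map_option ?P \<circ> ppair a b = pfun (carrier (prod_module F F)) ?P \<circ>\<^sub>m ppair a b"
    using sm_ran[OF E FF ab] by (force simp: map_comp_def pfun_def ran_def fun_eq_iff split: option.splits simp del: prod_module_simps)
  then have "T ks E F (map_option ?P \<circ> ppair a b) z = Some (cmap ?A ?P ?w)"
    using T_comp[OF ks E FF F ab sm_pfun[OF FF F lin_aff[OF lin_plus[OF F]]]] p T_pfun[OF ks FF F lin_plus[OF F] w]
    by (simp only: map_comp_simps(2))
  moreover have "cmap ?A ?P ?w = x \<oplus>\<^bsub>cube_space F ?A\<^esub> y"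
    by (auto simp: cmap_def intro!: restrict_ext)
  ultimately show ?thesis by simp
qed

end

locale good_cube_list = good_cube K t for K :: "'k top_ring" and t +
  fixes ks :: "nat list"
  assumes ks: "valid_list ks"
begin

abbreviation "A \<equiv> set ks"
abbreviation "KA \<equiv> cube_ring K t A"
abbreviation VA :: "('k, 'v) top_module \<Rightarrow> (nat set \<Rightarrow> 'k, nat set \<Rightarrow> 'v) top_module" where
  "VA V \<equiv> cube_module K t V A"
abbreviation CA :: "('k, 'v) top_module \<Rightarrow> ('k, nat set \<Rightarrow> 'v) top_module" where
  "CA V \<equiv> cube_space V A"
abbreviation "Kr \<equiv> regular_module K"

lemma vA: "valid A" using ks by (simp add: valid_list_def)

lemma carrier_KA: "carrier KA = carrier (CA Kr)" by simp

lemma add_KA: "x \<oplus>\<^bsub>KA\<^esub> y = x \<oplus>\<^bsub>CA Kr\<^esub> y" by simp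

lemma mult_KA:
  assumes r: "r \<in> carrier KA" and s: "s \<in> carrier KA"
  shows "r \<otimes>\<^bsub>KA\<^esub> s = cmul Kr A r s"
proof -
  \<comment> \<open>The ring uses sums in \<open>K\<close>, the module sums in \<open>K\<close> as a module over itself.\<close>
  have fs: "finsum Kr = finsum K" by (simp add: finsum_def finprod_def fun_eq_iff regular_module_def)
  have "finsum K (\<lambda>(B, C). finprod K t (B \<inter> C) \<otimes>\<^bsub>K\<^esub> (r B \<otimes>\<^bsub>K\<^esub> s C)) (covers D) = finsum Kr (cterm Kr r s) (covers D)"
    if D: "D \<subseteq> A" for D
    unfolding fs
  proof (rule K.finsum_cong'[OF refl])
    show "cterm Kr r s \<in> covers D \<rightarrow> carrier K"
      using cterm_Pi[OF tm_regular vA, of r s D] r s D by simp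
    fix p assume p: "p \<in> covers D"
    then have "fst p \<subseteq> A" "snd p \<subseteq> A" using coversD D by blast+
    then have "r (fst p) \<in> carrier K" "s (snd p) \<in> carrier K" "finprod K t (fst p \<inter> snd p) \<in> carrier K"
      using r s finprod_t[OF vA] by (auto simp: PiE_iff le_infI1)
    then show "(\<lambda>(B, C). finprod K t (B \<inter> C) \<otimes>\<^bsub>K\<^esub> (r B \<otimes>\<^bsub>K\<^esub> s C)) p = cterm Kr r s p"
      by (simp add: cterm_def case_prod_unfold K.m_assoc)
  qed
  then show ?thesis
    by (auto simp: cube_ring_def cmul_def covers_eq intro!: restrict_ext)
qed

text \<open>The functor is applied to the identity \<open>(r s) x = r (s x)\<close> between smooth maps over \<open>K\<close> and evaluated on both
  sides at the point with coordinates \<open>r\<close>, \<open>s\<close>, \<open>x\<close>.\<close>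

lemma cmul_assoc:
  assumes V: "topological_module K V" and r: "r \<in> carrier KA" and s: "s \<in> carrier KA" and x: "x \<in> carrier (CA V)"
  shows "cmul V A (cmul Kr A r s) x = cmul V A r (cmul V A s x)"
proof -
  interpret V: Module.module K V by (rule topological_moduleD(2)[OF V])
  let ?E = "prod_module Kr (prod_module Kr V)"
  note E = tm_prod[OF tm_regular tm_prod[OF tm_regular V]]
  let ?z = "\<lambda>B\<in>Pow A. (r B, s B, x B)"
  have z: "?z \<in> carrier (CA ?E)" using r s x by (auto simp: PiE_iff)
  define p1 where "p1 = pfun (carrier ?E) fst"
  define p2 where "p2 = pfun (carrier ?E) (\<lambda>q. fst (snd q))"
  define p3 where "p3 = pfun (carrier ?E) (\<lambda>q. snd (snd q))"
  have cm: "cmap A fst ?z = r" "cmap A (\<lambda>q. fst (snd q)) ?z = s" "cmap A (\<lambda>q. snd (snd q)) ?z = x"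
    using r s x by (auto simp: cmap_def PiE_iff fun_eq_iff extensional_def)
  have T: "T ks ?E Kr p1 ?z = Some r" "T ks ?E Kr p2 ?z = Some s" "T ks ?E V p3 ?z = Some x"
    unfolding p1_def p2_def p3_def
    using T_pfun[OF ks E tm_regular lin_fst z] T_pfun[OF ks E tm_regular lin_fst_snd z] T_pfun[OF ks E V lin_snd_snd z]
    unfolding cm by auto
  have S: "sm ?E Kr p1" "sm ?E Kr p2" "sm ?E V p3"
    unfolding p1_def p2_def p3_def
    by (rule sm_pfun[OF E tm_regular lin_aff[OF lin_fst]] sm_pfun[OF E tm_regular lin_aff[OF lin_fst_snd]]
       sm_pfun[OF E V lin_aff[OF lin_snd_snd]])+
  have "smul V \<circ>\<^sub>m ppair (smul Kr \<circ>\<^sub>m ppair p1 p2) p3 = smul V \<circ>\<^sub>m ppair p1 (smul V \<circ>\<^sub>m ppair p2 p3)"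
  proof
    fix q :: "'k \<times> 'k \<times> 'a" obtain a b c where q: "q = (a, b, c)" by (metis prod.exhaust)
    show "(smul V \<circ>\<^sub>m ppair (smul Kr \<circ>\<^sub>m ppair p1 p2) p3) q = (smul V \<circ>\<^sub>m ppair p1 (smul V \<circ>\<^sub>m ppair p2 p3)) q"
      by (cases "q \<in> carrier ?E") (auto simp: q p1_def p2_def p3_def smul_def map_comp_def ppair_def pfun_def V.smult_assoc1)
  qed
  then show ?thesis
    using T_smul_ppair[OF ks E V sm_scaled[OF E tm_regular S(1,2)] S(3) T_smul_ppair[OF ks E tm_regular S(1,2) T(1,2)] T(3)]
      T_smul_ppair[OF ks E V S(1) sm_scaled[OF E V S(2,3)] T(1) T_smul_ppair[OF ks E V S(2,3) T(2,3)]] by simp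
qed

lemma cmul_comm:
  assumes r: "r \<in> carrier KA" and s: "s \<in> carrier KA"
  shows "cmul Kr A r s = cmul Kr A s r"
proof -
  let ?E = "prod_module Kr Kr"
  note E = tm_prod[OF tm_regular tm_regular]
  let ?z = "\<lambda>B\<in>Pow A. (r B, s B)"
  have z: "?z \<in> carrier (CA ?E)" using r s by (auto simp: PiE_iff)
  define p1 where "p1 = pfun (carrier ?E) fst"
  define p2 where "p2 = pfun (carrier ?E) snd"
  have cm: "cmap A fst ?z = r" "cmap A snd ?z = s"
    using r s by (auto simp: cmap_def PiE_iff fun_eq_iff extensional_def)
  have T: "T ks ?E Kr p1 ?z = Some r" "T ks ?E Kr p2 ?z = Some s"
    unfolding p1_def p2_def
    using T_pfun[OF ks E tm_regular lin_fst z] T_pfun[OF ks E tm_regular lin_snd z] unfolding cm by auto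
  have S: "sm ?E Kr p1" "sm ?E Kr p2"
    unfolding p1_def p2_def
    by (rule sm_pfun[OF E tm_regular lin_aff[OF lin_fst]] sm_pfun[OF E tm_regular lin_aff[OF lin_snd]])+
  have "smul Kr \<circ>\<^sub>m ppair p1 p2 = smul Kr \<circ>\<^sub>m ppair p2 p1"
    by (rule ext) (auto simp: p1_def p2_def smul_def map_comp_def ppair_def pfun_def K.m_comm)
  then show ?thesis
    using T_smul_ppair[OF ks E tm_regular S T] T_smul_ppair[OF ks E tm_regular S(2,1) T(2,1)] by simp
qed

text \<open>Only the cover by the empty set and \<open>D\<close> contributes to the coefficient of \<open>e_D\<close>.\<close>

lemma cmul_one:
  assumes V: "topological_module K V" and x: "x \<in> carrier (CA V)"
  shows "cmul V A \<one>\<^bsub>KA\<^esub> x = x"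
proof (rule cube_eqI)
  interpret V: Module.module K V by (rule topological_moduleD(2)[OF V])
  have o: "\<one>\<^bsub>KA\<^esub> \<in> carrier (CA Kr)" by auto
  then show "cmul V A \<one>\<^bsub>KA\<^esub> x \<in> carrier (CA V)" by (rule cmul_closed[OF V vA _ x])
  fix D assume D: "D \<subseteq> A"
  have xD: "x D \<in> carrier V" using x D by (auto simp: PiE_iff)
  have "finsum V (cterm V \<one>\<^bsub>KA\<^esub> x) (covers D) = finsum V (\<lambda>p. if ({}, D) = p then x D else \<zero>\<^bsub>V\<^esub>) (covers D)"
  proof (rule V.M.finsum_cong'[OF refl])
    fix p assume p: "p \<in> covers D"
    obtain B C where BC: "p = (B, C)" by (cases p)
    have q: "B \<subseteq> A" "C \<subseteq> A" using coversD[OF p] D BC by auto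
    have xC: "x C \<in> carrier V" using x q by (auto simp: PiE_iff)
    have f: "finprod K t (B \<inter> C) \<in> carrier K" using finprod_t[OF vA] q by blast
    show "cterm V \<one>\<^bsub>KA\<^esub> x p = (if ({}, D) = p then x D else \<zero>\<^bsub>V\<^esub>)"
    proof (cases "B = {}")
      case True
      then have "C = D" using p BC by (auto simp: covers_def)
      then show ?thesis using True BC xC by (simp add: cterm_def)
    next
      case False
      then show ?thesis using BC q xC f by (auto simp: cterm_def)
    qed
  qed (use xD in auto)
  also have "\<dots> = x D"
    using V.M.finsum_singleton[of "({}, D)" "covers D" "\<lambda>_. x D"] xD finite_covers[OF valid_fin[OF V vA D]]
    by (auto simp: covers_def)
  finally show "cmul V A \<one>\<^bsub>KA\<^esub> x D = x D" using D by (simp add: cmul_def)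
qed (rule x)

lemma cmul_continuous:
  assumes V: "topological_module K V"
  shows "continuous_map (prod_topology (mtop (CA Kr)) (mtop (CA V))) (mtop (CA V)) (\<lambda>p. cmul V A (fst p) (snd p))"
proof -
  note S = tm_prod[OF tm_regular V]
  let ?S = "CA (scalars V)" and ?P = "prod_topology (mtop (CA Kr)) (mtop (CA V))"
  have q: "continuous_map (mtop ?S) (mtop (CA V)) (\<lambda>z. cmul V A (cmap A fst z) (cmap A snd z))"
    using sm_continuous[OF tm_cube[OF S] sm_T[OF ks S V sm_smul[OF V]]]
    unfolding T_smul[OF ks V] topological_moduleD(3)[OF tm_cube[OF S], symmetric] by (rule continuous_partial_pfunD)
  have z: "continuous_map ?P (mtop ?S) (\<lambda>p. \<lambda>B\<in>Pow A. (fst p B, snd p B))"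
    unfolding cube_space_simps continuous_restrict prod_module_simps regular_module_simps
    by (auto intro!: continuous_map_pairedI
      continuous_map_compose[OF continuous_map_fst continuous_coordinate, unfolded o_def]
      continuous_map_compose[OF continuous_map_snd continuous_coordinate, unfolded o_def])
  show ?thesis
  proof (rule continuous_map_eq[OF continuous_map_compose[OF z q]])
    fix p assume "p \<in> topspace ?P"
    then have "fst p \<in> carrier (CA Kr)" "snd p \<in> carrier (CA V)"
      using topological_moduleD(3)[OF tm_cube[OF tm_regular]] topological_moduleD(3)[OF tm_cube[OF V]] by (auto simp del: cube_space_simps)
    then have "cmap A fst (\<lambda>B\<in>Pow A. (fst p B, snd p B)) = fst p" "cmap A snd (\<lambda>B\<in>Pow A. (fst p B, snd p B)) = snd p"
      by (auto simp: cmap_def PiE_iff fun_eq_iff extensional_def)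
    then show "((\<lambda>z. cmul V A (cmap A fst z) (cmap A snd z)) \<circ> (\<lambda>p. \<lambda>B\<in>Pow A. (fst p B, snd p B))) p = cmul V A (fst p) (snd p)"
      by simp
  qed
qed

lemma cring_KA: "cring KA"
proof (rule cringI)
  interpret KC: Module.module K "CA Kr" by (rule topological_moduleD(2)[OF tm_cube[OF tm_regular]])
  note cl = cmul_closed[OF tm_regular vA, folded carrier_KA]
  show "abelian_group KA"
    by (rule abelian_group_transfer[OF abelian_group_cube[OF topological_moduleD(6)[OF tm_regular], of A]]) auto
  have o: "\<one>\<^bsub>KA\<^esub> \<in> carrier KA" by auto
  have m: "x \<otimes>\<^bsub>KA\<^esub> y \<in> carrier KA" if "x \<in> carrier KA" "y \<in> carrier KA" for x y
    using that by (simp only: mult_KA cl)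
  have assoc: "x \<otimes>\<^bsub>KA\<^esub> y \<otimes>\<^bsub>KA\<^esub> z = x \<otimes>\<^bsub>KA\<^esub> (y \<otimes>\<^bsub>KA\<^esub> z)"
    if c: "x \<in> carrier KA" "y \<in> carrier KA" "z \<in> carrier KA" for x y z
    unfolding mult_KA[OF c(1,2)] mult_KA[OF c(2,3)] mult_KA[OF cl[OF c(1,2)] c(3)] mult_KA[OF c(1) cl[OF c(2,3)]]
    by (rule cmul_assoc[OF tm_regular c(1,2) c(3)[unfolded carrier_KA]])
  have comm: "x \<otimes>\<^bsub>KA\<^esub> y = y \<otimes>\<^bsub>KA\<^esub> x" if "x \<in> carrier KA" "y \<in> carrier KA" for x y
    using that cmul_comm by (simp only: mult_KA)
  have one: "\<one>\<^bsub>KA\<^esub> \<otimes>\<^bsub>KA\<^esub> x = x" if c: "x \<in> carrier KA" for x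
    unfolding mult_KA[OF o c] by (rule cmul_one[OF tm_regular c[unfolded carrier_KA]])
  show "comm_monoid KA" by (rule comm_monoidI[OF m o assoc one comm])
  fix x y z assume c: "x \<in> carrier KA" "y \<in> carrier KA" "z \<in> carrier KA"
  have xy: "x \<oplus>\<^bsub>KA\<^esub> y \<in> carrier KA" using c KC.M.add.m_closed[of x y] by (simp only: carrier_KA add_KA)
  show "(x \<oplus>\<^bsub>KA\<^esub> y) \<otimes>\<^bsub>KA\<^esub> z = x \<otimes>\<^bsub>KA\<^esub> z \<oplus>\<^bsub>KA\<^esub> y \<otimes>\<^bsub>KA\<^esub> z"
    unfolding mult_KA[OF xy c(3)] mult_KA[OF c(1,3)] mult_KA[OF c(2,3)] unfolding add_KA
    by (rule cmul_add_left[OF tm_regular vA c[unfolded carrier_KA]])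
qed

lemma H_KA: "Hausdorff_space (rtop KA)"
  using H by (simp add: Hausdorff_space_product_topology)

lemma topological_ring_KA: "topological_ring KA"
proof -
  interpret KA: cring KA by (rule cring_KA)
  have neg: "\<ominus>\<^bsub>KA\<^esub> x = (\<lambda>B\<in>Pow A. \<ominus>\<^bsub>K\<^esub> x B)" if x: "x \<in> carrier KA" for x
  proof (rule KA.minus_equality)
    have "x B \<in> carrier K" if "B \<subseteq> A" for B using x that by (auto simp: PiE_iff)
    then show "(\<lambda>B\<in>Pow A. \<ominus>\<^bsub>K\<^esub> x B) \<oplus>\<^bsub>KA\<^esub> x = \<zero>\<^bsub>KA\<^esub>"
      by (auto simp: K.l_neg intro!: restrict_ext)
  qed (use x in \<open>auto simp: PiE_iff\<close>)
  have "continuous_map (rtop K) (rtop K) (\<lambda>x. \<ominus>\<^bsub>K\<^esub> x)" using ring by (simp add: topological_ring_def)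
  then have "continuous_map (rtop KA) (rtop KA) (\<lambda>x. \<lambda>B\<in>Pow A. \<ominus>\<^bsub>K\<^esub> x B)"
    unfolding cube_ring_simps continuous_restrict
    by (auto intro: continuous_map_compose[OF continuous_coordinate, unfolded o_def])
  then have n: "continuous_map (rtop KA) (rtop KA) (\<lambda>x. \<ominus>\<^bsub>KA\<^esub> x)"
    by (rule continuous_map_eq) (simp add: neg)
  have mt: "mtop (CA Kr) = rtop KA" by simp
  have ts: "topspace (rtop KA) = carrier KA" by simp
  have "continuous_map (prod_topology (rtop KA) (rtop KA)) (rtop KA) (\<lambda>(x, y). x \<otimes>\<^bsub>KA\<^esub> y)"
    by (rule continuous_map_eq[OF cmul_continuous[OF tm_regular, unfolded mt]])
      (auto simp: mult_KA ts simp del: cube_ring_simps)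
  moreover have "continuous_map (prod_topology (rtop KA) (rtop KA)) (rtop KA) (\<lambda>(x, y). x \<oplus>\<^bsub>KA\<^esub> y)"
    using tm_cube[OF tm_regular, of A] unfolding topological_module_def mt add_KA by blast
  ultimately show ?thesis using n cring_KA ts unfolding topological_ring_def by blast
qed

lemma tm_VA:
  assumes V: "topological_module K V"
  shows "topological_module KA (VA V)"
proof -
  interpret V: Module.module K "CA V" by (rule topological_moduleD(2)[OF tm_cube[OF V]])
  have s: "r \<odot>\<^bsub>VA V\<^esub> x = cmul V A r x" for r x by (rule smult_cube_module)
  have ag: "abelian_group (VA V)"
    by (rule abelian_group_transfer[OF abelian_group_cube[OF topological_moduleD(6)[OF V], of A]]) auto
  have "Module.module KA (VA V)"
    by (rule moduleI[OF cring_KA ag]; unfold s cube_module_simps add_KA; (subst mult_KA)?)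
      (simp_all only: carrier_KA cmul_closed[OF V vA] cmul_add_left[OF V vA] cmul_add_right[OF V vA]
        cmul_assoc[OF V, unfolded carrier_KA] cmul_one[OF V])
  moreover have "continuous_map (prod_topology (rtop KA) (mtop (VA V))) (mtop (VA V)) (\<lambda>(r, x). r \<odot>\<^bsub>VA V\<^esub> x)"
    using cmul_continuous[OF V] by (simp add: s case_prod_unfold)
  ultimately show ?thesis
    using tm_cube[OF V, of A] topological_ring_KA unfolding topological_module_def cube_module_simps by blast
qed

section \<open>Smoothness over \<open>K^A\<close>\<close>

text \<open>The functor applied to \<open>L (r x) = r (L x)\<close>: a coordinatewise map that is linear over \<open>K\<close> is linear over \<open>K^A\<close>.\<close>

lemma cmap_cmul:
  assumes E: "topological_module K E" and F: "topological_module K F" and L: "lin K E F L"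
    and r: "r \<in> carrier KA" and x: "x \<in> carrier (CA E)"
  shows "cmap A L (cmul E A r x) = cmul F A r (cmap A L x)"
proof -
  let ?S = "scalars E"
  note S = tm_prod[OF tm_regular E]
  let ?z = "\<lambda>B\<in>Pow A. (r B, x B)"
  have z: "?z \<in> carrier (CA ?S)" using r x by (auto simp: PiE_iff)
  define p1 where "p1 = pfun (carrier ?S) fst"
  define p2 where "p2 = pfun (carrier ?S) snd"
  have cm: "cmap A fst ?z = r" "cmap A snd ?z = x"
    using r x by (auto simp: cmap_def PiE_iff fun_eq_iff extensional_def)
  have T: "T ks ?S Kr p1 ?z = Some r" "T ks ?S E p2 ?z = Some x"
    unfolding p1_def p2_def
    using T_pfun[OF ks S tm_regular lin_fst z] T_pfun[OF ks S E lin_snd z] unfolding cm by auto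
  have Sm: "sm ?S Kr p1" "sm ?S E p2"
    unfolding p1_def p2_def
    by (rule sm_pfun[OF S tm_regular lin_aff[OF lin_fst]] sm_pfun[OF S E lin_aff[OF lin_snd]])+
  define l where "l = pfun (carrier E) L"
  have l: "sm E F l" unfolding l_def by (rule sm_pfun[OF E F lin_aff[OF L]])
  have Tl: "T ks ?S F (l \<circ>\<^sub>m g) ?z = Some (cmap A L y)" if "sm ?S E g" "T ks ?S E g ?z = Some y" for g y
  proof -
    have "y \<in> carrier (CA E)" using dom_T_closed(2)[OF ks S E that(1), of ?z] that(2) by (auto simp del: cube_space_simps)
    then show ?thesis
      using T_comp[OF ks S E F that(1) l] T_pfun[OF ks E F L, of y] that(2) by (simp only: map_comp_simps(2) l_def)
  qed
  have "l \<circ>\<^sub>m (smul E \<circ>\<^sub>m ppair p1 p2) = smul F \<circ>\<^sub>m ppair p1 (l \<circ>\<^sub>m p2)"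
  proof
    fix q :: "'k \<times> 'a" obtain a b where q: "q = (a, b)" by (cases q)
    have "a \<odot>\<^bsub>E\<^esub> b \<in> carrier E" "L b \<in> carrier F" if "a \<in> carrier K" "b \<in> carrier E"
      using that Module.module.smult_closed[OF topological_moduleD(2)[OF E]] lin_closed[OF E F L] by auto
    then show "(l \<circ>\<^sub>m (smul E \<circ>\<^sub>m ppair p1 p2)) q = (smul F \<circ>\<^sub>m ppair p1 (l \<circ>\<^sub>m p2)) q"
      using L by (cases "q \<in> carrier ?S")
        (auto simp: q p1_def p2_def l_def smul_def map_comp_def ppair_def pfun_def lin_def)
  qed
  then show ?thesis
    using Tl[OF sm_scaled[OF S E Sm] T_smul_ppair[OF ks S E Sm T]]
      T_smul_ppair[OF ks S F Sm(1) sm_comp[OF S E F Sm(2) l] T(1) Tl[OF Sm(2) T(2)]] by simp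
qed

lemma cmap_lin_KA:
  assumes E: "topological_module K E" and F: "topological_module K F" and L: "lin K E F L"
  shows "lin KA (VA E) (VA F) (cmap A L)"
  using cmap_lin[OF E F L, of A] cmap_cmul[OF E F L]
  unfolding lin_def cube_module_simps smult_cube_module by auto

text \<open>The identification of \<open>E^A \<times> E^A \<times> K^A\<close> with \<open>(E \<times> E \<times> K)^A\<close>. It is linear over \<open>K^A\<close> because its composites
  with the coordinatewise projections are.\<close>

definition zip3 :: "(nat set \<Rightarrow> 'a) \<times> (nat set \<Rightarrow> 'b) \<times> (nat set \<Rightarrow> 'c) \<Rightarrow> (nat set \<Rightarrow> 'a \<times> 'b \<times> 'c)" where
  "zip3 p = (\<lambda>B\<in>Pow A. (fst p B, fst (snd p) B, snd (snd p) B))"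

lemma zip3_closed:
  "p \<in> carrier (bracket_module KA (VA E)) \<Longrightarrow> zip3 p \<in> carrier (CA (bracket_module K E))"
  by (cases p) (auto simp: zip3_def PiE_iff)

lemma cmap_zip3:
  assumes "(x, v, s) \<in> carrier (bracket_module KA (VA E))"
  shows "cmap A fst (zip3 (x, v, s)) = x" "cmap A (\<lambda>q. fst (snd q)) (zip3 (x, v, s)) = v"
    "cmap A (\<lambda>q. snd (snd q)) (zip3 (x, v, s)) = s"
  using assms by (auto simp: zip3_def cmap_def PiE_iff fun_eq_iff extensional_def)

lemma zip3_lin:
  assumes E: "topological_module K E"
  shows "lin KA (bracket_module KA (VA E)) (VA (bracket_module K E)) zip3"
  unfolding lin_def
proof (intro conjI ballI)
  note B = tm_bracket[OF E]
  let ?P = "prod_topology (mtop (CA E)) (prod_topology (mtop (CA E)) (rtop KA))"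
  have "continuous_map ?P (mtop (CA (bracket_module K E))) zip3"
    unfolding zip3_def cube_space_simps continuous_restrict prod_module_simps regular_module_simps cube_ring_simps
    by (auto intro!: continuous_map_pairedI
      continuous_map_compose[OF continuous_map_fst continuous_coordinate, unfolded o_def]
      continuous_map_compose[OF continuous_map_compose[OF continuous_map_snd continuous_map_fst] continuous_coordinate, unfolded o_def]
      continuous_map_compose[OF continuous_map_compose[OF continuous_map_snd continuous_map_snd] continuous_coordinate, unfolded o_def])
  then show "continuous_map (mtop (bracket_module KA (VA E))) (mtop (VA (bracket_module K E))) zip3"
    unfolding prod_module_simps regular_module_simps cube_module_simps .
  fix p q assume "p \<in> carrier (bracket_module KA (VA E))" "q \<in> carrier (bracket_module KA (VA E))"
  then show "zip3 (p \<oplus>\<^bsub>bracket_module KA (VA E)\<^esub> q) = zip3 p \<oplus>\<^bsub>VA (bracket_module K E)\<^esub> zip3 q"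
    by (cases p; cases q) (auto simp: zip3_def intro!: restrict_ext)
next
  note B = tm_bracket[OF E]
  fix r p assume r: "r \<in> carrier KA" and p: "p \<in> carrier (bracket_module KA (VA E))"
  obtain x v s where xvs: "p = (x, v, s)" by (metis prod.exhaust)
  define w where "w = cmul (bracket_module K E) A r (zip3 p)"
  have s: "s \<in> carrier KA" using p xvs by simp
  note pc = p[unfolded xvs] and z = zip3_closed[OF p]
  have w: "w \<in> carrier (CA (bracket_module K E))"
    unfolding w_def by (rule cmul_closed[OF B vA r[unfolded carrier_KA] z])
  have e: "cmap A fst w = cmul E A r x" "cmap A (\<lambda>q. fst (snd q)) w = cmul E A r v"
    "cmap A (\<lambda>q. snd (snd q)) w = cmul Kr A r s"
    using cmap_cmul[OF B E lin_fst r z] cmap_cmul[OF B E lin_fst_snd r z] cmap_cmul[OF B tm_regular lin_snd_snd r z]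
    unfolding w_def xvs cmap_zip3[OF pc] .
  have "zip3 (cmul E A r x, cmul E A r v, cmul Kr A r s) = (\<lambda>B\<in>Pow A. w B)"
    unfolding zip3_def e[symmetric] by (rule restrict_ext) simp
  also have "\<dots> = w" using w by (auto simp: PiE_iff fun_eq_iff extensional_def)
  finally show "zip3 (r \<odot>\<^bsub>bracket_module KA (VA E)\<^esub> p) = r \<odot>\<^bsub>VA (bracket_module K E)\<^esub> zip3 p"
    unfolding w_def xvs prod_module_simps regular_module_simps smult_cube_module mult_KA[OF r s] by simp
qed

text \<open>The heart of the proof: up to the identification of \<open>(E \<times> E \<times> K)^A\<close>, the image under \<open>T\<close> of \<open>f^[1]\<close> is a difference
  quotient of \<open>T f\<close> over \<open>K^A\<close>. The division-free formula says that \<open>f x + s f^[1] (x, v, s)\<close> is a restriction of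
  \<open>f (x + s v)\<close>; applying \<open>T\<close> gives the same relation over \<open>K^A\<close>.\<close>

lemma T_diff_quot:
  fixes E :: "('k, 'e) top_module"
  assumes E: "topological_module K E" and F: "topological_module K F" and f: "sm E F f"
  defines "h \<equiv> T ks (bracket_module K E) F (DQ E F f) \<circ>\<^sub>m pfun (carrier (bracket_module KA (VA E))) zip3"
  shows "is_diff_quot KA (VA E) (VA F) (T ks E F f) h"
proof -
  interpret FA: Module.module KA "VA F" by (rule topological_moduleD(2)[OF tm_VA[OF F]])
  let ?B = "bracket_module K E" and ?BA = "bracket_module KA (VA E)"
  note B = tm_bracket[OF E]
  define d where "d = DQ E F f"
  note dq = sm_DQ[OF E F f, folded d_def]
  define p1 where "p1 = pfun (carrier ?B) fst"
  define p2 where "p2 = pfun (carrier ?B) (\<lambda>q. fst (snd q))"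
  define p3 where "p3 = pfun (carrier ?B) (\<lambda>q. snd (snd q))"
  have S: "sm ?B E p1" "sm ?B E p2" "sm ?B Kr p3"
    unfolding p1_def p2_def p3_def
    by (rule sm_pfun[OF B E lin_aff[OF lin_fst]] sm_pfun[OF B E lin_aff[OF lin_fst_snd]]
       sm_pfun[OF B tm_regular lin_aff[OF lin_snd_snd]])+
  \<comment> \<open>The maps \<open>(x, v, s) \<mapsto> x + s v\<close> and \<open>(x, v, s) \<mapsto> f x + s f^[1] (x, v, s)\<close>.\<close>
  define a where "a = map_option (\<lambda>p. fst p \<oplus>\<^bsub>E\<^esub> snd p) \<circ> ppair p1 (smul E \<circ>\<^sub>m ppair p3 p2)"
  define g where "g = map_option (\<lambda>p. fst p \<oplus>\<^bsub>F\<^esub> snd p) \<circ> ppair (f \<circ>\<^sub>m p1) (smul F \<circ>\<^sub>m ppair p3 d)"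
  have sa: "sm ?B E a" unfolding a_def by (rule sm_add[OF E S(1) sm_scaled[OF B E S(3,2)]])
  have sf1: "sm ?B F (f \<circ>\<^sub>m p1)" by (rule sm_comp[OF B E F S(1) f])
  have sfa: "sm ?B F (f \<circ>\<^sub>m a)" by (rule sm_comp[OF B E F sa f])
  have sg: "sm ?B F g" unfolding g_def by (rule sm_add[OF F sf1 sm_scaled[OF B F S(3) dq(2)]])
  have dd: "dom d = bracket1 K E (dom f)" by (rule is_diff_quot_dom[OF dq(1)])
  have dE: "dom f \<subseteq> carrier E" by (rule sm_dom[OF f])
  have a: "a (x, v, s) = (if (x, v, s) \<in> carrier ?B then Some (x \<oplus>\<^bsub>E\<^esub> s \<odot>\<^bsub>E\<^esub> v) else None)" for x v s
    by (auto simp: a_def p1_def p2_def p3_def ppair_def map_comp_def smul_def pfun_def)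
  have p1: "p1 (x, v, s) = (if (x, v, s) \<in> carrier ?B then Some x else None)" for x v s
    by (auto simp: p1_def pfun_def)
  have d1: "dom d = dom (f \<circ>\<^sub>m p1) \<inter> dom (f \<circ>\<^sub>m a)"
  proof (rule Set.set_eqI)
    fix q :: "'e \<times> 'e \<times> 'k" obtain x v s where q: "q = (x, v, s)" by (metis prod.exhaust)
    show "q \<in> dom d \<longleftrightarrow> q \<in> dom (f \<circ>\<^sub>m p1) \<inter> dom (f \<circ>\<^sub>m a)"
    proof (cases "q \<in> carrier ?B")
      case True
      then have "p1 q = Some x" "a q = Some (x \<oplus>\<^bsub>E\<^esub> s \<odot>\<^bsub>E\<^esub> v)" "v \<in> carrier E" "s \<in> carrier K"
        using q by (auto simp: p1 a)
      then show ?thesis unfolding dd unfolding q by (simp add: bracket1_def domIff)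
    next
      case False
      then have "p1 q = None" using q by (simp add: p1)
      moreover have "q \<notin> bracket1 K E (dom f)" using bracket1_carrier[OF dE] False by blast
      ultimately show ?thesis unfolding dd by (simp add: domIff)
    qed
  qed
  have le: "g \<subseteq>\<^sub>m f \<circ>\<^sub>m a"
    unfolding map_le_def
  proof
    fix q assume q': "q \<in> dom g"
    obtain x v s where q: "q = (x, v, s)" by (metis prod.exhaust)
    have "q \<in> dom d" using q' by (auto simp: g_def map_comp_def ppair_def split: option.splits)
    then have b: "(x, v, s) \<in> bracket1 K E (dom f)" using dd q by simp
    then have c: "(x, v, s) \<in> carrier ?B" and dm: "x \<in> dom f" "x \<oplus>\<^bsub>E\<^esub> s \<odot>\<^bsub>E\<^esub> v \<in> dom f" using dE by (auto simp: bracket1_def)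
    obtain y' where d': "d (x, v, s) = Some y'" using \<open>q \<in> dom d\<close> q by auto
    have y': "y' \<in> carrier F" by (rule subsetD[OF sm_ran[OF B F dq(2)] ranI[of d, OF d']])
    obtain b' where b': "f x = Some b'" using dm by auto
    have "g q = Some (b' \<oplus>\<^bsub>F\<^esub> s \<odot>\<^bsub>F\<^esub> y')"
      using c d' y' b' by (simp add: g_def q p1 p3_def smul_def map_comp_def ppair_def)
    then have "g q = Some (the (f x) \<oplus>\<^bsub>F\<^esub> s \<odot>\<^bsub>F\<^esub> the (d (x, v, s)))" using d' b' by simp
    moreover have "(f \<circ>\<^sub>m a) q = Some (the (f (x \<oplus>\<^bsub>E\<^esub> s \<odot>\<^bsub>E\<^esub> v)))"
      using c dm by (auto simp: q a map_comp_def)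
    ultimately show "g q = (f \<circ>\<^sub>m a) q"
      using diff_quot_formula[OF E F sm_continuous[OF E f] dq(1) b] by simp
  qed
  have h: "h p = T ks ?B F d (zip3 p)" if "p \<in> carrier ?BA" for p
    using that by (simp only: h_def d_def[symmetric] map_comp_pfun if_True)
  have Tp: "T ks ?B E p1 (zip3 (x, v, s)) = Some x" "T ks ?B E p2 (zip3 (x, v, s)) = Some v"
    "T ks ?B Kr p3 (zip3 (x, v, s)) = Some s" "T ks ?B E a (zip3 (x, v, s)) = Some (x \<oplus>\<^bsub>VA E\<^esub> s \<odot>\<^bsub>VA E\<^esub> v)"
    if p: "(x, v, s) \<in> carrier ?BA" for x v s
  proof -
    note z = zip3_closed[OF p] and c = cmap_zip3[OF p]
    show 1: "T ks ?B E p1 (zip3 (x, v, s)) = Some x" and 2: "T ks ?B E p2 (zip3 (x, v, s)) = Some v"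
      and 3: "T ks ?B Kr p3 (zip3 (x, v, s)) = Some s"
      unfolding p1_def p2_def p3_def
      using T_pfun[OF ks B E lin_fst z] T_pfun[OF ks B E lin_fst_snd z] T_pfun[OF ks B tm_regular lin_snd_snd z]
      unfolding c .
    show "T ks ?B E a (zip3 (x, v, s)) = Some (x \<oplus>\<^bsub>VA E\<^esub> s \<odot>\<^bsub>VA E\<^esub> v)"
      unfolding a_def cube_module_simps smult_cube_module
      by (rule T_add_ppair[OF ks B E S(1) sm_scaled[OF B E S(3,2)] 1 T_smul_ppair[OF ks B E S(3,2) 3 2]])
  qed
  have Tf: "T ks ?B F (f \<circ>\<^sub>m p1) (zip3 (x, v, s)) = T ks E F f x"
    "T ks ?B F (f \<circ>\<^sub>m a) (zip3 (x, v, s)) = T ks E F f (x \<oplus>\<^bsub>VA E\<^esub> s \<odot>\<^bsub>VA E\<^esub> v)"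
    if p: "(x, v, s) \<in> carrier ?BA" for x v s
    unfolding T_comp[OF ks B E F S(1) f] T_comp[OF ks B E F sa f] using Tp(1,4)[OF p] by (simp_all only: map_comp_simps(2))
  have dT: "z \<in> dom (T ks ?B F d) \<longleftrightarrow> z \<in> dom (T ks ?B F (f \<circ>\<^sub>m p1)) \<and> z \<in> dom (T ks ?B F (f \<circ>\<^sub>m a))" for z
    unfolding dom_T[OF ks B F sm_dom[OF dq(2)]] dom_T[OF ks B F sm_dom[OF sf1]] dom_T[OF ks B F sm_dom[OF sfa]] d1 by auto
  have dTf: "dom (T ks E F f) \<subseteq> carrier (VA E)" unfolding cube_module_simps by (rule sm_dom[OF sm_T[OF ks E F f]])
  have dh: "dom h = bracket1 KA (VA E) (dom (T ks E F f))"
  proof (rule Set.set_eqI)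
    fix q :: "(nat set \<Rightarrow> 'e) \<times> (nat set \<Rightarrow> 'e) \<times> (nat set \<Rightarrow> 'k)"
    obtain x v s where q: "q = (x, v, s)" by (metis prod.exhaust)
    show "q \<in> dom h \<longleftrightarrow> q \<in> bracket1 KA (VA E) (dom (T ks E F f))"
    proof (cases "q \<in> carrier ?BA")
      case True
      then have c: "v \<in> carrier (VA E)" "s \<in> carrier KA" using q by (simp_all del: cube_module_simps cube_ring_simps)
      have "q \<in> dom h \<longleftrightarrow> zip3 q \<in> dom (T ks ?B F d)" using h[OF True] by (simp only: domIff)
      also have "\<dots> \<longleftrightarrow> x \<in> dom (T ks E F f) \<and> x \<oplus>\<^bsub>VA E\<^esub> s \<odot>\<^bsub>VA E\<^esub> v \<in> dom (T ks E F f)"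
        using dT[of "zip3 q"] unfolding domIff q Tf[OF True[unfolded q]] .
      also have "\<dots> \<longleftrightarrow> q \<in> bracket1 KA (VA E) (dom (T ks E F f))"
        unfolding q bracket1_def using c by blast
      finally show ?thesis .
    next
      case False
      then have "h q = None" by (simp only: h_def map_comp_pfun if_False)
      moreover have "q \<notin> bracket1 KA (VA E) (dom (T ks E F f))" using bracket1_carrier[OF dTf] False by blast
      ultimately show ?thesis by (simp add: domIff)
    qed
  qed
  show ?thesis
    unfolding is_diff_quot_def
  proof (intro conjI allI impI dh)
    have BA: "topological_module KA ?BA" by (rule topological_module_bracket[OF tm_VA[OF E] H_KA])
    have "continuous_partial (mtop (VA ?B)) (mtop (VA F)) (T ks ?B F d)"
      using sm_continuous[OF tm_cube[OF B] sm_T[OF ks B F dq(2)]] unfolding cube_module_simps .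
    then show "continuous_partial (mtop ?BA) (mtop (VA F)) h"
      unfolding h_def d_def[symmetric] by (rule continuous_partial_precomp[OF BA lin_aff[OF zip3_lin[OF E]]])
    fix x v s assume A: "(x, v, s) \<in> bracket1 KA (VA E) (dom (T ks E F f)) \<and> s \<in> Units KA"
    then have p: "(x, v, s) \<in> carrier ?BA" using bracket1_carrier[OF dTf] by blast
    have zd: "zip3 (x, v, s) \<in> dom (T ks ?B F d)"
      using A h[OF p] unfolding dh[symmetric] by (metis domIff)
    then obtain y where y: "T ks ?B F d (zip3 (x, v, s)) = Some y" by auto
    have yc: "y \<in> carrier (VA F)"
      using dom_T_closed(2)[OF ks B F dq(2) zd] y unfolding cube_module_simps by simp
    obtain b where b: "T ks E F f x = Some b" using A by (auto simp: bracket1_def)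
    have bc: "b \<in> carrier (VA F)"
      using dom_T_closed(2)[OF ks E F f, of x] b unfolding cube_module_simps by auto
    have "T ks ?B F g (zip3 (x, v, s)) = Some (b \<oplus>\<^bsub>VA F\<^esub> s \<odot>\<^bsub>VA F\<^esub> y)"
      unfolding g_def cube_module_simps smult_cube_module
      by (rule T_add_ppair[OF ks B F sf1 sm_scaled[OF B F S(3) dq(2)] _ T_smul_ppair[OF ks B F S(3) dq(2) Tp(3)[OF p] y]])
        (simp only: Tf[OF p] b)
    then have "T ks ?B F (f \<circ>\<^sub>m a) (zip3 (x, v, s)) = Some (b \<oplus>\<^bsub>VA F\<^esub> s \<odot>\<^bsub>VA F\<^esub> y)"
      using T_mono[OF ks B F sg sfa le] by (rule map_leD[rotated])
    then have e: "T ks E F f (x \<oplus>\<^bsub>VA E\<^esub> s \<odot>\<^bsub>VA E\<^esub> v) = Some (b \<oplus>\<^bsub>VA F\<^esub> s \<odot>\<^bsub>VA F\<^esub> y)"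
      unfolding Tf(2)[OF p] .
    have s: "s \<in> carrier KA" "s \<in> Units KA"
      using A p by (simp_all only: prod_module_simps regular_module_simps mem_Sigma_iff)
    have "(b \<oplus>\<^bsub>VA F\<^esub> s \<odot>\<^bsub>VA F\<^esub> y) \<ominus>\<^bsub>VA F\<^esub> b = s \<odot>\<^bsub>VA F\<^esub> y"
      by (rule FA.M.add_minus_cancel_left[OF bc FA.smult_closed[OF s(1) yc]])
    then have "inv\<^bsub>KA\<^esub> s \<odot>\<^bsub>VA F\<^esub> ((b \<oplus>\<^bsub>VA F\<^esub> s \<odot>\<^bsub>VA F\<^esub> y) \<ominus>\<^bsub>VA F\<^esub> b) = y"
      using s yc by (simp only: FA.smult_assoc1[symmetric] FA.Units_inv_closed FA.Units_l_inv FA.smult_one)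
    then show "h (x, v, s) = Some (inv\<^bsub>KA\<^esub> s \<odot>\<^bsub>VA F\<^esub>
      (the (T ks E F f (x \<oplus>\<^bsub>VA E\<^esub> s \<odot>\<^bsub>VA E\<^esub> v)) \<ominus>\<^bsub>VA F\<^esub> the (T ks E F f x)))"
      unfolding h[OF p] y e b option.sel by simp
  qed
qed

text \<open>The renaming changes \<open>T f\<close> by a coordinatewise isomorphism, and this is linear over \<open>K^A\<close>.\<close>

lemma T_relabel:
  assumes E: "topological_module K E" and F: "topological_module K F" and i: "inj_on i (carrier E)" and f: "sm E F f"
  shows "sm (relabel_module i E) F (relabel_dom (carrier E) i f)"
    and "cls n KA (VA (relabel_module i E)) (VA F) (T ks (relabel_module i E) F (relabel_dom (carrier E) i f)) \<Longrightarrow>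
      cls n KA (VA E) (VA F) (T ks E F f)"
proof -
  note N = relabel_module_iso[OF E i]
  let ?N = "relabel_module i E" and ?f = "relabel_dom (carrier E) i f"
  show s: "sm ?N F ?f" using f cls_relabel[OF E H i sm_dom[OF f]] by (simp add: sm_def)
  have "f = ?f \<circ>\<^sub>m pfun (carrier E) i" by (rule relabel_dom_undo[OF i sm_dom[OF f], symmetric])
  then have "T ks E F f = T ks ?N F ?f \<circ>\<^sub>m pfun (carrier (CA E)) (cmap A i)"
    using T_comp[OF ks E N(1) F sm_pfun[OF E N(1) lin_aff[OF N(2)]] s] T_lin[OF ks E N(1,2)] by simp
  moreover assume "cls n KA (VA ?N) (VA F) (T ks ?N F ?f)"
  then have "cls n KA (VA E) (VA F) (T ks ?N F ?f \<circ>\<^sub>m pfun (carrier (VA E)) (cmap A i))"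
    by (rule cls_precomp[OF tm_VA[OF N(1)] tm_VA[OF E] H_KA lin_aff[OF cmap_lin_KA[OF E N(1,2)]]])
  ultimately show "cls n KA (VA E) (VA F) (T ks E F f)" by simp
qed

text \<open>Trees are used only to keep the type fixed while \<open>f\<close> is replaced by \<open>f^[1]\<close>.\<close>

lemma cls_T_tup:
  fixes E :: "('k, ('e, 'k) tup) top_module"
  assumes "topological_module K E" and F: "topological_module K F" and "sm E F f"
  shows "cls n KA (VA E) (VA F) (T ks E F f)"
  using assms(1,3)
proof (induction n arbitrary: E f)
  case 0
  then show ?case
    using sm_continuous[OF tm_cube sm_T[OF ks _ F]] by (simp add: cls_0[OF tm_VA])
next
  case (Suc n)
  note E = Suc.prems(1) and f = Suc.prems(2)
  let ?B = "bracket_module K E" and ?BA = "bracket_module KA (VA E)"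
  note B = tm_bracket[OF E] and dq = sm_DQ[OF E F f] and BA = topological_module_bracket[OF tm_VA[OF E] H_KA]
  note N = relabel_module_iso[OF B inj_node]
  have "cls n KA (VA ?B) (VA F) (T ks ?B F (DQ E F f))"
    by (rule T_relabel(2)[OF B F inj_node dq(2)]) (rule Suc.IH[OF N(1) T_relabel(1)[OF B F inj_node dq(2)]])
  from cls_precomp[OF tm_VA[OF B] BA H_KA lin_aff[OF zip3_lin[OF E]] this]
  have "cls n KA ?BA (VA F) (T ks ?B F (DQ E F f) \<circ>\<^sub>m pfun (carrier ?BA) zip3)" .
  moreover have "continuous_partial (mtop (VA E)) (mtop (VA F)) (T ks E F f)"
    using sm_continuous[OF tm_cube[OF E] sm_T[OF ks E F f]] by simp
  ultimately show ?case
    unfolding cls_Suc[OF tm_VA[OF E] H_KA] using T_diff_quot[OF E F f] by blast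
qed

theorem cls_T:
  fixes E :: "('k, 'e) top_module"
  assumes E: "topological_module K E" and F: "topological_module K F" and f: "sm E F f"
  shows "cls n KA (VA E) (VA F) (T ks E F f)"
proof -
  let ?Leaf = "Leaf :: 'e \<Rightarrow> ('e, 'k) tup"
  have i: "inj_on ?Leaf (carrier E)" by simp
  show ?thesis
    by (rule T_relabel(2)[OF E F i f cls_T_tup[OF relabel_module_iso(1)[OF E i] F T_relabel(1)[OF E F i f]]])
qed

end

section \<open>Charts\<close>

definition pinj :: "('a \<rightharpoonup> 'b) \<Rightarrow> bool" where
  "pinj f \<longleftrightarrow> (\<forall>x y z. f x = Some z \<longrightarrow> f y = Some z \<longrightarrow> x = y)"

lemma pinv_eq_Some: "pinj f \<Longrightarrow> pinv f y = Some x \<longleftrightarrow> f x = Some y"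
proof -
  assume p: "pinj f"
  have e: "pinv f y = Some x'" if "f x' = Some y" for x'
  proof -
    have "(THE x. f x = Some y) = x'" using p that by (intro the_equality) (auto simp: pinj_def)
    then show ?thesis using that by (auto simp: pinv_def ran_def)
  qed
  show ?thesis
  proof
    assume "pinv f y = Some x"
    then have "y \<in> ran f" by (auto simp: pinv_def split: if_splits)
    then obtain x' where "f x' = Some y" by (auto simp: ran_def)
    then show "f x = Some y" using e \<open>pinv f y = Some x\<close> by force
  qed (rule e)
qed

lemma pinv_eqI: "(\<And>x y. f x = Some y \<longleftrightarrow> g y = Some x) \<Longrightarrow> pinv f = g"
proof
  fix y assume a: "\<And>x y. f x = Some y \<longleftrightarrow> g y = Some x"
  then have "pinj f" unfolding pinj_def by (metis option.inject)
  then show "pinv f y = g y" using pinv_eq_Some[of f y] a by (metis not_None_eq)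
qed

lemma dom_pinv [simp]: "dom (pinv f) = ran f"
  by (auto simp: pinv_def split: if_splits)

text \<open>A symmetric description of charts: besides injectivity, only continuity in both directions has to be checked.\<close>

lemma is_chart_iff:
  "is_chart E X \<phi> \<longleftrightarrow> pinj \<phi> \<and> continuous_partial X (mtop E) \<phi> \<and> continuous_partial (mtop E) X (pinv \<phi>)" (is "_ \<longleftrightarrow> ?R")
proof
  assume L: "is_chart E X \<phi>"
  then have o: "openin X (dom \<phi>)" "openin (mtop E) (ran \<phi>)"
    and h: "homeomorphic_map (subtopology X (dom \<phi>)) (subtopology (mtop E) (ran \<phi>)) (the \<circ> \<phi>)"
    by (auto simp: is_chart_def)
  have d: "topspace (subtopology X (dom \<phi>)) = dom \<phi>" "topspace (subtopology (mtop E) (ran \<phi>)) = ran \<phi>"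
    using openin_subset[OF o(1)] openin_subset[OF o(2)] by auto
  obtain g where g: "homeomorphic_maps (subtopology X (dom \<phi>)) (subtopology (mtop E) (ran \<phi>)) (the \<circ> \<phi>) g"
    using h homeomorphic_map_maps by blast
  then have c: "continuous_map (subtopology X (dom \<phi>)) (mtop E) (the \<circ> \<phi>)"
    "continuous_map (subtopology (mtop E) (ran \<phi>)) X g"
    and gi: "\<And>x. x \<in> dom \<phi> \<Longrightarrow> g (the (\<phi> x)) = x"
    unfolding homeomorphic_maps_def d by (auto simp: continuous_map_in_subtopology)
  have p: "pinj \<phi>" unfolding pinj_def using gi by (metis domI option.sel)
  have "(the \<circ> pinv \<phi>) y = g y" if y: "y \<in> ran \<phi>" for y
  proof -
    obtain x where x: "\<phi> x = Some y" using y by (auto simp: ran_def)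
    then have "pinv \<phi> y = Some x" using p by (simp add: pinv_eq_Some)
    then show ?thesis using x gi[of x] by force
  qed
  then have "continuous_map (subtopology (mtop E) (ran \<phi>)) X (the \<circ> pinv \<phi>)"
    using continuous_map_eq[OF c(2), unfolded d] by metis
  then show ?R using p o c by (simp add: continuous_partial_def)
next
  assume R: ?R
  then have p: "pinj \<phi>" by simp
  have o: "openin X (dom \<phi>)" "openin (mtop E) (ran \<phi>)" using R by (auto simp: continuous_partial_def)
  have d: "topspace (subtopology X (dom \<phi>)) = dom \<phi>" "topspace (subtopology (mtop E) (ran \<phi>)) = ran \<phi>"
    using openin_subset[OF o(1)] openin_subset[OF o(2)] by auto
  have c: "continuous_map (subtopology X (dom \<phi>)) (mtop E) (the \<circ> \<phi>)"
    "continuous_map (subtopology (mtop E) (ran \<phi>)) X (the \<circ> pinv \<phi>)"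
    using R by (auto simp: continuous_partial_def)
  have "homeomorphic_maps (subtopology X (dom \<phi>)) (subtopology (mtop E) (ran \<phi>)) (the \<circ> \<phi>) (the \<circ> pinv \<phi>)"
    unfolding homeomorphic_maps_def d continuous_map_in_subtopology
  proof (intro conjI c ballI funcsetI)
    fix x assume "x \<in> dom \<phi>"
    then obtain y where y: "\<phi> x = Some y" by auto
    then have "pinv \<phi> y = Some x" using p by (simp add: pinv_eq_Some)
    then show "(the \<circ> \<phi>) x \<in> ran \<phi>" "(the \<circ> pinv \<phi>) ((the \<circ> \<phi>) x) = x" using y by (auto intro: ranI)
  next
    fix y assume "y \<in> ran \<phi>"
    then obtain x where x: "\<phi> x = Some y" by (auto simp: ran_def)
    then have "pinv \<phi> y = Some x" using p by (simp add: pinv_eq_Some)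
    then show "(the \<circ> pinv \<phi>) y \<in> dom \<phi>" "(the \<circ> \<phi>) ((the \<circ> pinv \<phi>) y) = y" using x by auto
  qed
  then show "is_chart E X \<phi>"
    using o homeomorphic_map_maps unfolding is_chart_def by blast
qed

definition trans_map :: "('i, 'p, 'e) charted \<Rightarrow> 'i \<Rightarrow> 'i \<Rightarrow> ('e \<rightharpoonup> 'e)" where
  "trans_map M i j = chart M i \<circ>\<^sub>m pinv (chart M j)"

definition local_map :: "('i, 'p, 'e) charted \<Rightarrow> ('j, 'q, 'f) charted \<Rightarrow> ('p \<rightharpoonup> 'q) \<Rightarrow> 'j \<Rightarrow> 'i \<Rightarrow> ('e \<rightharpoonup> 'f)" where
  "local_map M N f j i = chart N j \<circ>\<^sub>m f \<circ>\<^sub>m pinv (chart M i)"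

lemma map_comp_eq_Some: "(f \<circ>\<^sub>m g) x = Some z \<longleftrightarrow> (\<exists>y. g x = Some y \<and> f y = Some z)"
  by (auto simp: map_comp_def split: option.splits)

lemma map_eqI: "(\<And>x y. f x = Some y \<longleftrightarrow> g x = Some y) \<Longrightarrow> f = g"
  by (rule ext) (metis not_None_eq)

lemma map_leI: "(\<And>x y. f x = Some y \<Longrightarrow> g x = Some y) \<Longrightarrow> f \<subseteq>\<^sub>m g"
  by (auto simp: map_le_def)

context good_ring begin

text \<open>An atlas of smooth transition maps, with indexed charts; maximality would be lost under \<open>M \<mapsto> M_t\<close>.\<close>

definition good_charted :: "('k, 'e) top_module \<Rightarrow> ('i, 'p, 'e) charted \<Rightarrow> bool" where
  "good_charted E M \<longleftrightarrow> topological_module K E \<and> (\<forall>i\<in>index M. is_chart E (points M) (chart M i)) \<and>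
     (\<Union>i\<in>index M. dom (chart M i)) = topspace (points M) \<and>
     (\<forall>i\<in>index M. \<forall>j\<in>index M. sm E E (trans_map M i j))"

definition good_map :: "('k, 'e) top_module \<Rightarrow> ('i, 'p, 'e) charted \<Rightarrow> ('k, 'f) top_module \<Rightarrow> ('j, 'q, 'f) charted \<Rightarrow>
    ('p \<rightharpoonup> 'q) \<Rightarrow> bool" where
  "good_map E M F N f \<longleftrightarrow> continuous_partial (points M) (points N) f \<and>
     (\<forall>i\<in>index M. \<forall>j\<in>index N. sm E F (local_map M N f j i))"

lemma good_chartedD:
  assumes "good_charted E M"
  shows "topological_module K E" and "i \<in> index M \<Longrightarrow> pinj (chart M i)"
    and "i \<in> index M \<Longrightarrow> continuous_partial (points M) (mtop E) (chart M i)"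
    and "i \<in> index M \<Longrightarrow> continuous_partial (mtop E) (points M) (pinv (chart M i))"
    and "(\<Union>i\<in>index M. dom (chart M i)) = topspace (points M)"
    and "i \<in> index M \<Longrightarrow> j \<in> index M \<Longrightarrow> sm E E (trans_map M i j)"
  using assms by (auto simp: good_charted_def is_chart_iff)

lemma trans_map_eq_Some:
  assumes "good_charted E M" "j \<in> index M"
  shows "trans_map M i j y = Some z \<longleftrightarrow> (\<exists>p. chart M j p = Some y \<and> chart M i p = Some z)"
  using good_chartedD(2)[OF assms] by (auto simp: trans_map_def map_comp_eq_Some pinv_eq_Some)

lemma local_map_eq_Some:
  assumes "good_charted E M" "i \<in> index M"
  shows "local_map M N f j i y = Some z \<longleftrightarrow> (\<exists>p q. chart M i p = Some y \<and> f p = Some q \<and> chart N j q = Some z)"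
  using good_chartedD(2)[OF assms] by (auto simp: local_map_def map_comp_eq_Some pinv_eq_Some)

section \<open>Renaming of points and of model spaces\<close>

text \<open>The second half of each step of the iteration: after the passage to \<open>M_t\<close>, points and model space are moved
  back into a fixed type.\<close>

lemma good_charted_relabel:
  assumes M: "good_charted E M" and h: "inj_on h (topspace (points M))"
    and E': "topological_module K E'" and c: "lin K E E' c" and c': "lin K E' E c'"
    and c'c: "\<And>x. x \<in> carrier E \<Longrightarrow> c' (c x) = x" and cc': "\<And>y. y \<in> carrier E' \<Longrightarrow> c (c' y) = y"
  shows "good_charted E' (relabel_charted h c M)"
    and "j \<in> index M \<Longrightarrow> trans_map (relabel_charted h c M) i j = conj_map (carrier E') c' c (trans_map M i j)"
proof -
  note E = good_chartedD(1)[OF M] and cl = lin_closed[OF E E' c] and cl' = lin_closed[OF E' E c']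
  let ?M = "relabel_charted h c M" and ?X = "topspace (points M)" and ?g = "inv_into (topspace (points M)) h"
  have dX: "dom (chart M i) \<subseteq> ?X" and rE: "ran (chart M i) \<subseteq> carrier E" if "i \<in> index M" for i
    using good_chartedD(3)[OF M that] topological_moduleD(3)[OF E] by (auto simp: continuous_partial_iff)
  have ch: "chart ?M i = map_option c \<circ> (chart M i \<circ>\<^sub>m pfun (h ` ?X) ?g)" for i
    by (simp add: relabel_charted_def relabel_dom_pfun)
  have ch_iff: "chart ?M i y = Some z \<longleftrightarrow> (\<exists>x w. x \<in> ?X \<and> y = h x \<and> chart M i x = Some w \<and> z = c w)" for i y z
  proof (cases "y \<in> h ` ?X")
    case True
    then obtain x where x: "x \<in> ?X" "y = h x" by auto
    then have "?g y = x" using h by simp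
    then show ?thesis using x h True by (auto simp: ch map_comp_pfun inj_on_def)
  qed (auto simp: ch map_comp_pfun)
  have pv: "pinv (chart ?M i) = map_option h \<circ> (pinv (chart M i) \<circ>\<^sub>m pfun (carrier E') c')" if i: "i \<in> index M" for i
  proof (rule pinv_eqI)
    fix y z
    show "chart ?M i y = Some z \<longleftrightarrow> (map_option h \<circ> (pinv (chart M i) \<circ>\<^sub>m pfun (carrier E') c')) z = Some y"
    proof
      assume "chart ?M i y = Some z"
      then obtain x w where x: "x \<in> ?X" "y = h x" "chart M i x = Some w" "z = c w" unfolding ch_iff by blast
      then have "w \<in> carrier E" using rE[OF i] ranI[of "chart M i"] by blast
      then show "(map_option h \<circ> (pinv (chart M i) \<circ>\<^sub>m pfun (carrier E') c')) z = Some y"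
        using x cl c'c good_chartedD(2)[OF M i] by (auto simp: map_comp_pfun pinv_eq_Some)
    next
      assume "(map_option h \<circ> (pinv (chart M i) \<circ>\<^sub>m pfun (carrier E') c')) z = Some y"
      then obtain x where x: "z \<in> carrier E'" "pinv (chart M i) (c' z) = Some x" "y = h x"
        by (auto simp: map_comp_pfun split: if_splits)
      then have "chart M i x = Some (c' z)" using good_chartedD(2)[OF M i] by (simp add: pinv_eq_Some)
      then show "chart ?M i y = Some z" unfolding ch_iff using x cc'[OF x(1)] dX[OF i] by (metis domI subsetD)
    qed
  qed
  have hom: "homeomorphic_maps (points M) (points ?M) h ?g"
    using homeomorphic_maps_relabel_top[OF h] by (simp add: relabel_charted_def)
  have ts: "topspace (points ?M) = h ` ?X" using topspace_relabel_top[OF h] by (simp add: relabel_charted_def)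
  have ix: "index ?M = index M" by (simp add: relabel_charted_def)
  have tr: "trans_map ?M i j = conj_map (carrier E') c' c (trans_map M i j)" if j: "j \<in> index M" for i j
  proof (rule map_eqI)
    fix y z
    have "trans_map ?M i j y = Some z \<longleftrightarrow> (\<exists>x w. y \<in> carrier E' \<and> pinv (chart M j) (c' y) = Some x \<and> x \<in> ?X \<and> chart M i x = Some w \<and> z = c w)"
      using h dX[OF j] good_chartedD(2)[OF M j] unfolding trans_map_def map_comp_eq_Some pv[OF j] ch_iff
      by (auto simp: map_comp_pfun pinv_eq_Some inj_on_def split: if_splits)
    also have "\<dots> \<longleftrightarrow> conj_map (carrier E') c' c (trans_map M i j) y = Some z"
      using dX[OF j] good_chartedD(2)[OF M j] by (auto simp: conj_map_apply trans_map_def map_comp_eq_Some pinv_eq_Some)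
    finally show "trans_map ?M i j y = Some z \<longleftrightarrow> conj_map (carrier E') c' c (trans_map M i j) y = Some z" .
  qed
  then show "j \<in> index M \<Longrightarrow> trans_map ?M i j = conj_map (carrier E') c' c (trans_map M i j)" .
  show "good_charted E' ?M"
    unfolding good_charted_def ix is_chart_iff
  proof (intro conjI ballI E')
    fix i assume i: "i \<in> index M"
    show "pinj (chart ?M i)"
      unfolding pinj_def ch_iff using good_chartedD(2)[OF M i] rE[OF i] ranI[of "chart M i"] c'c
      unfolding pinj_def by (metis subsetD)
    have "continuous_partial (points ?M) (points M) (pfun (h ` ?X) ?g)"
      using continuous_partial_pfun[of "points ?M" "points M" ?g] hom ts by (auto simp: homeomorphic_maps_def)
    then show "continuous_partial (points ?M) (mtop E') (chart ?M i)"
      unfolding ch using c good_chartedD(3)[OF M i]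
      by (auto simp: lin_def intro!: continuous_partial_post[OF continuous_partial_comp])
    show "continuous_partial (mtop E') (points ?M) (pinv (chart ?M i))"
      unfolding pv[OF i] using hom good_chartedD(4)[OF M i]
      by (auto simp: homeomorphic_maps_def intro!: continuous_partial_post[OF continuous_partial_precomp[OF E' lin_aff[OF c']]])
  next
    show "(\<Union>i\<in>index M. dom (chart ?M i)) = topspace (points ?M)"
    proof (rule Set.set_eqI)
      fix y
      have "y \<in> (\<Union>i\<in>index M. dom (chart ?M i)) \<longleftrightarrow> (\<exists>i\<in>index M. \<exists>z. chart ?M i y = Some z)" by blast
      also have "\<dots> \<longleftrightarrow> (\<exists>x\<in>?X. y = h x \<and> (\<exists>i\<in>index M. \<exists>w. chart M i x = Some w))" unfolding ch_iff by blast
      also have "\<dots> \<longleftrightarrow> y \<in> topspace (points ?M)"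
        unfolding ts image_iff good_chartedD(5)[OF M, symmetric] by blast
      finally show "y \<in> (\<Union>i\<in>index M. dom (chart ?M i)) \<longleftrightarrow> y \<in> topspace (points ?M)" .
    qed
  next
    fix i j assume ij: "i \<in> index M" "j \<in> index M"
    show "sm E' E' (trans_map ?M i j)"
      unfolding tr[OF ij(2)] by (rule sm_conj_map[OF E' E E' E c' c good_chartedD(6)[OF M ij]])
  qed
qed

end

section \<open>The manifold \<open>M_t\<close>\<close>

lemma continuous_partial_openD:
  "continuous_partial S T f \<Longrightarrow> openin T W \<Longrightarrow> openin S {x \<in> dom f. the (f x) \<in> W}"
  by (simp add: continuous_partial_iff)

lemma dom_the_iff: "x \<in> dom f \<and> the (f x) \<in> W \<longleftrightarrow> (\<exists>y. f x = Some y \<and> y \<in> W)"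
  by auto

context good_ring begin

context
  fixes E :: "('k, 'e) top_module" and M :: "('i, 'p, 'e) charted" and s :: 'k
  assumes M: "good_charted E M" and s: "s \<in> carrier K"
begin

abbreviation (input) "Mt \<equiv> tmanifold K E s M"
abbreviation (input) "Q \<equiv> tunion E s M // tglue K E s M"
abbreviation (input) "cl i a \<equiv> tglue K E s M `` {(i, a)}"
abbreviation (input) "G i j \<equiv> tmap K E E s (trans_map M i j)"
abbreviation (input) "U i \<equiv> tset E s (ran (chart M i))"

lemma tmE: "topological_module K E" by (rule good_chartedD(1)[OF M])

lemma ran_carrier: "i \<in> index M \<Longrightarrow> ran (chart M i) \<subseteq> carrier E"
  using good_chartedD(3)[OF M] topological_moduleD(3)[OF tmE] by (auto simp: continuous_partial_iff)

lemma sm_trans: "i \<in> index M \<Longrightarrow> j \<in> index M \<Longrightarrow> sm E E (trans_map M i j)"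
  by (rule good_chartedD(6)[OF M])

lemma trans_dom_ran:
  assumes "i \<in> index M" "j \<in> index M" "trans_map M i j y = Some z"
  shows "y \<in> ran (chart M j)" "z \<in> ran (chart M i)"
  using assms trans_map_eq_Some[OF M assms(2)] by (auto intro: ranI)

lemma tmap_tset:
  assumes F: "topological_module K F" and F': "topological_module K F'" and f: "sm F F' f" and a: "tmap K F F' s f a = Some b"
    and A: "dom f \<subseteq> S" and B: "ran f \<subseteq> S'"
  shows "a \<in> tset F s S" and "b \<in> tset F' s S'"
proof -
  obtain x v y w where e: "a = (x, v)" "b = (y, w)" by (cases a; cases b)
  have "a \<in> dom (tmap K F F' s f)" using a by blast
  then show "a \<in> tset F s S" using A unfolding dom_tmap by (auto simp: tset_def)
  note ve = tmap_vertices[OF s F F' f a[unfolded e]]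
  show "b \<in> tset F' s S'" using ve B ranI[of f] unfolding e tset_def by blast
qed

lemma G_tset:
  assumes ij: "i \<in> index M" "j \<in> index M" and a: "G i j a = Some b"
  shows "a \<in> U j" "b \<in> U i"
proof -
  have "dom (trans_map M i j) \<subseteq> ran (chart M j)" using trans_dom_ran(1)[OF ij] by blast
  moreover have "ran (trans_map M i j) \<subseteq> ran (chart M i)" using trans_dom_ran(2)[OF ij] by (auto simp: ran_def)
  ultimately show "a \<in> U j" "b \<in> U i" using tmap_tset[OF tmE tmE sm_trans[OF ij] a] by blast+
qed

text \<open>The transition map from a chart to itself is a restriction of the identity, and functoriality keeps it so.\<close>

lemma G_refl:
  assumes i: "i \<in> index M" and a: "a \<in> U i"
  shows "G i i a = Some a"
proof -
  have t: "trans_map M i i y = Some z \<longleftrightarrow> y \<in> ran (chart M i) \<and> z = y" for y z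
    unfolding trans_map_eq_Some[OF M i] by (auto simp: ran_def)
  have id: "lin K E E id" by (simp add: lin_def)
  have "trans_map M i i \<subseteq>\<^sub>m pfun (carrier E) id"
    using ran_carrier[OF i] by (intro map_leI) (auto simp: t pfun_eq_Some)
  from tmap_mono[OF tmE tmE sm_trans[OF i i] sm_pfun[OF tmE tmE lin_aff[OF id]] this, of s]
  have le: "G i i \<subseteq>\<^sub>m pfun (carrier E \<times> carrier E) (\<lambda>p. (id (fst p), id (snd p)))"
    unfolding tmap_lin[OF s tmE tmE id] .
  have "dom (trans_map M i i) = ran (chart M i)" using t by blast
  then have "a \<in> dom (G i i)" using a by simp
  then obtain b where b: "G i i a = Some b" by blast
  from map_leD[OF le b] show ?thesis unfolding b by (simp add: pfun_eq_Some)
qed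

text \<open>The cocycle condition passes to the maps \<open>(\<phi>_ij)_t\<close> by functoriality and monotonicity.\<close>

lemma G_trans:
  assumes i: "i \<in> index M" and j: "j \<in> index M" and k: "k \<in> index M"
    and ab: "G i j a = Some b" and bc: "G k i b = Some c"
  shows "G k j a = Some c"
proof -
  have le: "trans_map M k i \<circ>\<^sub>m trans_map M i j \<subseteq>\<^sub>m trans_map M k j"
  proof (rule map_leI)
    fix y z assume "(trans_map M k i \<circ>\<^sub>m trans_map M i j) y = Some z"
    then show "trans_map M k j y = Some z"
      using good_chartedD(2)[OF M i] unfolding map_comp_eq_Some trans_map_eq_Some[OF M i] trans_map_eq_Some[OF M j] pinj_def
      by metis
  qed
  have "(G k i \<circ>\<^sub>m G i j) a = Some c" using ab bc by (simp add: map_comp_eq_Some)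
  then have "tmap K E E s (trans_map M k i \<circ>\<^sub>m trans_map M i j) a = Some c"
    using tmap_comp[OF s tmE tmE tmE sm_trans[OF i j] sm_trans[OF k i]] by simp
  then show ?thesis
    using map_leD[OF tmap_mono[OF tmE tmE sm_comp[OF tmE tmE tmE sm_trans[OF i j] sm_trans[OF k i]] sm_trans[OF k j] le]] by blast
qed

text \<open>A point in the image of \<open>(\<phi>_ij)_t\<close> has its vertices in the image of \<open>\<phi>_ij\<close>, which is the domain of \<open>\<phi>_ji\<close>.\<close>

lemma G_sym:
  assumes i: "i \<in> index M" and j: "j \<in> index M" and ab: "G i j a = Some b"
  shows "G j i b = Some a"
proof -
  have "ran (trans_map M i j) \<subseteq> dom (trans_map M j i)"
  proof
    fix z assume "z \<in> ran (trans_map M i j)"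
    then obtain y p where "chart M j p = Some y" "chart M i p = Some z"
      using trans_map_eq_Some[OF M j] by (auto simp: ran_def)
    then show "z \<in> dom (trans_map M j i)" using trans_map_eq_Some[OF M i, of j z y] by blast
  qed
  then have "b \<in> tset E s (dom (trans_map M j i))"
    using tmap_tset(2)[OF tmE tmE sm_trans[OF i j] ab] by blast
  then obtain c where c: "G j i b = Some c" using dom_tmap by (metis domD)
  then have "G j j a = Some c" using G_trans[OF i j j ab] by blast
  then have "c = a" using G_refl[OF j] G_tset(1)[OF i j ab] by simp
  then show ?thesis using c by simp
qed

lemma tunion_iff: "(i, a) \<in> tunion E s M \<longleftrightarrow> i \<in> index M \<and> a \<in> U i"
  by (simp add: tunion_def)

lemma tglue_iff: "((j, a), (i, b)) \<in> tglue K E s M \<longleftrightarrow> i \<in> index M \<and> j \<in> index M \<and> G i j a = Some b"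
  unfolding tglue_def trans_map_def[symmetric] mem_Collect_eq case_prod_conv tunion_iff using G_tset by blast

lemma in_cl: "(i, b) \<in> cl j a \<longleftrightarrow> i \<in> index M \<and> j \<in> index M \<and> G i j a = Some b"
  by (simp add: tglue_iff)

lemma equiv_tglue: "equiv (tunion E s M) (tglue K E s M)"
proof (rule equivI)
  show "tglue K E s M \<subseteq> tunion E s M \<times> tunion E s M" by (auto simp: tglue_def)
  show "refl_on (tunion E s M) (tglue K E s M)"
    by (auto simp: refl_on_def tglue_iff tunion_iff G_refl)
  show "sym (tglue K E s M)"
  proof (rule symI)
    fix p q assume pq: "(p, q) \<in> tglue K E s M"
    obtain i a j b where e: "p = (i, a)" "q = (j, b)" by (cases p; cases q) blast
    show "(q, p) \<in> tglue K E s M" using pq G_sym[of j i a b] unfolding e tglue_iff by blast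
  qed
  show "trans (tglue K E s M)"
  proof (rule transI)
    fix p q r assume pq: "(p, q) \<in> tglue K E s M" "(q, r) \<in> tglue K E s M"
    obtain i a j b k c where e: "p = (i, a)" "q = (j, b)" "r = (k, c)" by (cases p; cases q; cases r) blast
    show "(p, r) \<in> tglue K E s M" using pq G_trans[of j i k a b c] unfolding e tglue_iff by blast
  qed
qed

lemma Q_iff: "c \<in> Q \<longleftrightarrow> (\<exists>i a. i \<in> index M \<and> a \<in> U i \<and> c = cl i a)"
  unfolding quotient_def UN_iff singleton_iff Bex_def split_paired_Ex tunion_iff by blast

lemma cl_eq:
  assumes c: "c \<in> Q" and "(i, a) \<in> c"
  shows "c = cl i a" "i \<in> index M" "a \<in> U i"
proof -
  have "(i, a) \<in> tunion E s M" using assms Union_quotient[OF equiv_tglue] by blast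
  then show "i \<in> index M" "a \<in> U i" by (auto simp: tunion_iff)
  obtain p where p: "c = tglue K E s M `` {p}" using c by (rule quotientE)
  then have "(p, (i, a)) \<in> tglue K E s M" using assms(2) by blast
  then show "c = cl i a" unfolding p by (rule equiv_class_eq[OF equiv_tglue])
qed

lemma cl_in_Q: "i \<in> index M \<Longrightarrow> a \<in> U i \<Longrightarrow> cl i a \<in> Q"
  unfolding Q_iff by blast

lemma in_cl_self: "i \<in> index M \<Longrightarrow> a \<in> U i \<Longrightarrow> (i, a) \<in> cl i a"
  unfolding in_cl using G_refl by blast

text \<open>A chart of \<open>M_t\<close> is single valued because \<open>(\<phi>_ii)_t\<close> is the identity.\<close>

lemma in_cl_unique: "c \<in> Q \<Longrightarrow> (i, a) \<in> c \<Longrightarrow> (i, b) \<in> c \<Longrightarrow> a = b"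
proof -
  assume c: "c \<in> Q" "(i, a) \<in> c" "(i, b) \<in> c"
  note e = cl_eq[OF c(1,2)]
  have "G i i a = Some b" using c(3) e(1) in_cl by blast
  then show ?thesis using G_refl[OF e(2,3)] by simp
qed

lemma index_Mt [simp]: "index Mt = index M"
  by (simp add: tmanifold_def Let_def)

lemma chart_Mt: "chart Mt i c = Some a \<longleftrightarrow> c \<in> Q \<and> (i, a) \<in> c"
proof -
  have "(THE a. (i, a) \<in> c) = a" if "c \<in> Q" "(i, a) \<in> c" for a
    using that in_cl_unique by (intro the_equality) blast+
  note the = this
  have e: "chart Mt i c = (if c \<in> Q \<and> (\<exists>a. (i, a) \<in> c) then Some (THE a. (i, a) \<in> c) else None)"
    unfolding tmanifold_def Let_def charted.simps ..
  show ?thesis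
  proof
    assume a: "chart Mt i c = Some a"
    then have Q: "c \<in> Q" and "\<exists>a. (i, a) \<in> c" unfolding e by (metis option.distinct(1))+
    then obtain b where b: "(i, b) \<in> c" by (elim exE)
    have "chart Mt i c = Some b" unfolding e using Q b the[OF Q b] by (simp only: if_True simp_thms) (metis b)
    then show "c \<in> Q \<and> (i, a) \<in> c" using a b Q by simp
  next
    assume a: "c \<in> Q \<and> (i, a) \<in> c"
    then have "\<exists>a. (i, a) \<in> c" by (intro exI) (erule conjunct2)
    then show "chart Mt i c = Some a" unfolding e using a the[of a] by (simp only: if_True simp_thms)
  qed
qed

lemma chart_Mt': "chart Mt i c = Some a \<longleftrightarrow> i \<in> index M \<and> a \<in> U i \<and> c = cl i a"
proof
  assume "chart Mt i c = Some a"
  then have "c \<in> Q" "(i, a) \<in> c" unfolding chart_Mt by simp_all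
  then show "i \<in> index M \<and> a \<in> U i \<and> c = cl i a" using cl_eq by (intro conjI)
next
  assume a: "i \<in> index M \<and> a \<in> U i \<and> c = cl i a"
  then show "chart Mt i c = Some a" unfolding chart_Mt using cl_in_Q[of i a] in_cl_self[of i a] by simp
qed

lemma pinv_chart_Mt: "pinv (chart Mt i) a = Some c \<longleftrightarrow> i \<in> index M \<and> a \<in> U i \<and> c = cl i a"
proof -
  have "pinj (chart Mt i)" unfolding pinj_def chart_Mt' by blast
  then show ?thesis by (simp only: pinv_eq_Some chart_Mt')
qed

lemma open_U: "i \<in> index M \<Longrightarrow> openin (mtop (prod_module E E)) (U i)"
proof -
  assume i: "i \<in> index M"
  have "dom (trans_map M i i) = ran (chart M i)" using trans_map_eq_Some[OF M i, of i] by (force simp: ran_def dom_def)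
  then have "dom (G i i) = U i" by simp
  then show ?thesis using sm_continuous[OF tm_prod[OF tmE tmE] tmap_sm[OF s tmE tmE sm_trans[OF i i]]]
    unfolding continuous_partial_def by metis
qed

lemma openin_Mt: "openin (points Mt) W \<longleftrightarrow> W \<subseteq> Q \<and>
   (\<forall>i\<in>index M. openin (mtop (prod_module E E)) {a \<in> U i. cl i a \<in> W})"
proof -
  let ?o = "\<lambda>W. W \<subseteq> Q \<and> (\<forall>i\<in>index M. openin (mtop (prod_module E E)) {a \<in> U i. cl i a \<in> W})"
  have "istopology ?o"
    unfolding istopology_def
  proof (intro conjI allI impI ballI)
    fix S T assume o: "?o S" "?o T"
    then show "S \<inter> T \<subseteq> Q" by blast
    fix i assume "i \<in> index M"
    then have "openin (mtop (prod_module E E)) ({a \<in> U i. cl i a \<in> S} \<inter> {a \<in> U i. cl i a \<in> T})"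
      using o by (intro openin_Int) blast+
    moreover have "{a \<in> U i. cl i a \<in> S} \<inter> {a \<in> U i. cl i a \<in> T} = {a \<in> U i. cl i a \<in> S \<inter> T}" by blast
    ultimately show "openin (mtop (prod_module E E)) {a \<in> U i. cl i a \<in> S \<inter> T}" by simp
  next
    fix \<S> assume o: "\<forall>S\<in>\<S>. ?o S"
    then show "\<Union>\<S> \<subseteq> Q" by blast
    fix i assume "i \<in> index M"
    then have "openin (mtop (prod_module E E)) (\<Union>S\<in>\<S>. {a \<in> U i. cl i a \<in> S})"
      using o by (intro openin_Union) blast
    moreover have "(\<Union>S\<in>\<S>. {a \<in> U i. cl i a \<in> S}) = {a \<in> U i. cl i a \<in> \<Union>\<S>}" by blast
    ultimately show "openin (mtop (prod_module E E)) {a \<in> U i. cl i a \<in> \<Union>\<S>}" by simp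
  qed
  moreover have "points Mt = topology ?o" by (simp add: tmanifold_def Let_def)
  ultimately show ?thesis by (simp add: topology_inverse')
qed

lemma topspace_Mt: "topspace (points Mt) = Q"
proof
  have e: "{a \<in> U i. cl i a \<in> Q} = U i" if "i \<in> index M" for i using cl_in_Q[OF that] by blast
  have "openin (points Mt) Q" unfolding openin_Mt by (intro conjI ballI order_refl) (simp only: e open_U)
  then show "Q \<subseteq> topspace (points Mt)" by (rule openin_subset)
  show "topspace (points Mt) \<subseteq> Q" using openin_topspace[of "points Mt"] unfolding openin_Mt by blast
qed

text \<open>By construction of the gluing relation, the transition maps are \<open>(\<phi>_ij)_t\<close>, with the same domains.\<close>

lemma trans_map_Mt:
  assumes "i \<in> index M" "j \<in> index M"
  shows "trans_map Mt i j = G i j"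
proof (rule map_eqI)
  fix a b
  show "trans_map Mt i j a = Some b \<longleftrightarrow> G i j a = Some b"
    unfolding trans_map_def[of Mt] map_comp_eq_Some pinv_chart_Mt chart_Mt
    using assms in_cl cl_in_Q G_tset(1)[OF assms] by blast
qed

theorem good_charted_Mt: "good_charted (prod_module E E) Mt"
  unfolding good_charted_def index_Mt is_chart_iff
proof (intro conjI ballI)
  note EE = tm_prod[OF tmE tmE]
  show "topological_module K (prod_module E E)" by (rule EE)
  fix i assume i: "i \<in> index M"
  show "pinj (chart Mt i)" unfolding pinj_def chart_Mt' by blast
  have rU: "U i \<subseteq> carrier (prod_module E E)"
    using open_U[OF i] openin_subset topological_moduleD(3)[OF EE] by metis
  show "continuous_partial (points Mt) (mtop (prod_module E E)) (chart Mt i)"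
    unfolding continuous_partial_iff topspace_Mt topological_moduleD(3)[OF EE]
  proof (intro conjI allI impI)
    show "dom (chart Mt i) \<subseteq> Q" using chart_Mt by blast
    show "ran (chart Mt i) \<subseteq> carrier (prod_module E E)" using rU unfolding ran_def chart_Mt' by blast
    fix W assume W: "openin (mtop (prod_module E E)) W"
    show "openin (points Mt) {c \<in> dom (chart Mt i). the (chart Mt i c) \<in> W}"
      unfolding openin_Mt
    proof (intro conjI ballI)
      show "{c \<in> dom (chart Mt i). the (chart Mt i c) \<in> W} \<subseteq> Q" using chart_Mt by blast
      fix j assume j: "j \<in> index M"
      have e: "chart Mt i (cl j a) = Some b \<longleftrightarrow> G i j a = Some b" if "a \<in> U j" for a b
        unfolding chart_Mt using cl_in_Q[OF j that] in_cl i j by blast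
      have eq: "{a \<in> U j. cl j a \<in> {c \<in> dom (chart Mt i). the (chart Mt i c) \<in> W}} = {a \<in> dom (G i j). the (G i j a) \<in> W}"
      proof (rule Set.set_eqI)
        fix a
        have "a \<in> {a \<in> U j. cl j a \<in> {c \<in> dom (chart Mt i). the (chart Mt i c) \<in> W}}
            \<longleftrightarrow> a \<in> U j \<and> (\<exists>b. chart Mt i (cl j a) = Some b \<and> b \<in> W)"
          unfolding mem_Collect_eq dom_the_iff ..
        also have "\<dots> \<longleftrightarrow> (\<exists>b. G i j a = Some b \<and> b \<in> W)"
          using e G_tset(1)[OF i j] by blast
        also have "\<dots> \<longleftrightarrow> a \<in> {a \<in> dom (G i j). the (G i j a) \<in> W}"
          unfolding mem_Collect_eq dom_the_iff ..
        finally show "a \<in> {a \<in> U j. cl j a \<in> {c \<in> dom (chart Mt i). the (chart Mt i c) \<in> W}}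
            \<longleftrightarrow> a \<in> {a \<in> dom (G i j). the (G i j a) \<in> W}" .
      qed
      show "openin (mtop (prod_module E E)) {a \<in> U j. cl j a \<in> {c \<in> dom (chart Mt i). the (chart Mt i c) \<in> W}}"
        unfolding eq by (rule continuous_partial_openD[OF sm_continuous[OF EE tmap_sm[OF s tmE tmE sm_trans[OF i j]]] W])
    qed
  qed
  show "continuous_partial (mtop (prod_module E E)) (points Mt) (pinv (chart Mt i))"
    unfolding continuous_partial_iff topspace_Mt topological_moduleD(3)[OF EE]
  proof (intro conjI allI impI)
    have "a \<in> U i" if "a \<in> dom (pinv (chart Mt i))" for a
      using domD[OF that] unfolding pinv_chart_Mt by (elim exE conjE)
    then show "dom (pinv (chart Mt i)) \<subseteq> carrier (prod_module E E)" using rU by (meson subsetI subsetD)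
    show "ran (pinv (chart Mt i)) \<subseteq> Q"
    proof
      fix c assume "c \<in> ran (pinv (chart Mt i))"
      then obtain a where "pinv (chart Mt i) a = Some c" unfolding ran_def by (elim CollectE exE)
      then show "c \<in> Q" unfolding pinv_chart_Mt using cl_in_Q by (elim conjE) (simp only:)
    qed
    fix W assume "openin (points Mt) W"
    then have "openin (mtop (prod_module E E)) {a \<in> U i. cl i a \<in> W}" using i openin_Mt by blast
    moreover have "{a \<in> dom (pinv (chart Mt i)). the (pinv (chart Mt i) a) \<in> W} = {a \<in> U i. cl i a \<in> W}"
      unfolding dom_the_iff pinv_chart_Mt using i by blast
    ultimately show "openin (mtop (prod_module E E)) {a \<in> dom (pinv (chart Mt i)). the (pinv (chart Mt i) a) \<in> W}" by simp
  qed
next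
  show "(\<Union>i\<in>index M. dom (chart Mt i)) = topspace (points Mt)"
  proof (rule Set.set_eqI)
    fix c
    have "c \<in> (\<Union>i\<in>index M. dom (chart Mt i)) \<longleftrightarrow> (\<exists>i\<in>index M. \<exists>a. chart Mt i c = Some a)"
      by (simp only: UN_iff dom_def mem_Collect_eq not_None_eq)
    also have "\<dots> \<longleftrightarrow> c \<in> Q" unfolding chart_Mt' Q_iff by (simp only: Bex_def) metis
    finally show "c \<in> (\<Union>i\<in>index M. dom (chart Mt i)) \<longleftrightarrow> c \<in> topspace (points Mt)"
      unfolding topspace_Mt .
  qed
next
  fix i j assume ij: "i \<in> index M" "j \<in> index M"
  show "sm (prod_module E E) (prod_module E E) (trans_map Mt i j)"
    unfolding trans_map_Mt[OF ij] by (rule tmap_sm[OF s tmE tmE sm_trans[OF ij]])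
qed

end

end

section \<open>The map \<open>f_t\<close> on \<open>M_t\<close>\<close>

context good_ring begin

context
  fixes E :: "('k, 'e) top_module" and M :: "('i, 'p, 'e) charted"
    and F :: "('k, 'f) top_module" and N :: "('j, 'q, 'f) charted" and f :: "'p \<rightharpoonup> 'q" and s :: 'k
  assumes M: "good_charted E M" and N: "good_charted F N" and s: "s \<in> carrier K"
    and f: "good_map E M F N f"
begin

abbreviation (input) "Ms \<equiv> tmanifold K E s M"
abbreviation (input) "Ns \<equiv> tmanifold K F s N"
abbreviation (input) "clM i a \<equiv> tglue K E s M `` {(i, a)}"
abbreviation (input) "clN i a \<equiv> tglue K F s N `` {(i, a)}"
abbreviation (input) "GM i j \<equiv> tmap K E E s (trans_map M i j)"
abbreviation (input) "GN i j \<equiv> tmap K F F s (trans_map N i j)"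
abbreviation (input) "L j i \<equiv> tmap K E F s (local_map M N f j i)"
abbreviation (input) "ft \<equiv> tmanifold_map K E F s M N f"

lemma tmEF: "topological_module K E" "topological_module K F"
  using good_chartedD(1) M N by blast+

lemma sm_local: "i \<in> index M \<Longrightarrow> j \<in> index N \<Longrightarrow> sm E F (local_map M N f j i)"
  using f by (simp add: good_map_def)

lemma smM: "i \<in> index M \<Longrightarrow> j \<in> index M \<Longrightarrow> sm E E (trans_map M i j)"
  by (rule good_chartedD(6)[OF M])

lemma smN: "i \<in> index N \<Longrightarrow> j \<in> index N \<Longrightarrow> sm F F (trans_map N i j)"
  by (rule good_chartedD(6)[OF N])

lemma L_tset:
  assumes i: "i \<in> index M" and j: "j \<in> index N" and a: "L j i a = Some b"
  shows "a \<in> tset E s (ran (chart M i))" "b \<in> tset F s (ran (chart N j))"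
proof -
  have d: "dom (local_map M N f j i) \<subseteq> ran (chart M i)"
    using local_map_eq_Some[OF M i, of N f j] by (metis domD ranI subsetI)
  have r: "ran (local_map M N f j i) \<subseteq> ran (chart N j)"
    using local_map_eq_Some[OF M i, of N f j] by (auto simp: ran_def)
  show "a \<in> tset E s (ran (chart M i))" "b \<in> tset F s (ran (chart N j))"
    using tmap_tset[OF M s tmEF sm_local[OF i j] a d r] by blast+
qed

text \<open>A local representative of \<open>f\<close> composed with a transition map is a restriction of another local representative;
  functoriality and monotonicity preserve this.\<close>

lemma L_change_source:
  assumes i: "i \<in> index M" and i': "i' \<in> index M" and j: "j \<in> index N"
    and a: "GM i i' a' = Some a" and b: "L j i a = Some b"
  shows "L j i' a' = Some b"
proof -
  have le: "local_map M N f j i \<circ>\<^sub>m trans_map M i i' \<subseteq>\<^sub>m local_map M N f j i'"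
  proof (rule map_leI)
    fix y z assume "(local_map M N f j i \<circ>\<^sub>m trans_map M i i') y = Some z"
    then obtain x p p' q where "chart M i' p = Some y" "chart M i p = Some x" "chart M i p' = Some x" "f p' = Some q" "chart N j q = Some z"
      unfolding map_comp_eq_Some local_map_eq_Some[OF M i] trans_map_eq_Some[OF M i'] by blast
    moreover then have "p = p'" using good_chartedD(2)[OF M i] unfolding pinj_def by blast
    ultimately show "local_map M N f j i' y = Some z" unfolding local_map_eq_Some[OF M i'] by blast
  qed
  have "(L j i \<circ>\<^sub>m GM i i') a' = Some b" using a b by (simp add: map_comp_eq_Some)
  then have "tmap K E F s (local_map M N f j i \<circ>\<^sub>m trans_map M i i') a' = Some b"
    unfolding tmap_comp[OF s tmEF(1,1,2) smM[OF i i'] sm_local[OF i j]] .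
  with tmap_mono[OF tmEF sm_comp[OF tmEF(1,1,2) smM[OF i i'] sm_local[OF i j]] sm_local[OF i' j] le, of s]
  show ?thesis by (rule map_leD)
qed

lemma L_change_target:
  assumes i: "i \<in> index M" and j: "j \<in> index N" and j': "j' \<in> index N"
    and a: "L j i a = Some b" and b: "GN j' j b = Some b'"
  shows "L j' i a = Some b'"
proof -
  have le: "trans_map N j' j \<circ>\<^sub>m local_map M N f j i \<subseteq>\<^sub>m local_map M N f j' i"
  proof (rule map_leI)
    fix y z assume "(trans_map N j' j \<circ>\<^sub>m local_map M N f j i) y = Some z"
    then obtain x p q q' where "chart M i p = Some y" "f p = Some q" "chart N j q = Some x" "chart N j q' = Some x" "chart N j' q' = Some z"
      unfolding map_comp_eq_Some local_map_eq_Some[OF M i] trans_map_eq_Some[OF N j] by blast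
    moreover then have "q = q'" using good_chartedD(2)[OF N j] unfolding pinj_def by blast
    ultimately show "local_map M N f j' i y = Some z" unfolding local_map_eq_Some[OF M i] by blast
  qed
  have "(GN j' j \<circ>\<^sub>m L j i) a = Some b'" using a b by (simp add: map_comp_eq_Some)
  then have "tmap K E F s (trans_map N j' j \<circ>\<^sub>m local_map M N f j i) a = Some b'"
    unfolding tmap_comp[OF s tmEF(1,2,2) sm_local[OF i j] smN[OF j' j]] .
  with tmap_mono[OF tmEF sm_comp[OF tmEF(1,2,2) sm_local[OF i j] smN[OF j' j]] sm_local[OF i j'] le, of s]
  show ?thesis by (rule map_leD)
qed

text \<open>If two charts of \<open>N\<close> both serve at a point of \<open>M_t\<close>, then both contain the images of its vertices; hence the
  corresponding values are identified in \<open>N_t\<close>.\<close>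

lemma L_targets:
  assumes i: "i \<in> index M" and j: "j \<in> index N" and j': "j' \<in> index N"
    and a: "L j i a = Some b" and a': "L j' i a = Some b'"
  shows "GN j' j b = Some b'"
proof -
  obtain x v y w y' w' where e: "a = (x, v)" "b = (y, w)" "b' = (y', w')" by (cases a; cases b; cases b') blast
  note v1 = tmap_vertices[OF s tmEF sm_local[OF i j] a[unfolded e]]
    and v2 = tmap_vertices[OF s tmEF sm_local[OF i j'] a'[unfolded e]]
  have *: "z \<in> dom (trans_map N j' j)"
    if A: "local_map M N f j i u = Some z" "local_map M N f j' i u = Some z'" for u z z'
  proof -
    obtain p q p' q' where "chart M i p = Some u" "f p = Some q" "chart N j q = Some z"
      "chart M i p' = Some u" "f p' = Some q'" "chart N j' q' = Some z'"
      using A unfolding local_map_eq_Some[OF M i] by blast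
    moreover then have "p = p'" using good_chartedD(2)[OF M i] unfolding pinj_def by blast
    ultimately have "trans_map N j' j z = Some z'" unfolding trans_map_eq_Some[OF N j] by auto
    then show ?thesis by blast
  qed
  have "b \<in> tset F s (dom (trans_map N j' j))"
    unfolding e tset_def using *[OF v1(1) v2(1)] *[OF v1(3) v2(3)] v1(2) by blast
  then obtain b2 where b2: "GN j' j b = Some b2" using dom_tmap by (metis domD)
  then have "L j' i a = Some b2" by (rule L_change_target[OF i j j' a])
  then show ?thesis using a' b2 by simp
qed

definition Pft :: "('i \<times> 'e \<times> 'e) set \<Rightarrow> ('j \<times> 'f \<times> 'f) set \<Rightarrow> bool" where
  "Pft c d \<longleftrightarrow> (\<exists>i\<in>index M. \<exists>j\<in>index N. \<exists>a b. c = clM i a \<and> L j i a = Some b \<and> d = clN j b)"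

lemma Pft_unique:
  assumes "Pft c d" "Pft c d'"
  shows "d = d'"
proof -
  obtain i j a b where 1: "i \<in> index M" "j \<in> index N" "c = clM i a" "L j i a = Some b" "d = clN j b"
    using assms(1) unfolding Pft_def by blast
  obtain i' j' a' b' where 2: "i' \<in> index M" "j' \<in> index N" "c = clM i' a'" "L j' i' a' = Some b'" "d' = clN j' b'"
    using assms(2) unfolding Pft_def by blast
  have "(i', a') \<in> clM i a"
    using in_cl_self[OF M s 2(1) L_tset(1)[OF 2(1,2,4)]] unfolding 2(3)[symmetric] unfolding 1(3) .
  then have "GM i' i a = Some a'" unfolding in_cl[OF M s] by blast
  then have "L j' i a = Some b'" using L_change_source[OF 2(1) 1(1) 2(2) _ 2(4)] by blast
  then have "GN j' j b = Some b'" by (rule L_targets[OF 1(1,2) 2(2) 1(4)])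
  then have "(j', b') \<in> clN j b" unfolding in_cl[OF N s] using 1 2 by blast
  then show ?thesis
    using cl_eq(1)[OF N s cl_in_Q[OF N s 1(2) L_tset(2)[OF 1(1,2,4)]]] 1(5) 2(5) by simp
qed

lemma ft_iff: "ft c = Some d \<longleftrightarrow> Pft c d"
proof -
  have "(c \<in> topspace (points Ms) \<and> (\<exists>i\<in>index M. \<exists>j\<in>index N. \<exists>a b. (i, a) \<in> c \<and>
      L j i a = Some b \<and> d = clN j b)) \<longleftrightarrow> Pft c d" for d
  proof
    assume "c \<in> topspace (points Ms) \<and> (\<exists>i\<in>index M. \<exists>j\<in>index N. \<exists>a b. (i, a) \<in> c \<and>
      L j i a = Some b \<and> d = clN j b)"
    then obtain i j a b where 1: "c \<in> topspace (points Ms)" "i \<in> index M" "j \<in> index N" "(i, a) \<in> c" "L j i a = Some b" "d = clN j b"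
      by (elim conjE bexE exE)
    have "c = clM i a" using cl_eq(1)[OF M s _ 1(4)] 1(1) topspace_Mt[OF M s] by simp
    then show "Pft c d" unfolding Pft_def using 1 by blast
  next
    assume "Pft c d"
    then obtain i j a b where 1: "i \<in> index M" "j \<in> index N" "c = clM i a" "L j i a = Some b" "d = clN j b"
      unfolding Pft_def by (elim conjE bexE exE)
    have "c \<in> topspace (points Ms)" "(i, a) \<in> c"
      using cl_in_Q[OF M s 1(1) L_tset(1)[OF 1(1,2,4)]] in_cl_self[OF M s 1(1) L_tset(1)[OF 1(1,2,4)]] topspace_Mt[OF M s] 1(3) by simp_all
    then show "c \<in> topspace (points Ms) \<and> (\<exists>i\<in>index M. \<exists>j\<in>index N. \<exists>a b. (i, a) \<in> c \<and>
      L j i a = Some b \<and> d = clN j b)" using 1 by (intro conjI bexI[of _ i] bexI[of _ j] exI[of _ a] exI[of _ b])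
  qed
  then have e: "ft c = (if \<exists>d. Pft c d then Some (THE d. Pft c d) else None)"
    unfolding tmanifold_map_def Let_def local_map_def[symmetric] by (simp only:)
  show ?thesis
  proof
    assume "ft c = Some d"
    then obtain d' where d': "Pft c d'" unfolding e by (metis option.distinct(1))
    then have "(THE d. Pft c d) = d'" using Pft_unique by (intro the_equality)
    then have "ft c = Some d'" unfolding e using d' by auto
    then show "Pft c d" using d' \<open>ft c = Some d\<close> by simp
  next
    assume d: "Pft c d"
    then have "(THE d. Pft c d) = d" using Pft_unique by (intro the_equality)
    then show "ft c = Some d" unfolding e using d by auto
  qed
qed

lemma Pft_cl:
  assumes i: "i \<in> index M" and j: "j \<in> index N" and a: "a \<in> tset E s (ran (chart M i))"
  shows "(\<exists>d. Pft (clM i a) d \<and> chart Ns j d = Some b) \<longleftrightarrow> L j i a = Some b"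
proof
  assume "\<exists>d. Pft (clM i a) d \<and> chart Ns j d = Some b"
  then obtain d where d: "Pft (clM i a) d" and b: "chart Ns j d = Some b" by (elim exE conjE)
  then obtain i' j' a' b' where 1: "i' \<in> index M" "j' \<in> index N" "clM i a = clM i' a'" "L j' i' a' = Some b'" "d = clN j' b'"
    unfolding Pft_def by (elim bexE exE conjE)
  have "(i', a') \<in> clM i a" using in_cl_self[OF M s 1(1) L_tset(1)[OF 1(1,2,4)]] unfolding 1(3)[symmetric] .
  then have "GM i' i a = Some a'" unfolding in_cl[OF M s] by (elim conjE)
  from L_change_source[OF 1(1) i 1(2) this 1(4)] have 2: "L j' i a = Some b'" .
  have "(j, b) \<in> clN j' b'" using b 1(5) unfolding chart_Mt[OF N s] by simp
  then have "GN j j' b' = Some b" unfolding in_cl[OF N s] by (elim conjE)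
  then show "L j i a = Some b" by (rule L_change_target[OF i 1(2) j 2])
next
  assume L: "L j i a = Some b"
  have "Pft (clM i a) (clN j b)" unfolding Pft_def using i j L by (intro bexI[of _ i] bexI[of _ j] exI[of _ a] exI[of _ b]) simp_all
  moreover have "chart Ns j (clN j b) = Some b"
    unfolding chart_Mt'[OF N s] using j L_tset(2)[OF i j L] by simp
  ultimately show "\<exists>d. Pft (clM i a) d \<and> chart Ns j d = Some b" by (intro exI conjI)
qed

text \<open>No point is gained by patching: if \<open>f_t\<close> is defined at a point through some pair of charts, and the point and its
  value lie in the charts \<open>i\<close> and \<open>j\<close>, then compatibility shows that the pair \<open>i\<close>, \<open>j\<close> could have been used.\<close>

lemma local_map_Mt:
  assumes i: "i \<in> index M" and j: "j \<in> index N"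
  shows "local_map Ms Ns ft j i = L j i"
proof (rule map_eqI)
  fix a b
  have "local_map Ms Ns ft j i a = Some b \<longleftrightarrow> (\<exists>c. (i \<in> index M \<and> a \<in> tset E s (ran (chart M i)) \<and> c = clM i a) \<and>
      (\<exists>d. Pft c d \<and> chart Ns j d = Some b))"
    unfolding local_map_def[of Ms] map_comp_eq_Some pinv_chart_Mt[OF M s] ft_iff by blast
  also have "\<dots> \<longleftrightarrow> L j i a = Some b"
    using Pft_cl[OF i j] L_tset(1)[OF i j] i by (metis (no_types, lifting))
  finally show "local_map Ms Ns ft j i a = Some b \<longleftrightarrow> L j i a = Some b" .
qed

theorem good_map_Mt: "good_map (prod_module E E) Ms (prod_module F F) Ns ft"
  unfolding good_map_def index_Mt[OF M s] index_Mt[OF N s]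
proof (intro conjI ballI)
  note EE = tm_prod[OF tmEF(1,1)] and FF = tm_prod[OF tmEF(2,2)]
  show "sm (prod_module E E) (prod_module F F) (local_map Ms Ns ft j i)" if "i \<in> index M" "j \<in> index N" for i j
    unfolding local_map_Mt[OF that] by (rule tmap_sm[OF s tmEF sm_local[OF that]])
  show "continuous_partial (points Ms) (points Ns) ft"
    unfolding continuous_partial_iff
  proof (intro conjI allI impI)
    have c: "c \<in> topspace (points Ms) \<and> d \<in> topspace (points Ns)" if P: "Pft c d" for c d
    proof -
      obtain i j a b where 1: "i \<in> index M" "j \<in> index N" "c = clM i a" "L j i a = Some b" "d = clN j b"
        using P unfolding Pft_def by (elim conjE bexE exE)
      then show ?thesis unfolding topspace_Mt[OF M s] topspace_Mt[OF N s]
        using cl_in_Q[OF M s 1(1) L_tset(1)[OF 1(1,2,4)]] cl_in_Q[OF N s 1(2) L_tset(2)[OF 1(1,2,4)]] by simp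
    qed
    show "dom ft \<subseteq> topspace (points Ms)" using c ft_iff by blast
    show "ran ft \<subseteq> topspace (points Ns)" unfolding ran_def ft_iff using c by blast
    fix W assume W: "openin (points Ns) W"
    show "openin (points Ms) {c \<in> dom ft. the (ft c) \<in> W}"
      unfolding openin_Mt[OF M s] dom_the_iff ft_iff
    proof (intro conjI ballI)
      show "{c. \<exists>d. Pft c d \<and> d \<in> W} \<subseteq> tunion E s M // tglue K E s M" using c unfolding topspace_Mt[OF M s] by blast
      fix i assume i: "i \<in> index M"
      let ?V = "\<lambda>j. {b \<in> tset F s (ran (chart N j)). clN j b \<in> W}"
      have "{a \<in> tset E s (ran (chart M i)). clM i a \<in> {c. \<exists>d. Pft c d \<and> d \<in> W}}
         = (\<Union>j\<in>index N. {a \<in> dom (L j i). the (L j i a) \<in> ?V j})" (is "?l = ?r")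
      proof (rule Set.set_eqI)
        fix a
        show "a \<in> ?l \<longleftrightarrow> a \<in> ?r"
        proof
          assume "a \<in> ?l"
          then obtain d where a: "a \<in> tset E s (ran (chart M i))" and d: "Pft (clM i a) d" "d \<in> W" by blast
          then obtain j b where jb: "j \<in> index N" "d = clN j b" "b \<in> tset F s (ran (chart N j))"
            using L_tset(2) unfolding Pft_def by metis
          then have "chart Ns j d = Some b" unfolding chart_Mt'[OF N s] by simp
          then have "L j i a = Some b" using Pft_cl[OF i jb(1) a] d(1) by blast
          then have "a \<in> {a \<in> dom (L j i). the (L j i a) \<in> ?V j}" using jb d(2) by (simp add: domI del: dom_tmap)
          then show "a \<in> ?r" using jb(1) by blast
        next
          assume "a \<in> ?r"
          then obtain j where j: "j \<in> index N" and "a \<in> {a \<in> dom (L j i). the (L j i a) \<in> ?V j}" by (rule UN_E)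
          then have a1: "a \<in> dom (L j i)" "clN j (the (L j i a)) \<in> W" by (simp_all del: dom_tmap)
          obtain b where b0: "L j i a = Some b" using domD[OF a1(1)] by (rule exE)
          then have b: "L j i a = Some b" "clN j b \<in> W" using a1(2) by simp_all
          note a = L_tset(1)[OF i j b(1)]
          obtain d where d: "Pft (clM i a) d" "chart Ns j d = Some b" using Pft_cl[OF i j a, of b] b(1) by blast
          then have "d = clN j b" unfolding chart_Mt'[OF N s] by simp
          then show "a \<in> ?l" using a d b(2) by blast
        qed
      qed
      moreover have "openin (mtop (prod_module E E)) ?r"
      proof (rule openin_Union, safe)
        fix j assume j: "j \<in> index N"
        then have "openin (mtop (prod_module F F)) (?V j)" using W unfolding openin_Mt[OF N s] by blast
        then show "openin (mtop (prod_module E E)) {a \<in> dom (L j i). the (L j i a) \<in> ?V j}"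
          by (rule continuous_partial_openD[OF sm_continuous[OF EE tmap_sm[OF s tmEF sm_local[OF i j]]]])
      qed
      ultimately show "openin (mtop (prod_module E E)) {a \<in> tset E s (ran (chart M i)). clM i a \<in> {c. \<exists>d. Pft c d \<and> d \<in> W}}"
        by simp
    qed
  qed
qed

end

text \<open>The counterpart for maps of the renaming of a manifold.\<close>

lemma good_map_relabel:
  fixes E :: "('k, 'e) top_module" and F :: "('k, 'f) top_module"
  assumes M: "good_charted E M" and N: "good_charted F N" and f: "good_map E M F N f"
    and h: "inj_on h (topspace (points M))" and g: "inj_on g (topspace (points N))"
    and E': "topological_module K E'" and c: "lin K E E' c" and c': "lin K E' E c'"
    and c'c: "\<And>x. x \<in> carrier E \<Longrightarrow> c' (c x) = x" and cc': "\<And>y. y \<in> carrier E' \<Longrightarrow> c (c' y) = y"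
    and F': "topological_module K F'" and d: "lin K F F' d"
  defines "M' \<equiv> relabel_charted h c M" and "N' \<equiv> relabel_charted g d N"
    and "f' \<equiv> map_option g \<circ> relabel_dom (topspace (points M)) h f"
  shows "i \<in> index M \<Longrightarrow> j \<in> index N \<Longrightarrow> local_map M' N' f' j i = conj_map (carrier E') c' d (local_map M N f j i)"
    and "good_map E' M' F' N' f'"
proof -
  note E = good_chartedD(1)[OF M] and F = good_chartedD(1)[OF N]
  note cl = lin_closed[OF E E' c] and cl' = lin_closed[OF E' E c']
  have fc: "continuous_partial (points M) (points N) f" using f by (simp add: good_map_def)
  then have fX: "dom f \<subseteq> topspace (points M)" "ran f \<subseteq> topspace (points N)" by (auto simp: continuous_partial_iff)
  note M' = good_charted_relabel(1)[OF M h E' c c' c'c cc', folded M'_def]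
  have ix: "index M' = index M" "index N' = index N" by (simp_all add: M'_def N'_def relabel_charted_def)
  have f'_iff: "f' y = Some z \<longleftrightarrow> (\<exists>p q. y = h p \<and> f p = Some q \<and> z = g q)" for y z
  proof
    assume "f' y = Some z"
    then obtain q where q: "y \<in> h ` topspace (points M)" "f (inv_into (topspace (points M)) h y) = Some q" "z = g q"
      by (auto simp: f'_def relabel_dom_def split: if_splits)
    then show "\<exists>p q. y = h p \<and> f p = Some q \<and> z = g q" using f_inv_into_f[OF q(1)] by metis
  next
    assume "\<exists>p q. y = h p \<and> f p = Some q \<and> z = g q"
    then obtain p q where p: "y = h p" "f p = Some q" "z = g q" by blast
    then have "p \<in> topspace (points M)" using fX(1) by blast
    then show "f' y = Some z" using p h by (simp add: f'_def relabel_dom_def)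
  qed
  have chM: "chart M' i y = Some z \<longleftrightarrow> (\<exists>x w. x \<in> topspace (points M) \<and> y = h x \<and> chart M i x = Some w \<and> z = c w)" for i y z
    using h by (auto simp: M'_def relabel_charted_def relabel_dom_def inj_on_def split: if_splits)
  have chN: "chart N' i y = Some z \<longleftrightarrow> (\<exists>x w. x \<in> topspace (points N) \<and> y = g x \<and> chart N i x = Some w \<and> z = d w)" for i y z
    using g by (auto simp: N'_def relabel_charted_def relabel_dom_def inj_on_def split: if_splits)
  have l: "local_map M' N' f' j i = conj_map (carrier E') c' d (local_map M N f j i)" if i: "i \<in> index M" and j: "j \<in> index N" for i j
  proof (rule map_eqI)
    fix y z
    have i': "i \<in> index M'" using i ix by simp
    have rM: "ran (chart M i) \<subseteq> carrier E" and dM: "dom (chart M i) \<subseteq> topspace (points M)"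
      using good_chartedD(3)[OF M i] topological_moduleD(3)[OF E] by (auto simp: continuous_partial_iff)
    show "local_map M' N' f' j i y = Some z \<longleftrightarrow> conj_map (carrier E') c' d (local_map M N f j i) y = Some z"
    proof
      assume "local_map M' N' f' j i y = Some z"
      then obtain y1 y2 where y: "chart M' i y1 = Some y" "f' y1 = Some y2" "chart N' j y2 = Some z"
        using local_map_eq_Some[OF M' i', of N' f' j y z] by blast
      obtain p w where p: "p \<in> topspace (points M)" "y1 = h p" "chart M i p = Some w" "y = c w"
        using y(1) unfolding chM by blast
      obtain p' q where q: "y1 = h p'" "f p' = Some q" "y2 = g q" using y(2) unfolding f'_iff by blast
      obtain q' u where u: "q' \<in> topspace (points N)" "y2 = g q'" "chart N j q' = Some u" "z = d u"
        using y(3) unfolding chN by blast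
      note 1 = p(1) p(2)[unfolded q(1), symmetric] p(3,4) q(2) u(2)[unfolded q(3)] u(1,3,4)
      have "p' \<in> topspace (points M)" "q \<in> topspace (points N)" using fX domI[of f, OF 1(5)] ranI[of f, OF 1(5)] by blast+
      then have "p = p'" "q = q'" using h g 1 by (auto simp: inj_on_def)
      moreover have "w \<in> carrier E" using 1(3) rM by (auto intro: ranI)
      ultimately show "conj_map (carrier E') c' d (local_map M N f j i) y = Some z"
        using 1 cl c'c by (auto simp: conj_map_apply local_map_eq_Some[OF M i])
    next
      assume "conj_map (carrier E') c' d (local_map M N f j i) y = Some z"
      then obtain p q u where 1: "y \<in> carrier E'" "chart M i p = Some (c' y)" "f p = Some q" "chart N j q = Some u" "z = d u"
        by (auto simp: conj_map_apply local_map_eq_Some[OF M i] split: if_splits)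
      then have "chart M' i (h p) = Some y" "f' (h p) = Some (g q)" "chart N' j (g q) = Some z"
        unfolding chM chN f'_iff using dM fX cc'[OF 1(1)] by (metis domI ranI subsetD)+
      then show "local_map M' N' f' j i y = Some z"
        using local_map_eq_Some[OF M' i', of N' f' j y z] by blast
    qed
  qed
  then show "i \<in> index M \<Longrightarrow> j \<in> index N \<Longrightarrow> local_map M' N' f' j i = conj_map (carrier E') c' d (local_map M N f j i)" .
  have hh: "continuous_map (points M') (points M) (inv_into (topspace (points M)) h)" "topspace (points M') = h ` topspace (points M)"
    and gg: "continuous_map (points N) (points N') g"
    using homeomorphic_maps_relabel_top[OF h] homeomorphic_maps_relabel_top[OF g] topspace_relabel_top[OF h]
    by (auto simp: M'_def N'_def relabel_charted_def homeomorphic_maps_def)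
  show "good_map E' M' F' N' f'"
    unfolding good_map_def ix
  proof (intro conjI ballI)
    show "continuous_partial (points M') (points N') f'"
      unfolding f'_def relabel_dom_pfun
      using continuous_partial_pfun[OF hh(1)] hh(2) fc gg
      by (auto intro!: continuous_partial_post continuous_partial_comp)
    fix i j assume ij: "i \<in> index M" "j \<in> index N"
    show "sm E' F' (local_map M' N' f' j i)"
      unfolding l[OF ij] using sm_conj_map[OF E' E F' F c' d] f ij by (simp add: good_map_def)
  qed
qed

end

section \<open>Maximal atlases\<close>

text \<open>Compatibility of an atlas is a condition on pairs of charts, so the union of a chain of atlases is an atlas and
  the lemma of Zorn applies. The more usual maximal atlas, consisting of all charts compatible with the given
  one, relies on gluing difference quotients and thus on their uniqueness, which may fail over \<open>K^A\<close>.\<close>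

lemma smooth_atlas_extends:
  assumes A: "smooth_atlas R E X \<A>"
  shows "\<exists>\<C>. \<A> \<subseteq> \<C> \<and> smooth_manifold R E X \<C>"
proof -
  let ?S = "{\<B>. smooth_atlas R E X \<B> \<and> \<A> \<subseteq> \<B>}"
  have "\<exists>M\<in>?S. \<forall>\<B>\<in>?S. M \<subseteq> \<B> \<longrightarrow> \<B> = M"
  proof (rule subset_Zorn_nonempty)
    show "?S \<noteq> {}" using A by blast
    fix \<C> assume ne: "\<C> \<noteq> {}" and ch: "subset.chain ?S \<C>"
    have S: "\<B> \<in> \<C> \<Longrightarrow> \<B> \<in> ?S" for \<B> using ch by (auto simp: subset_chain_def)
    have pair: "\<exists>\<B>\<in>\<C>. \<phi> \<in> \<B> \<and> \<psi> \<in> \<B>" if "\<phi> \<in> \<Union>\<C>" "\<psi> \<in> \<Union>\<C>" for \<phi> \<psi>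
    proof -
      obtain \<B> \<B>' where b: "\<B> \<in> \<C>" "\<B>' \<in> \<C>" "\<phi> \<in> \<B>" "\<psi> \<in> \<B>'" using \<open>\<phi> \<in> \<Union>\<C>\<close> \<open>\<psi> \<in> \<Union>\<C>\<close> by blast
      then have "\<B> \<subseteq> \<B>' \<or> \<B>' \<subseteq> \<B>" using ch by (auto simp: subset_chain_def)
      then show ?thesis using b by blast
    qed
    have "\<forall>\<phi>\<in>\<Union>\<C>. \<forall>\<psi>\<in>\<Union>\<C>. smooth R E E (\<phi> \<circ>\<^sub>m pinv \<psi>)"
    proof (intro ballI)
      fix \<phi> \<psi> assume "\<phi> \<in> \<Union>\<C>" "\<psi> \<in> \<Union>\<C>"
      then obtain \<B> where b: "\<B> \<in> \<C>" "\<phi> \<in> \<B>" "\<psi> \<in> \<B>" using pair by blast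
      then show "smooth R E E (\<phi> \<circ>\<^sub>m pinv \<psi>)" using S[OF b(1)] by (simp add: smooth_atlas_def)
    qed
    moreover have "(\<Union>\<phi>\<in>\<Union>\<C>. dom \<phi>) = topspace X"
    proof -
      have "(\<Union>\<phi>\<in>\<Union>\<C>. dom \<phi>) = (\<Union>\<B>\<in>\<C>. \<Union>\<phi>\<in>\<B>. dom \<phi>)" by blast
      also have "\<dots> = (\<Union>\<B>\<in>\<C>. topspace X)" by (rule SUP_cong[OF refl]) (use S in \<open>simp add: smooth_atlas_def\<close>)
      finally show ?thesis using ne by auto
    qed
    moreover have "\<forall>\<phi>\<in>\<Union>\<C>. is_chart E X \<phi>"
    proof (intro ballI)
      fix \<phi> assume "\<phi> \<in> \<Union>\<C>"
      then obtain \<B> where b: "\<B> \<in> \<C>" "\<phi> \<in> \<B>" by blast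
      then show "is_chart E X \<phi>" using S[OF b(1)] by (simp add: smooth_atlas_def)
    qed
    moreover have "\<A> \<subseteq> \<Union>\<C>" using ne S by blast
    moreover have "topological_module R E" using A by (simp add: smooth_atlas_def)
    ultimately show "\<Union>\<C> \<in> ?S" unfolding mem_Collect_eq smooth_atlas_def by (intro conjI)
  qed
  then obtain M where M: "M \<in> ?S" and max: "\<forall>\<B>\<in>?S. M \<subseteq> \<B> \<longrightarrow> \<B> = M" by (rule bexE)
  have "\<B> = M" if "smooth_atlas R E X \<B>" "M \<subseteq> \<B>" for \<B>
    using max M that by blast
  then show ?thesis using M unfolding smooth_manifold_def by (intro exI[of _ M]) simp
qed

section \<open>The iterated manifolds and maps\<close>

context good_cube begin

text \<open>A point of \<open>M_t\<close> is a class of pairs whose second entries lie in the model space, where \<open>join\<close> is injective.\<close>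

lemma inj_cube_label:
  assumes M: "good_charted E M" and E: "E = cube_space V A" and s: "s \<in> carrier K" and k: "k \<notin> A"
  shows "inj_on (cube_label A k) (topspace (points (tmanifold K E s M)))"
proof (rule inj_onI)
  let ?C = "UNIV \<times> (carrier E \<times> carrier E)" and ?j = "\<lambda>(i, a). (i, join A k a)"
  have inj: "inj_on ?j ?C"
  proof (rule inj_onI)
    fix p q assume pq: "p \<in> ?C" "q \<in> ?C" "?j p = ?j q"
    obtain i a i' a' where e: "p = (i, a)" "q = (i', a')" by (cases p; cases q) blast
    have a: "a \<in> carrier (prod_module E E)" "a' \<in> carrier (prod_module E E)" using pq(1,2) unfolding e by simp_all
    have "i = i'" "join A k a = join A k a'" using pq(3) unfolding e by simp_all
    moreover have "a = unjoin A k (join A k a)" "a' = unjoin A k (join A k a')"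
      using a unjoin_join[OF k] unfolding E by metis+
    ultimately show "p = q" unfolding e by metis
  qed
  have sub: "c \<subseteq> ?C" if "c \<in> topspace (points (tmanifold K E s M))" for c
  proof
    fix p assume p: "p \<in> c"
    obtain i a where ia: "p = (i, a)" by (cases p) blast
    have c: "c \<in> tunion E s M // tglue K E s M" using that topspace_Mt[OF M s] by simp
    note u = cl_eq(2,3)[OF M s c p[unfolded ia]]
    then show "p \<in> ?C" using ran_carrier[OF M s u(1)] ia by (auto simp: tset_def)
  qed
  fix c c' assume c: "c \<in> topspace (points (tmanifold K E s M))" "c' \<in> topspace (points (tmanifold K E s M))"
    and "cube_label A k c = cube_label A k c'"
  then have "?j ` c = ?j ` c'" by (simp add: cube_label_def)
  then show "c = c'" using inj_on_image_eq_iff[OF inj sub[OF c(1)] sub[OF c(2)]] by blast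
qed

lemma inj_on_Inl: "inj_on Inl S"
  by simp

lemma cube0_eq: "(\<lambda>x. \<lambda>B\<in>Pow {}. x) = cube0"
  by (simp add: cube0_def fun_eq_iff)

text \<open>Each step is a passage to \<open>M_t\<close> followed by a renaming, and so is each step of \<open>T\<close>.\<close>

lemma good_charted_cube_iter:
  assumes M: "good_charted V M" and "valid_list ks"
  shows "good_charted (cube_space V (set ks)) (cube_iter K t V M ks) \<and> index (cube_iter K t V M ks) = index M \<and>
    (\<forall>i\<in>index M. \<forall>j\<in>index M. trans_map (cube_iter K t V M ks) i j = T ks V V (trans_map M i j))"
  using assms(2)
proof (induction ks)
  case Nil
  note V = good_chartedD(1)[OF M]
  note R = good_charted_relabel[OF M inj_on_Inl tm_cube[OF V] cube0_lin uncube0_lin uncube0_cube0 cube0_uncube0[where V = V]]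
  show ?case
    unfolding cube_iter.simps cube0_eq T.simps list.set
    by (intro conjI ballI R) (simp_all add: relabel_charted_def)
next
  case (Cons k ks)
  note v = valid_list_Cons[OF Cons.prems] and V = good_chartedD(1)[OF M]
  let ?E = "cube_space V (set ks)" and ?M = "cube_iter K t V M ks"
  have IH: "good_charted ?E ?M" "index ?M = index M" "\<And>i j. i \<in> index M \<Longrightarrow> j \<in> index M \<Longrightarrow> trans_map ?M i j = T ks V V (trans_map M i j)"
    using Cons.IH v by blast+
  have tk: "t k \<in> carrier K" and k: "k \<notin> set ks" using v by blast+
  note R = good_charted_relabel[OF good_charted_Mt[OF IH(1) tk] inj_cube_label[OF IH(1) refl tk k] tm_cube[OF V] join_lin[OF V k] unjoin_lin
    unjoin_join[OF k, where V = V] join_unjoin[OF k, where V = V]]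
  have "index (cube_iter K t V M (k # ks)) = index M"
    using index_Mt[OF IH(1) tk] IH(2) by (simp add: relabel_charted_def)
  moreover have "trans_map (cube_iter K t V M (k # ks)) i j = T (k # ks) V V (trans_map M i j)"
    if "i \<in> index M" "j \<in> index M" for i j
    using R(2)[where i = i and j = j] trans_map_Mt[OF IH(1) tk, of i j] that IH(2,3) index_Mt[OF IH(1) tk] by (simp del: cube_space_simps)
  ultimately show ?case using R(1) by (simp del: cube_space_simps)
qed

lemma good_map_cube_iter:
  assumes M: "good_charted V M" and N: "good_charted W N" and f: "good_map V M W N f" and "valid_list ks"
  shows "good_map (cube_space V (set ks)) (cube_iter K t V M ks) (cube_space W (set ks)) (cube_iter K t W N ks)
      (cube_map_iter K t V M W N f ks) \<and>
    (\<forall>i\<in>index M. \<forall>j\<in>index N. local_map (cube_iter K t V M ks) (cube_iter K t W N ks) (cube_map_iter K t V M W N f ks) j i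
       = T ks V W (local_map M N f j i))"
  using assms(4)
proof (induction ks)
  case Nil
  note V = good_chartedD(1)[OF M] and W = good_chartedD(1)[OF N]
  note R = good_map_relabel[OF M N f inj_on_Inl inj_on_Inl tm_cube[OF V] cube0_lin uncube0_lin uncube0_cube0
    cube0_uncube0[where V = V] tm_cube[OF W] cube0_lin]
  show ?case
    unfolding cube_iter.simps cube0_eq T.simps cube_map_iter.simps list.set by (intro conjI ballI R)
next
  case (Cons k ks)
  note v = valid_list_Cons[OF Cons.prems] and V = good_chartedD(1)[OF M] and W = good_chartedD(1)[OF N]
  let ?E = "cube_space V (set ks)" and ?M = "cube_iter K t V M ks" and ?F = "cube_space W (set ks)" and ?N = "cube_iter K t W N ks"
    and ?f = "cube_map_iter K t V M W N f ks"
  have tk: "t k \<in> carrier K" and k: "k \<notin> set ks" and vk: "valid_list ks" using v by blast+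
  have cM: "good_charted ?E ?M" "index ?M = index M" using good_charted_cube_iter[OF M vk] by blast+
  have cN: "good_charted ?F ?N" "index ?N = index N" using good_charted_cube_iter[OF N vk] by blast+
  have IH: "good_map ?E ?M ?F ?N ?f" "\<And>i j. i \<in> index M \<Longrightarrow> j \<in> index N \<Longrightarrow> local_map ?M ?N ?f j i = T ks V W (local_map M N f j i)"
    using Cons.IH vk by blast+
  note R = good_map_relabel[OF good_charted_Mt[OF cM(1) tk] good_charted_Mt[OF cN(1) tk] good_map_Mt[OF cM(1) cN(1) tk IH(1)]
     inj_cube_label[OF cM(1) refl tk k] inj_cube_label[OF cN(1) refl tk k] tm_cube[OF V] join_lin[OF V k] unjoin_lin
     unjoin_join[OF k, where V = V] join_unjoin[OF k, where V = V] tm_cube[OF W] join_lin[OF W k]]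
  have "local_map (cube_iter K t V M (k # ks)) (cube_iter K t W N (k # ks)) (cube_map_iter K t V M W N f (k # ks)) j i
      = T (k # ks) V W (local_map M N f j i)" if "i \<in> index M" "j \<in> index N" for i j
    using R(1)[where i = i and j = j] local_map_Mt[OF cM(1) cN(1) tk IH(1), of i j] that IH(2) cM(2) cN(2) index_Mt[OF cM(1) tk] index_Mt[OF cN(1) tk]
    by (simp add: Let_def del: cube_space_simps)
  moreover have "good_map (cube_space V (set (k # ks))) (cube_iter K t V M (k # ks)) (cube_space W (set (k # ks)))
      (cube_iter K t W N (k # ks)) (cube_map_iter K t V M W N f (k # ks))"
    unfolding cube_iter.simps cube_map_iter.simps Let_def list.set by (rule R(2))
  ultimately show ?case by blast
qed

end

context good_ring begin

lemma pinv_dom: "is_chart E X \<psi> \<Longrightarrow> topological_module K E \<Longrightarrow> dom (g \<circ>\<^sub>m pinv \<psi>) \<subseteq> carrier E"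
proof -
  assume c: "is_chart E X \<psi>" and E: "topological_module K E"
  then have "ran \<psi> \<subseteq> carrier E" using openin_subset topological_moduleD(3)[OF E] by (metis is_chart_def)
  moreover have "dom (g \<circ>\<^sub>m pinv \<psi>) \<subseteq> ran \<psi>"
    by (auto simp: map_comp_def pinv_def split: option.splits if_splits)
  ultimately show ?thesis by blast
qed

lemma good_charted_of:
  assumes "smooth_manifold K V X \<A>"
  shows "good_charted V (charted_of X \<A>)"
proof -
  have a: "topological_module K V" "\<And>\<phi>. \<phi> \<in> \<A> \<Longrightarrow> is_chart V X \<phi>" "(\<Union>\<phi>\<in>\<A>. dom \<phi>) = topspace X"
    "\<And>\<phi> \<psi>. \<phi> \<in> \<A> \<Longrightarrow> \<psi> \<in> \<A> \<Longrightarrow> smooth K V V (\<phi> \<circ>\<^sub>m pinv \<psi>)"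
    using assms by (auto simp: smooth_manifold_def smooth_atlas_def)
  have "sm V V (\<phi> \<circ>\<^sub>m pinv \<psi>)" if "\<phi> \<in> \<A>" "\<psi> \<in> \<A>" for \<phi> \<psi>
    using a(4)[OF that] unfolding sm_def smooth_cls[OF pinv_dom[OF a(2)[OF that(2)] a(1)]] .
  then show ?thesis using a(1-3) by (simp add: good_charted_def charted_of_def trans_map_def)
qed

lemma good_map_of:
  assumes V: "smooth_manifold K V X \<A>" and f: "smooth_map K V X \<A> W Y \<B> f"
  shows "good_map V (charted_of X \<A>) W (charted_of Y \<B>) f"
proof -
  have a: "topological_module K V" "\<And>\<phi>. \<phi> \<in> \<A> \<Longrightarrow> is_chart V X \<phi>"
    using V by (auto simp: smooth_manifold_def smooth_atlas_def)
  have "sm V W (\<psi> \<circ>\<^sub>m f \<circ>\<^sub>m pinv \<phi>)" if "\<phi> \<in> \<A>" "\<psi> \<in> \<B>" for \<phi> \<psi>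
  proof -
    have "smooth K V W (\<psi> \<circ>\<^sub>m f \<circ>\<^sub>m pinv \<phi>)"
      using f that by (simp add: smooth_map_def smooth_partial_map_def)
    then show ?thesis unfolding sm_def smooth_cls[OF pinv_dom[OF a(2)[OF that(1)] a(1)]] .
  qed
  then show ?thesis using f
    by (simp add: good_map_def charted_of_def local_map_def smooth_map_def smooth_partial_map_def)
qed

end

context good_cube_list begin

lemma smooth_T:
  assumes "topological_module K E" "topological_module K F" "sm E F f"
  shows "smooth KA (VA E) (VA F) (T ks E F f)"
proof -
  have "dom (T ks E F f) \<subseteq> carrier (VA E)"
    unfolding cube_module_simps by (rule sm_dom[OF sm_T[OF ks assms]])
  then show ?thesis using cls_T[OF assms] smooth_cls by blast
qed

lemma smooth_atlas_cube_iter: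
  assumes M: "good_charted V M"
  defines "M' \<equiv> cube_iter K t V M ks"
  shows "smooth_atlas KA (VA V) (points M') (chart M' ` index M')"
proof -
  have g: "good_charted (CA V) M'" and ix: "index M' = index M"
    and tr: "\<And>i j. i \<in> index M \<Longrightarrow> j \<in> index M \<Longrightarrow> trans_map M' i j = T ks V V (trans_map M i j)"
    using good_charted_cube_iter[OF M ks] unfolding M'_def by blast+
  have V: "topological_module K V" by (rule good_chartedD(1)[OF M])
  have ch: "is_chart (VA V) (points M') (chart M' i)" if "i \<in> index M'" for i
    using g that unfolding good_charted_def is_chart_def cube_module_simps by blast
  have "smooth KA (VA V) (VA V) (chart M' i \<circ>\<^sub>m pinv (chart M' j))" if "i \<in> index M'" "j \<in> index M'" for i j
    using tr[of i j] that ix smooth_T[OF V V good_chartedD(6)[OF M, of i j]] by (simp add: trans_map_def)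
  then show ?thesis
    using ch tm_VA[OF V] good_chartedD(5)[OF g] by (simp add: smooth_atlas_def)
qed

text \<open>A point of \<open>M^A\<close> lies in some chart, its vertices lie in the corresponding chart of \<open>M\<close>, and a chart of \<open>N\<close>
  that contains the images of all vertices makes \<open>f^A\<close> defined there.\<close>

lemma smooth_cube_map_iter:
  assumes M: "good_charted V M" and N: "good_charted W N" and f: "good_map V M W N f"
  defines "M' \<equiv> cube_iter K t V M ks" and "N' \<equiv> cube_iter K t W N ks" and "f' \<equiv> cube_map_iter K t V M W N f ks"
  shows "smooth_partial_map KA (VA V) (points M') (chart M' ` index M') (VA W) (points N') (chart N' ` index N') f'"
    and "(\<And>i z. i \<in> index M \<Longrightarrow> z \<in> carrier (CA V) \<Longrightarrow> \<forall>B\<in>Pow A. vertex K t V z B \<in> ran (chart M i) \<Longrightarrow>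
       \<exists>j\<in>index N. \<forall>B\<in>Pow A. vertex K t V z B \<in> dom (local_map M N f j i)) \<Longrightarrow> dom f' = topspace (points M')"
proof -
  have V: "topological_module K V" and W: "topological_module K W"
    using good_chartedD(1) M N by blast+
  have g: "good_charted (CA V) M'" and ix: "index M' = index M" "index N' = index N"
    and tr: "\<And>i j. i \<in> index M \<Longrightarrow> j \<in> index M \<Longrightarrow> trans_map M' i j = T ks V V (trans_map M i j)"
    using good_charted_cube_iter[OF M ks] good_charted_cube_iter[OF N ks] unfolding M'_def N'_def by blast+
  have gf: "good_map (CA V) M' (CA W) N' f'"
    and lm: "\<And>i j. i \<in> index M \<Longrightarrow> j \<in> index N \<Longrightarrow> local_map M' N' f' j i = T ks V W (local_map M N f j i)"
    using good_map_cube_iter[OF M N f ks] unfolding M'_def N'_def f'_def by blast+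
  have sl: "sm V W (local_map M N f j i)" if "i \<in> index M" "j \<in> index N" for i j
    using f that by (simp add: good_map_def)
  have "smooth KA (VA V) (VA W) (chart N' j \<circ>\<^sub>m f' \<circ>\<^sub>m pinv (chart M' i))" if "i \<in> index M'" "j \<in> index N'" for i j
    using lm[of i j] that ix smooth_T[OF V W sl[of i j]] by (simp add: local_map_def)
  moreover have cf: "continuous_partial (points M') (points N') f'" using gf by (simp add: good_map_def)
  ultimately show "smooth_partial_map KA (VA V) (points M') (chart M' ` index M') (VA W) (points N') (chart N' ` index N') f'"
    by (simp add: smooth_partial_map_def)
  assume ex: "\<And>i z. i \<in> index M \<Longrightarrow> z \<in> carrier (CA V) \<Longrightarrow> \<forall>B\<in>Pow A. vertex K t V z B \<in> ran (chart M i) \<Longrightarrow>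
       \<exists>j\<in>index N. \<forall>B\<in>Pow A. vertex K t V z B \<in> dom (local_map M N f j i)"
  show "dom f' = topspace (points M')"
  proof
    show "dom f' \<subseteq> topspace (points M')" using cf by (simp add: continuous_partial_iff)
    show "topspace (points M') \<subseteq> dom f'"
    proof
      fix c assume "c \<in> topspace (points M')"
      then obtain i where i: "i \<in> index M" and "c \<in> dom (chart M' i)"
        unfolding good_chartedD(5)[OF g, symmetric] ix by blast
      then obtain z where z: "chart M' i c = Some z" by blast
      then have "trans_map M' i i z = Some z" using trans_map_eq_Some[OF g, of i i z z] i ix by blast
      then have "z \<in> dom (T ks V V (trans_map M i i))" using tr[OF i i] by (metis domI)
      then have zc: "z \<in> carrier (CA V)" and "\<forall>B\<in>Pow A. vertex K t V z B \<in> dom (trans_map M i i)"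
        unfolding dom_T[OF ks V V sm_dom[OF good_chartedD(6)[OF M i i]]] by blast+
      moreover have "dom (trans_map M i i) \<subseteq> ran (chart M i)"
        by (auto simp: trans_map_def map_comp_def pinv_def split: option.splits if_splits)
      ultimately obtain j where j: "j \<in> index N" and "\<forall>B\<in>Pow A. vertex K t V z B \<in> dom (local_map M N f j i)"
        using ex[OF i zc] by blast
      then have "z \<in> dom (T ks V W (local_map M N f j i))"
        unfolding dom_T[OF ks V W sm_dom[OF sl[OF i j]]] using zc by blast
      then obtain y where "local_map M' N' f' j i z = Some y" unfolding lm[OF i j, symmetric] by blast
      then obtain p where "chart M' i p = Some z" "p \<in> dom f'"
        using local_map_eq_Some[OF g, of i N' f' j z y] i ix by blast
      moreover then have "p = c" using good_chartedD(2)[OF g, of i] i ix z unfolding pinj_def by blast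
      ultimately show "c \<in> dom f'" by simp
    qed
  qed
qed

end

theorem theorem6p9:
  fixes K :: "'k top_ring" and V :: "('k, 'v) top_module"
    and X :: "'p topology" and \<A> :: "('p \<rightharpoonup> 'v) set"
    and n :: nat and t :: "nat \<Rightarrow> 'k" and A :: "nat set"
  assumes "good_topological_ring K"
    and "smooth_manifold K V X \<A>" and "Hausdorff_space X"
    and "t \<in> {1..n} \<rightarrow> carrier K" and "A \<subseteq> {1..n}"
  shows "smooth_atlas (cube_ring K t A) (cube_module K t V A)
           (cube_points K t A V X \<A>) (cube_charts K t A V X \<A>) \<and>
         (\<exists>\<C>. cube_charts K t A V X \<A> \<subseteq> \<C> \<and>
           smooth_manifold (cube_ring K t A) (cube_module K t V A) (cube_points K t A V X \<A>) \<C>) \<and>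
         (\<forall>(W :: ('k, 'w) top_module) (Y :: 'q topology) \<B> f.
           smooth_manifold K W Y \<B> \<and> Hausdorff_space Y \<and> smooth_map K V X \<A> W Y \<B> f \<longrightarrow>
           smooth_partial_map (cube_ring K t A)
             (cube_module K t V A) (cube_points K t A V X \<A>) (cube_charts K t A V X \<A>)
             (cube_module K t W A) (cube_points K t A W Y \<B>) (cube_charts K t A W Y \<B>)
             (cube_map K t A V X \<A> W Y \<B> f) \<and>
           (vertices_in_charts K t A V \<A> \<B> f \<longrightarrow>
              smooth_map (cube_ring K t A)
                (cube_module K t V A) (cube_points K t A V X \<A>) (cube_charts K t A V X \<A>)
                (cube_module K t W A) (cube_points K t A W Y \<B>) (cube_charts K t A W Y \<B>)
                (cube_map K t A V X \<A> W Y \<B> f)))"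
proof -
  define ks where "ks = rev (sorted_list_of_set A)"
  have fin: "finite A" using assms(5) finite_subset by blast
  then have set: "set ks = A" "distinct ks" by (simp_all add: ks_def)
  interpret good_cube K t by unfold_locales (rule assms(1))
  have "valid_list ks" using set fin assms(4,5) by (auto simp: valid_list_def valid_def)
  then interpret good_cube_list K t ks by unfold_locales
  note M = good_charted_of[OF assms(2)]
  have iM: "index (charted_of X \<A>) = \<A>" "chart (charted_of X \<A>) \<phi> = \<phi>" for \<phi> by (simp_all add: charted_of_def)
  have atlas: "smooth_atlas (cube_ring K t A) (cube_module K t V A)
           (cube_points K t A V X \<A>) (cube_charts K t A V X \<A>)"
    using smooth_atlas_cube_iter[OF M] unfolding set cube_charts_def cube_manifold_def ks_def[symmetric] .
  have "smooth_partial_map (cube_ring K t A)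
             (cube_module K t V A) (cube_points K t A V X \<A>) (cube_charts K t A V X \<A>)
             (cube_module K t W A) (cube_points K t A W Y \<B>) (cube_charts K t A W Y \<B>)
             (cube_map K t A V X \<A> W Y \<B> f)" (is ?p)
    and "vertices_in_charts K t A V \<A> \<B> f \<longrightarrow> dom (cube_map K t A V X \<A> W Y \<B> f) = topspace (cube_points K t A V X \<A>)" (is ?d)
    if W: "smooth_manifold K W Y \<B>" and f: "smooth_map K V X \<A> W Y \<B> f"
    for W :: "('k, 'w) top_module" and Y :: "'q topology" and \<B> f
  proof -
    note N = good_charted_of[OF W] and gf = good_map_of[OF assms(2) f]
    have iN: "index (charted_of Y \<B>) = \<B>" "chart (charted_of Y \<B>) \<psi> = \<psi>" for \<psi> by (simp_all add: charted_of_def)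
    note S = smooth_cube_map_iter[OF M N gf, unfolded set]
    show ?p using S(1) unfolding cube_charts_def cube_manifold_def cube_map_def ks_def[symmetric] .
    show ?d
      using S(2) unfolding cube_manifold_def cube_map_def ks_def[symmetric] vertices_in_charts_def iM iN local_map_def by blast
  qed
  then show ?thesis
    using atlas smooth_atlas_extends[OF atlas] unfolding smooth_map_def by blast
qed

end
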